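(* Let $F$ be a one-dimensional CA (on $S^{\mathbb{Z}}$) with neighbourhood $\mathcal{N}=\{0,1\}$ and spreading symbol $\alpha\in S$. There exists an $\varepsilon_{\mathsf c}>0$ such that for every $\varepsilon<\varepsilon_{\mathsf c}$, every $\alpha$-positive $\varepsilon$-perturbation of $F$ is uniformly ergodic, with an invariant measure that is spatially mixing and admits a perfect sampling algorithm.
   Context: Let $S$ be a finite set and $\mathcal{X}=S^{\mathbb{Z}}$ with the product topology. For finite $K\subseteq\mathbb{Z}$ and $y_K\in S^K$, the cylinder $[y_K]$ is $\{x\in\mathcal{X}: x_k=y_k\ \forall k\in K\}$. For $k\in\mathbb{Z}$ the shift is $(\sigma^k x)_i=x_{k+i}$. A CA with neighbourhood $\{0,1\}$ and local rule $f:S^2\to S$ is the map $(Fx)_k=f(x_k,x_{k+1})$. A symbol $\alpha$ is spreading under $F$ if $(Fx)_k=\alpha$ whenever $x_k=\alpha$ or $x_{k+1}=\alpha$. A probabilistic cellular automaton (PCA) with neighbourhood $\{0,1\}$ and local rule $\varphi:S^2\times S\to[0,1]$ (a stochastic matrix) is the Markov kernel $\Phi$ on $\mathcal{X}$ with $\Phi(x,[y_K])=\prod_{k\in K}\varphi(x_k,x_{k+1})(y_k)$ for every cylinder. Such a PCA is an $\varepsilon$-perturbation of $F$ if $\varphi(a_0,a_1)\big(f(a_0,a_1)\big)\ge1-\varepsilon$ for all $a_0,a_1\in S$; it is $\alpha$-positive if $\varphi(a_0,a_1)(\alpha)>0$ for all $a_0,a_1\in S$. A Borel probability measure $\pi$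 on $\mathcal{X}$ is invariant if $\pi\Phi=\pi$. $\Phi$ is uniformly ergodic if it has a unique invariant measure $\pi$ and $\Phi^t(x,[u])\to\pi([u])$ as $t\to\infty$, uniformly in $x\in\mathcal{X}$, for each cylinder $[u]$. $\pi$ is spatially mixing if $\lim_{|k|\to\infty}\pi([u]\cap\sigma^{-k}[v])=\pi([u])\pi([v])$ for all cylinders $[u],[v]$. A perfect sampling algorithm for a probability measure $\mu$ on $\mathcal{X}$ is an algorithm that, given a finite set $A\subseteq\mathbb{Z}$ and using an unbounded source of independent uniform samples from $[0,1]$ (and with access to a symbolic presentation of the real transition probabilities of the PCA), outputs a random pattern $W_A\in S^A$ with $\mathbb{P}(W_A=w)=\mu([w])$ for all $w\in S^A$. *)

theory Defs
  imports "HOL-Probability.Probability"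
begin

text \<open>The finite alphabet \<open>S\<close> is a type \<open>'a\<close> of class \<^class>\<open>finite\<close>.\<close>

section \<open>Configurations and deterministic cellular automata\<close>

type_synonym 'a config = "int \<Rightarrow> 'a"

text \<open>A pattern in \<open>S\<^sup>K\<close> is given by a total function, of which only the values on \<open>K\<close> matter.\<close>

definition cyl :: "int set \<Rightarrow> 'a config \<Rightarrow> 'a config set" where
  "cyl K y = {x. \<forall>k\<in>K. x k = y k}"

definition shift :: "int \<Rightarrow> 'a config \<Rightarrow> 'a config" where
  "shift k x = (\<lambda>i. x (k + i))"

definition ca_map :: "('a \<Rightarrow> 'a \<Rightarrow> 'a) \<Rightarrow> 'a config \<Rightarrow> 'a config" where
  "ca_map f x = (\<lambda>k. f (x k) (x (k + 1)))"

definition spreading :: "('a config \<Rightarrow> 'a config) \<Rightarrow> 'a \<Rightarrow> bool" where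
  "spreading F \<alpha> \<longleftrightarrow> (\<forall>x k. x k = \<alpha> \<or> x (k + 1) = \<alpha> \<longrightarrow> F x k = \<alpha>)"

text \<open>The product \<open>\<sigma>\<close>-algebra; it is the Borel \<open>\<sigma>\<close>-algebra of the product topology
  (\<open>sets_cfg_space_eq_borel\<close> below).\<close>

definition cfg_space :: "'a config measure" where
  "cfg_space = PiM UNIV (\<lambda>_. count_space UNIV)"


section \<open>Probabilistic cellular automata\<close>

text \<open>A stochastic matrix \<open>\<phi> : S\<^sup>2 \<times> S \<rightarrow> [0,1]\<close> is a family of \<open>pmf\<close>s: the entry
  \<open>\<phi>(a,b)(c)\<close> is \<open>pmf (\<phi> a b) c\<close>. The kernel draws all cells independently; by
  \<open>measure_pca_cyl\<close> and \<open>pca_kernel\<close> below it is the Markov kernel with the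
  prescribed values on cylinders.\<close>

definition pca :: "('a \<Rightarrow> 'a \<Rightarrow> 'a pmf) \<Rightarrow> 'a config \<Rightarrow> 'a config measure" where
  "pca \<phi> x = PiM UNIV (\<lambda>k. measure_pmf (\<phi> (x k) (x (k + 1))))"

definition perturbation :: "real \<Rightarrow> ('a \<Rightarrow> 'a \<Rightarrow> 'a) \<Rightarrow> ('a \<Rightarrow> 'a \<Rightarrow> 'a pmf) \<Rightarrow> bool" where
  "perturbation \<epsilon> f \<phi> \<longleftrightarrow> (\<forall>a b. pmf (\<phi> a b) (f a b) \<ge> 1 - \<epsilon>)"

definition positive_at :: "'a \<Rightarrow> ('a \<Rightarrow> 'a \<Rightarrow> 'a pmf) \<Rightarrow> bool" where
  "positive_at \<alpha> \<phi> \<longleftrightarrow> (\<forall>a b. pmf (\<phi> a b) \<alpha> > 0)"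

definition invariant_measure ::
    "('a config \<Rightarrow> 'a config measure) \<Rightarrow> 'a config measure \<Rightarrow> bool" where
  "invariant_measure \<Phi> \<pi> \<longleftrightarrow> \<pi> \<in> space (prob_algebra cfg_space) \<and> \<pi> \<bind> \<Phi> = \<pi>"

primrec kernel_pow ::
    "('a config \<Rightarrow> 'a config measure) \<Rightarrow> nat \<Rightarrow> 'a config \<Rightarrow> 'a config measure" where
  "kernel_pow \<Phi> 0 x = return cfg_space x"
| "kernel_pow \<Phi> (Suc t) x = kernel_pow \<Phi> t x \<bind> \<Phi>"

text \<open>Uniform ergodicity, with the unique invariant measure \<open>\<pi>\<close> made explicit.\<close>

definition uniformly_ergodic_to ::
    "('a config \<Rightarrow> 'a config measure) \<Rightarrow> 'a config measure \<Rightarrow> bool" where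
  "uniformly_ergodic_to \<Phi> \<pi> \<longleftrightarrow>
     invariant_measure \<Phi> \<pi> \<and>
     (\<forall>\<pi>'. invariant_measure \<Phi> \<pi>' \<longrightarrow> \<pi>' = \<pi>) \<and>
     (\<forall>K u. finite K \<longrightarrow>
        uniform_limit UNIV (\<lambda>t x. measure (kernel_pow \<Phi> t x) (cyl K u))
          (\<lambda>_. measure \<pi> (cyl K u)) sequentially)"

text \<open>\<^term>\<open>filtercomap (\<lambda>k::int. \<bar>k\<bar>) at_top\<close> is the filter \<open>|k| \<rightarrow> \<infinity>\<close>.\<close>

definition spatially_mixing :: "'a config measure \<Rightarrow> bool" where
  "spatially_mixing \<pi> \<longleftrightarrow>
     (\<forall>K u L v. finite K \<longrightarrow> finite L \<longrightarrow>
        ((\<lambda>k. measure \<pi> (cyl K u \<inter> shift (- k) ` cyl L v))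
           \<longlongrightarrow> measure \<pi> (cyl K u) * measure \<pi> (cyl L v)) (filtercomap (\<lambda>k::int. \<bar>k\<bar>) at_top))"


section \<open>Perfect sampling algorithms\<close>

text \<open>Algorithms are programs of a real-number random access machine: one indirectly
  addressed memory of integers, one of real numbers with exact field operations and
  comparisons, and a command that draws a fresh uniform sample from \<open>[0,1]\<close>. The only
  real constants are integers and the symbols \<open>RProb a b c\<close>, which stand for the transition
  probabilities; arbitrary real constants would let a program carry non-computable data.\<close>

datatype iexp =
    IConst int
  | IMem iexp
  | IAdd iexp iexp
  | ISub iexp iexp
  | IMul iexp iexp
  | IDiv iexp iexp
  | IMod iexp iexp

datatype 'a rexp =
    ROfInt iexp
  | RMem iexp
  | RProb 'a 'a 'a
  | RAdd "'a rexp" "'a rexp"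
  | RSub "'a rexp" "'a rexp"
  | RMul "'a rexp" "'a rexp"
  | RDiv "'a rexp" "'a rexp"

datatype 'a bexp =
    ILess iexp iexp
  | RLess "'a rexp" "'a rexp"
  | BNot "'a bexp"
  | BAnd "'a bexp" "'a bexp"

datatype 'a com =
    Skip
  | IAssign iexp iexp
  | RAssign iexp "'a rexp"
  | Draw iexp
  | Seq "'a com" "'a com"
  | Cond "'a bexp" "'a com" "'a com"
  | While "'a bexp" "'a com"

record mstate =
  imem :: "int \<Rightarrow> int"
  rmem :: "int \<Rightarrow> real"
  drawn :: nat  \<comment> \<open>number of samples consumed so far\<close>

primrec ival :: "mstate \<Rightarrow> iexp \<Rightarrow> int" where
  "ival s (IConst n) = n"
| "ival s (IMem e) = imem s (ival s e)"
| "ival s (IAdd e1 e2) = ival s e1 + ival s e2"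
| "ival s (ISub e1 e2) = ival s e1 - ival s e2"
| "ival s (IMul e1 e2) = ival s e1 * ival s e2"
| "ival s (IDiv e1 e2) = ival s e1 div ival s e2"
| "ival s (IMod e1 e2) = ival s e1 mod ival s e2"

primrec rval :: "('a \<Rightarrow> 'a \<Rightarrow> 'a pmf) \<Rightarrow> mstate \<Rightarrow> 'a rexp \<Rightarrow> real" where
  "rval \<phi> s (ROfInt e) = real_of_int (ival s e)"
| "rval \<phi> s (RMem e) = rmem s (ival s e)"
| "rval \<phi> s (RProb a b c) = pmf (\<phi> a b) c"
| "rval \<phi> s (RAdd e1 e2) = rval \<phi> s e1 + rval \<phi> s e2"
| "rval \<phi> s (RSub e1 e2) = rval \<phi> s e1 - rval \<phi> s e2"
| "rval \<phi> s (RMul e1 e2) = rval \<phi> s e1 * rval \<phi> s e2"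
| "rval \<phi> s (RDiv e1 e2) = rval \<phi> s e1 / rval \<phi> s e2"

primrec bval :: "('a \<Rightarrow> 'a \<Rightarrow> 'a pmf) \<Rightarrow> mstate \<Rightarrow> 'a bexp \<Rightarrow> bool" where
  "bval \<phi> s (ILess e1 e2) \<longleftrightarrow> ival s e1 < ival s e2"
| "bval \<phi> s (RLess e1 e2) \<longleftrightarrow> rval \<phi> s e1 < rval \<phi> s e2"
| "bval \<phi> s (BNot b) \<longleftrightarrow> \<not> bval \<phi> s b"
| "bval \<phi> s (BAnd b1 b2) \<longleftrightarrow> bval \<phi> s b1 \<and> bval \<phi> s b2"

text \<open>\<open>exec \<phi> \<omega> c s s'\<close>: started in \<open>s\<close>, the program \<open>c\<close> halts in \<open>s'\<close>, where \<open>\<omega>\<close> is the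
  sequence of samples.\<close>

inductive exec ::
    "('a \<Rightarrow> 'a \<Rightarrow> 'a pmf) \<Rightarrow> (nat \<Rightarrow> real) \<Rightarrow> 'a com \<Rightarrow> mstate \<Rightarrow> mstate \<Rightarrow> bool"
  for \<phi> \<omega> where
  exec_Skip: "exec \<phi> \<omega> Skip s s"
| exec_IAssign: "exec \<phi> \<omega> (IAssign l e) s (s\<lparr>imem := (imem s)(ival s l := ival s e)\<rparr>)"
| exec_RAssign: "exec \<phi> \<omega> (RAssign l e) s (s\<lparr>rmem := (rmem s)(ival s l := rval \<phi> s e)\<rparr>)"
| exec_Draw: "exec \<phi> \<omega> (Draw l) s
    (s\<lparr>rmem := (rmem s)(ival s l := \<omega> (drawn s)), drawn := Suc (drawn s)\<rparr>)"
| exec_Seq: "exec \<phi> \<omega> c1 s s' \<Longrightarrow> exec \<phi> \<omega> c2 s' s'' \<Longrightarrow> exec \<phi> \<omega> (Seq c1 c2) s s''"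
| exec_CondT: "bval \<phi> s b \<Longrightarrow> exec \<phi> \<omega> c1 s s' \<Longrightarrow> exec \<phi> \<omega> (Cond b c1 c2) s s'"
| exec_CondF: "\<not> bval \<phi> s b \<Longrightarrow> exec \<phi> \<omega> c2 s s' \<Longrightarrow> exec \<phi> \<omega> (Cond b c1 c2) s s'"
| exec_WhileF: "\<not> bval \<phi> s b \<Longrightarrow> exec \<phi> \<omega> (While b c) s s"
| exec_WhileT: "bval \<phi> s b \<Longrightarrow> exec \<phi> \<omega> c s s' \<Longrightarrow> exec \<phi> \<omega> (While b c) s' s''
    \<Longrightarrow> exec \<phi> \<omega> (While b c) s s''"

text \<open>A finite \<open>A = {a\<^sub>1 < \<dots> < a\<^sub>n}\<close> is presented as \<open>n, a\<^sub>1, \<dots>, a\<^sub>n\<close> in the integer cells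
  \<open>0, 1, \<dots>, n\<close>; the output pattern \<open>W\<close> is read off as \<open>W(a\<^sub>1), \<dots>, W(a\<^sub>n)\<close> in the cells
  \<open>1, \<dots>, n\<close>, symbols being represented by integer codes.\<close>

definition input_state :: "int set \<Rightarrow> mstate" where
  "input_state A =
     \<lparr>imem = (\<lambda>i. if i = 0 then int (card A)
                  else if 1 \<le> i \<and> i \<le> int (card A) then sorted_list_of_set A ! nat (i - 1)
                  else 0),
      rmem = (\<lambda>_. 0),
      drawn = 0\<rparr>"

definition has_output :: "('a \<Rightarrow> int) \<Rightarrow> int set \<Rightarrow> mstate \<Rightarrow> 'a config \<Rightarrow> bool" where
  "has_output code A s w \<longleftrightarrow>
     (\<forall>i<card A. imem s (int i + 1) = code (w (sorted_list_of_set A ! i)))"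

definition uniform_samples :: "(nat \<Rightarrow> real) measure" where
  "uniform_samples = PiM UNIV (\<lambda>_. uniform_measure lborel {0..1})"

definition perfect_sampling_algorithm ::
    "('a \<Rightarrow> int) \<Rightarrow> ('a \<Rightarrow> 'a \<Rightarrow> 'a pmf) \<Rightarrow> 'a config measure \<Rightarrow> 'a com \<Rightarrow> bool" where
  "perfect_sampling_algorithm code \<phi> \<mu> c \<longleftrightarrow>
     (\<forall>A. finite A \<longrightarrow>
        (AE \<omega> in uniform_samples. \<exists>s. exec \<phi> \<omega> c (input_state A) s) \<and>
        (\<forall>w. {\<omega>. \<exists>s. exec \<phi> \<omega> c (input_state A) s \<and> has_output code A s w}
                 \<in> sets uniform_samples \<and>
             measure uniform_samples
               {\<omega>. \<exists>s. exec \<phi> \<omega> c (input_state A) s \<and> has_output code A s w}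
             = measure \<mu> (cyl A w)))"

definition admits_perfect_sampling ::
    "('a \<Rightarrow> 'a \<Rightarrow> 'a pmf) \<Rightarrow> 'a config measure \<Rightarrow> bool" where
  "admits_perfect_sampling \<phi> \<mu> \<longleftrightarrow>
     (\<forall>code. inj code \<longrightarrow> (\<exists>c. perfect_sampling_algorithm code \<phi> \<mu> c))"


section \<open>Adequacy of the probabilistic encoding\<close>

lemma space_cfg_space [simp]: "space cfg_space = UNIV"
  by (simp add: cfg_space_def space_PiM)

lemma cyl_eq_prod_emb:
  "cyl K y = prod_emb UNIV (\<lambda>_. count_space UNIV) K (Pi\<^sub>E K (\<lambda>k. {y k}))"
  by (auto simp: cyl_def prod_emb_def PiE_iff)

lemma cyl_sets [measurable]: "finite K \<Longrightarrow> cyl K y \<in> sets cfg_space"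
  unfolding cfg_space_def cyl_eq_prod_emb by (rule sets_PiM_I) auto

lemma sets_pca [simp]: "sets (pca \<phi> x) = sets cfg_space"
  unfolding pca_def cfg_space_def by (rule sets_PiM_cong) auto

lemma prob_space_pca: "prob_space (pca \<phi> x)"
  unfolding pca_def by (intro prob_space_PiM) (rule measure_pmf.prob_space_axioms)

lemma measure_pca_cyl:
  assumes "finite K"
  shows "measure (pca \<phi> x) (cyl K y) = (\<Prod>k\<in>K. pmf (\<phi> (x k) (x (k + 1))) (y k))"
proof -
  interpret product_prob_space "\<lambda>k. measure_pmf (\<phi> (x k) (x (k + 1)))" UNIV
    by unfold_locales
  have "cyl K y = prod_emb UNIV (\<lambda>k. measure_pmf (\<phi> (x k) (x (k + 1)))) K (Pi\<^sub>E K (\<lambda>k. {y k}))"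
    by (auto simp: cyl_def prod_emb_def PiE_iff)
  then show ?thesis
    unfolding pca_def using assms by (simp add: measure_PiM_emb pmf.rep_eq)
qed

lemma pca_kernel:
  fixes \<phi> :: "'a::finite \<Rightarrow> 'a \<Rightarrow> 'a pmf"
  shows "pca \<phi> \<in> cfg_space \<rightarrow>\<^sub>M prob_algebra cfg_space"
proof (rule measurable_prob_algebra_generated)
  let ?G = "prod_algebra UNIV (\<lambda>_::int. count_space (UNIV :: 'a set))"
  show "sets cfg_space = sigma_sets UNIV ?G"
    by (simp add: cfg_space_def sets_PiM)
  show "Int_stable ?G"
    by (rule Int_stable_prod_algebra)
  show "?G \<subseteq> Pow UNIV"
    by simp
  fix A assume "A \<in> ?G"
  then obtain J X where A: "A = prod_emb UNIV (\<lambda>_. count_space UNIV) J (Pi\<^sub>E J X)" "finite J"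
    by (rule prod_algebraE)
  have comp: "(\<lambda>x. x k) \<in> cfg_space \<rightarrow>\<^sub>M count_space (UNIV :: 'a set)" for k
    unfolding cfg_space_def by measurable
  have "emeasure (pca \<phi> x) A = (\<Prod>j\<in>J. emeasure (measure_pmf (\<phi> (x j) (x (j + 1)))) (X j))" for x
  proof -
    have "A = prod_emb UNIV (\<lambda>k. measure_pmf (\<phi> (x k) (x (k + 1)))) J (Pi\<^sub>E J X)"
      by (simp add: A prod_emb_def)
    then show ?thesis
      unfolding pca_def using A(2)
      by (simp add: emeasure_PiM_emb measure_pmf.prob_space_axioms)
  qed
  moreover have "(\<lambda>x. \<Prod>j\<in>J. emeasure (measure_pmf (\<phi> (x j) (x (j + 1)))) (X j))
      \<in> borel_measurable cfg_space"
  proof (rule borel_measurable_prod_ennreal)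
    fix j
    have "(\<lambda>x. (x j, x (j + 1))) \<in> cfg_space \<rightarrow>\<^sub>M count_space (UNIV :: ('a \<times> 'a) set)"
      using comp[of j] comp[of "j + 1"] by (simp add: measurable_Pair pair_measure_countable[symmetric])
    from measurable_compose[OF this, of "\<lambda>(a, b). emeasure (measure_pmf (\<phi> a b)) (X j)" borel]
    show "(\<lambda>x. emeasure (measure_pmf (\<phi> (x j) (x (j + 1)))) (X j)) \<in> borel_measurable cfg_space"
      by simp
  qed
  ultimately show "(\<lambda>x. emeasure (pca \<phi> x) A) \<in> borel_measurable cfg_space"
    by simp
qed (auto simp: prob_space_pca)

lemma sets_cfg_space_eq_borel:
  "sets (cfg_space :: 'a::finite config measure) =
     sigma_sets UNIV {U. openin (product_topology (\<lambda>_. discrete_topology UNIV) UNIV) U}"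
    (is "_ = sigma_sets UNIV ?O")
proof
  have "sets (cfg_space :: 'a config measure) = sigma_sets UNIV
      {{x. x i \<in> B} | i B. True}"
    unfolding cfg_space_def sets_PiM_single by (rule arg_cong2[where f=sigma_sets]) auto
  also have "\<dots> \<subseteq> sigma_sets UNIV ?O"
  proof (rule sigma_sets_mono, safe)
    fix i :: int and B :: "'a set"
    have "openin (product_topology (\<lambda>_. discrete_topology UNIV) UNIV) 
        {x \<in> topspace (product_topology (\<lambda>_::int. discrete_topology UNIV) UNIV). x i \<in> B}"
      by (rule openin_continuous_map_preimage[OF continuous_map_product_projection[of i UNIV]]) auto
    then show "{x. x i \<in> B} \<in> sigma_sets UNIV ?O"
      by (intro sigma_sets.Basic) simp
  qed
  finally show "sets (cfg_space :: 'a config measure) \<subseteq> sigma_sets UNIV ?O" .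
next
  define g :: "(int \<times> 'a) set \<Rightarrow> 'a config set" where "g P = {x. \<forall>(k, a)\<in>P. x k = a}" for P
  have cyl_g: "cyl K y = g ((\<lambda>k. (k, y k)) ` K)" for K y
    by (auto simp: cyl_def g_def)
  have "U \<in> sets cfg_space" if "U \<in> ?O" for U :: "'a config set"
  proof -
    let ?C = "{P. finite P \<and> g P \<subseteq> U \<and> g P \<in> sets cfg_space}"
    have "countable ?C"
      by (rule countable_subset[OF _ countable_Collect_finite]) auto
    then have "(\<Union>P\<in>?C. g P) \<in> sets cfg_space"
      by (intro sets.countable_UN'') auto
    moreover have "U = (\<Union>P\<in>?C. g P)"
    proof
      show "U \<subseteq> (\<Union>P\<in>?C. g P)"
      proof
        fix x assume "x \<in> U"
        with that obtain V where V: "finite {i. V i \<noteq> UNIV}" "x \<in> Pi\<^sub>E UNIV V" "Pi\<^sub>E UNIV V \<subseteq> U"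
          by (auto simp: openin_product_topology_alt)
        let ?K = "{i. V i \<noteq> UNIV}"
        have "cyl ?K x \<subseteq> Pi\<^sub>E UNIV V"
        proof
          fix z assume z: "z \<in> cyl ?K x"
          have "z i \<in> V i" for i
            using z V(2) by (cases "V i = UNIV") (auto simp: cyl_def PiE_iff)
          then show "z \<in> Pi\<^sub>E UNIV V" by auto
        qed
        then have "(\<lambda>k. (k, x k)) ` ?K \<in> ?C"
          using V cyl_sets[OF V(1), of x] by (auto simp: cyl_g)
        moreover have "x \<in> g ((\<lambda>k. (k, x k)) ` ?K)"
          by (auto simp: g_def)
        ultimately show "x \<in> (\<Union>P\<in>?C. g P)" by blast
      qed
    qed auto
    ultimately show ?thesis by simp
  qed
  then show "sigma_sets UNIV ?O \<subseteq> sets (cfg_space :: 'a config measure)"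
    by (metis (no_types, lifting) sets.sigma_sets_subset space_cfg_space subsetI)
qed

end

theory Submission
  imports Defs
begin

text \<open>The PCA is run from the past with one uniform sample \<open>u\<close> per space-time site. A site
  with small \<open>u\<close> becomes \<open>\<alpha>\<close> whatever its parents are; a site with
  \<open>u \<ge> 1 - eps\<close> is an error; any other site with a parent \<open>\<alpha>\<close> becomes \<open>\<alpha>\<close>.
  Whether the value of a site is determined by the samples of the last \<open>n\<close> rows is tracked by an
  envelope process with an extra symbol \<open>None\<close>. If it is not determined, then there is a path of
  \<open>None\<close> sites to the horizon. A site on it whose open (error free) ancestry reaches the horizon
  has a long open path of ancestors none of which is forced to be \<open>\<alpha>\<close>, which is exponentially
  unlikely for every positive lower bound on the probability of \<open>\<alpha>\<close>. All other sites on the path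
  are dead: their open ancestry dies out. A long path of dead sites is unlikely when \<open>eps\<close> is small,
  uniformly in the rest of the data, by a Peierls argument. So the values at the present coalesce
  almost surely. The law of the coalesced configuration is the invariant measure, mixing holds because
  values depend on finite space-time cones, and running the envelope process over more and more rows
  until the input cells are determined is a perfect sampler.\<close>

section \<open>Paths of dead sites\<close>

text \<open>The threshold has to be fixed before \<open>\<phi>\<close>, while positivity gives only
  some lower bound \<open>p\<^sub>0\<close>, which may be far smaller than \<open>eps\<close>. So
  the two sources of ignorance are kept apart. The Peierls estimate counts errors only, and its
  bound involves neither \<open>\<phi>\<close> nor the horizon. The bound \<open>p\<^sub>0\<close>
  enters only through a ratio \<open>q < 1\<close>, raised to the length of an open path. The order
  of choices is then decisive: first a depth \<open>m\<close> that makes a dead path of length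
  \<open>m\<close> unlikely, then a horizon \<open>n\<close> so far away that
  \<open>q ^ (n - m)\<close> beats the number of sites in the cone of depth \<open>m\<close>. One
  sample decides both whether a site is an error and whether it is forced, so these events are not
  independent. This is why the open path is selected by the errors alone: once the error set is
  fixed, the path is fixed too, and each sample on it still has probability \<open>q\<close> of
  missing the forcing range.\<close>

text \<open>The second coordinate of a site is its age, and the parents of \<open>(x, d)\<close> are
  \<open>(x, d + 1)\<close> and \<open>(x + 1, d + 1)\<close>. The contours of the Peierls argument are walks on
  sites with a flag that says whether the site is being entered (\<open>False\<close>) or left
  (\<open>True\<close>). A dead site that is not an error is explored by descending to its left parent
  (\<open>SD\<close>), exploring it, moving to the right parent (\<open>SH\<close>), exploring it and
  returning (\<open>SU\<close>). An error is explored in one step (\<open>SL\<close>), after which the walk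
  may follow the given path (\<open>SP\<close>).\<close>

datatype step = SD | SL | SH | SU | SP bool

type_synonym node = "(int \<times> nat) \<times> bool"

fun mv :: "step \<Rightarrow> node \<Rightarrow> node" where
  "mv SD ((x, d), c) = ((x, d + 1), c)"
| "mv SL (z, c) = (z, True)"
| "mv SH ((x, d), c) = ((x + 1, d), False)"
| "mv SU ((x, d), c) = ((x - 1, d - 1), c)"
| "mv (SP b) ((x, d), c) = ((if b then x + 1 else x, d + 1), False)"

text \<open>Each condition looks at the current node only, so that a loop can be cut out of a walk
  without spoiling the rest. Nothing forces \<open>SH\<close> and \<open>SU\<close> to belong to a
  genuine exploration; the counting below does not need it. Positive age in \<open>SU\<close> keeps
  the truncated \<open>d - 1\<close> from distorting the displacement.\<close>

fun ok :: "(int \<times> nat \<Rightarrow> bool) \<Rightarrow> step \<Rightarrow> node \<Rightarrow> bool" where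
  "ok e SD (z, c) \<longleftrightarrow> \<not> c"
| "ok e SL (z, c) \<longleftrightarrow> \<not> c \<and> e z"
| "ok e SH (z, c) \<longleftrightarrow> c"
| "ok e SU (z, c) \<longleftrightarrow> c \<and> snd z > 0"
| "ok e (SP b) (z, c) \<longleftrightarrow> c"

primrec valid :: "(int \<times> nat \<Rightarrow> bool) \<Rightarrow> node \<Rightarrow> step list \<Rightarrow> bool" where
  "valid e n [] \<longleftrightarrow> True"
| "valid e n (s # ws) \<longleftrightarrow> ok e s n \<and> valid e (mv s n) ws"

definition endpoint :: "node \<Rightarrow> step list \<Rightarrow> node" where
  "endpoint n ws = fold mv ws n"

lemma endpoint_Nil [simp]: "endpoint n [] = n"
  and endpoint_Cons [simp]: "endpoint n (s # ws) = endpoint (mv s n) ws"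
  and endpoint_append [simp]: "endpoint n (us @ vs) = endpoint (endpoint n us) vs"
  by (simp_all add: endpoint_def)

lemma valid_append [simp]: "valid e n (us @ vs) \<longleftrightarrow> valid e n us \<and> valid e (endpoint n us) vs"
  by (induction us arbitrary: n) auto

lemma valid_nth: "valid e n ws \<Longrightarrow> i < length ws \<Longrightarrow> ok e (ws ! i) (endpoint n (take i ws))"
proof (induction ws arbitrary: n i)
  case (Cons s ws)
  then show ?case by (cases i) auto
qed simp

text \<open>A function of the start and the word alone. Validity depends on the errors, but the
  leaves do not, so a union bound can run over words.\<close>

definition leaves :: "node \<Rightarrow> step list \<Rightarrow> (int \<times> nat) set" where
  "leaves n ws = (\<lambda>i. fst (endpoint n (take i ws))) ` {i. i < length ws \<and> ws ! i = SL}"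

abbreviation cnt :: "step list \<Rightarrow> step \<Rightarrow> int" where
  "cnt ws s \<equiv> int (count_list ws s)"

lemma length_eq_counts:
  "int (length ws) = cnt ws SD + cnt ws SL + cnt ws SH + cnt ws SU + cnt ws (SP False) + cnt ws (SP True)"
proof (induction ws)
  case (Cons s ws)
  then show ?case by (cases s) (auto split: if_splits)
qed simp

text \<open>Each kind of step changes position, age and flag by fixed amounts, so the two ends of a
  walk yield three linear relations between the step counts.\<close>

lemma valid_displacement:
  assumes "valid e ((x, d), c) ws" "endpoint ((x, d), c) ws = ((y, d'), c')"
  shows "y - x = cnt ws SH - cnt ws SU + cnt ws (SP True)"
    and "int d' - int d = cnt ws SD + cnt ws (SP False) + cnt ws (SP True) - cnt ws SU"
    and "of_bool c' - of_bool c = cnt ws SL - cnt ws SH - cnt ws (SP False) - cnt ws (SP True)"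
proof -
  have "y - x = cnt ws SH - cnt ws SU + cnt ws (SP True) \<and>
    int d' - int d = cnt ws SD + cnt ws (SP False) + cnt ws (SP True) - cnt ws SU \<and>
    of_bool c' - of_bool c = cnt ws SL - cnt ws SH - cnt ws (SP False) - cnt ws (SP True)"
    using assms
  proof (induction ws arbitrary: x d c)
    case (Cons s ws)
    obtain x1 d1 c1 where n: "mv s ((x, d), c) = ((x1, d1), c1)"
      by (metis surj_pair)
    have "valid e ((x1, d1), c1) ws" "endpoint ((x1, d1), c1) ws = ((y, d'), c')" "ok e s ((x, d), c)"
      using Cons.prems n by auto
    with Cons.IH[of x1 d1 c1] n show ?case
      by (cases s) (auto split: if_splits)
  qed simp
  then show "y - x = cnt ws SH - cnt ws SU + cnt ws (SP True)"
    "int d' - int d = cnt ws SD + cnt ws (SP False) + cnt ws (SP True) - cnt ws SU"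
    "of_bool c' - of_bool c = cnt ws SL - cnt ws SH - cnt ws (SP False) - cnt ws (SP True)"
    by blast+
qed

lemma leaves_error:
  assumes "valid e n ws" "z \<in> leaves n ws"
  shows "e z"
proof -
  obtain i where i: "i < length ws" "ws ! i = SL" "z = fst (endpoint n (take i ws))"
    using assms(2) by (auto simp: leaves_def)
  with valid_nth[OF assms(1), of i] show ?thesis
    by (cases "endpoint n (take i ws)") auto
qed

text \<open>A walk of minimal length visits no node twice, so its leaves are distinct errors.\<close>

lemma minimal_walk:
  assumes "valid e n us" "endpoint n us = m"
  obtains ws where "valid e n ws" "endpoint n ws = m" "card (leaves n ws) = count_list ws SL"
proof -
  define P where "P ws \<longleftrightarrow> valid e n ws \<and> endpoint n ws = m" for ws
  define ws where "ws = arg_min length P"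
  have "P us" using assms by (simp add: P_def)
  then have ws: "P ws" and min: "\<And>vs. P vs \<Longrightarrow> length ws \<le> length vs"
    unfolding ws_def using arg_min_nat_lemma[of P us length] by auto
  let ?I = "{i. i < length ws \<and> ws ! i = SL}"
  have distinct: "endpoint n (take i ws) \<noteq> endpoint n (take j ws)" if "i < j" "j < length ws" for i j
  proof
    assume eq: "endpoint n (take i ws) = endpoint n (take j ws)"
    have "P (take j ws @ drop j ws)" "P (take i ws @ drop i ws)"
      using ws by simp_all
    then have "P (take i ws @ drop j ws)"
      unfolding P_def valid_append endpoint_append eq by blast
    from min[OF this] that show False by auto
  qed
  \<comment> \<open>All leaves carry the flag \<open>False\<close>, so distinct nodes here are
    distinct sites.\<close>
  have nodes: "\<not> snd (endpoint n (take i ws))" if "i \<in> ?I" for i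
    using that valid_nth[of e n ws i] ws by (cases "endpoint n (take i ws)") (auto simp: P_def)
  have "inj_on (\<lambda>i. fst (endpoint n (take i ws))) ?I"
  proof (rule inj_onI)
    fix i j assume ij: "i \<in> ?I" "j \<in> ?I" "fst (endpoint n (take i ws)) = fst (endpoint n (take j ws))"
    then have "endpoint n (take i ws) = endpoint n (take j ws)"
      using nodes[OF ij(1)] nodes[OF ij(2)] by (auto intro: prod_eqI)
    with distinct[of i j] distinct[of j i] ij show "i = j"
      by (cases i j rule: linorder_cases) auto
  qed
  then have "card (leaves n ws) = card ?I"
    unfolding leaves_def by (rule card_image)
  also have "\<dots> = count_list ws SL"
    by (simp add: count_list_eq_length_filter length_filter_conv_card eq_commute)
  finally show thesis
    using that ws by (auto simp: P_def)
qed

lemma finite_leaves [simp]: "finite (leaves n ws)"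
  by (simp add: leaves_def)

section \<open>Dead sites and the errors they require\<close>

text \<open>Here \<open>r\<close> counts the rows left before the horizon. The value at
  \<open>0\<close> declares the horizon alive, so a site is not dead exactly if an error-free
  ancestry reaches the horizon.\<close>

primrec dead :: "(int \<times> nat \<Rightarrow> bool) \<Rightarrow> nat \<Rightarrow> int \<Rightarrow> nat \<Rightarrow> bool" where
  "dead e 0 x d \<longleftrightarrow> False"
| "dead e (Suc r) x d \<longleftrightarrow> e (x, d) \<or> dead e r x (d + 1) \<and> dead e r (x + 1) (d + 1)"

text \<open>Only the \<open>m\<close> sites before the end of the path are dead; the site at
  \<open>y\<close> itself is free.\<close>

primrec dead_path :: "(int \<times> nat \<Rightarrow> bool) \<Rightarrow> nat \<Rightarrow> nat \<Rightarrow> int \<Rightarrow> nat \<Rightarrow> int \<Rightarrow> bool" where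
  "dead_path e 0 r x d y \<longleftrightarrow> y = x"
| "dead_path e (Suc m) r x d y \<longleftrightarrow> dead e r x d \<and>
     (dead_path e m (r - 1) x (d + 1) y \<or> dead_path e m (r - 1) (x + 1) (d + 1) y)"

lemma dead_walk:
  assumes "dead e r x d"
  obtains ws where "valid e ((x, d), False) ws" "endpoint ((x, d), False) ws = ((x, d), True)"
proof -
  have "\<exists>ws. valid e ((x, d), False) ws \<and> endpoint ((x, d), False) ws = ((x, d), True)"
    using assms
  proof (induction r arbitrary: x d)
    case (Suc r)
    show ?case
    proof (cases "e (x, d)")
      case True
      then show ?thesis by (intro exI[of _ "[SL]"]) auto
    next
      case False
      with Suc obtain us vs where
        "valid e ((x, d + 1), False) us" "endpoint ((x, d + 1), False) us = ((x, d + 1), True)"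
        "valid e ((x + 1, d + 1), False) vs" "endpoint ((x + 1, d + 1), False) vs = ((x + 1, d + 1), True)"
        by (metis dead.simps(2))
      then show ?thesis
        by (intro exI[of _ "SD # us @ SH # vs @ [SU]"]) auto
    qed
  qed simp
  with that show thesis by blast
qed

lemma dead_path_walk:
  assumes "dead_path e m r x d y"
  obtains ws where "valid e ((x, d), False) ws" "endpoint ((x, d), False) ws = ((y, d + m), False)"
proof -
  have "\<exists>ws. valid e ((x, d), False) ws \<and> endpoint ((x, d), False) ws = ((y, d + m), False)"
    using assms
  proof (induction m arbitrary: x d r)
    case 0
    then show ?case by (intro exI[of _ "[]"]) auto
  next
    case (Suc m)
    then obtain b where b: "dead_path e m (r - 1) (if b then x + 1 else x) (d + 1) y"
      by (metis (full_types) dead_path.simps(2))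
    with Suc.IH obtain us where us: "valid e ((if b then x + 1 else x, d + 1), False) us"
      "endpoint ((if b then x + 1 else x, d + 1), False) us = ((y, d + Suc m), False)"
      by fastforce
    have dead: "dead e r x d" using Suc.prems by simp
    show ?case
    proof (cases "e (x, d)")
      case True
      with us show ?thesis by (intro exI[of _ "SL # SP b # us"]) auto
    next
      case False
      with dead obtain r' where "dead e r' x (d + 1)"
        by (cases r) auto
      from dead_walk[OF this] obtain vs where
        "valid e ((x, d + 1), False) vs" "endpoint ((x, d + 1), False) vs = ((x, d + 1), True)"
        by blast
      \<comment> \<open>Towards the left parent the walk just descends. Towards the right parent it
        must first explore the left one, which is dead as well because \<open>(x, d)\<close> is no
        error.\<close>
      with us show ?thesis
        by (intro exI[of _ "if b then SD # vs @ SH # us else SD # us"]) (auto split: if_splits)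
    qed
  qed
  with that show thesis by blast
qed

text \<open>With the flag \<open>False\<close> at both ends, the displacement relations give
  \<open>SL = SH + SP False + SP True\<close>, so the length is \<open>SD + SU + 2 * SL\<close>. The
  condition \<open>2 * y \<ge> int m\<close> becomes
  \<open>SD + SU \<le> 2 * SH + SP True - SP False\<close>, which is at most \<open>2 * SL\<close>;
  hence the factor 4. Without a drift to the right there is no such bound: a path that always turns
  left can be walked by \<open>SD\<close> alone.\<close>

lemma dead_path_leaves:
  assumes "dead_path e m r 0 0 y" "2 * y \<ge> int m"
  obtains ws where "m \<le> length ws" "length ws \<le> 4 * card (leaves ((0, 0), False) ws)"
    "\<And>z. z \<in> leaves ((0, 0), False) ws \<Longrightarrow> e z"
proof -
  from dead_path_walk[OF assms(1)] obtain us where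
    "valid e ((0, 0), False) us" "endpoint ((0, 0), False) us = ((y, 0 + m), False)"
    by blast
  from minimal_walk[OF this] obtain ws where ws: "valid e ((0, 0), False) ws"
    "endpoint ((0, 0), False) ws = ((y, 0 + m), False)" "card (leaves ((0, 0), False) ws) = count_list ws SL"
    by blast
  note valid_displacement[OF ws(1,2)] length_eq_counts[of ws]
  with ws(3) assms(2) have "m \<le> length ws" "length ws \<le> 4 * card (leaves ((0, 0), False) ws)"
    by auto
  with ws leaves_error that show thesis by blast
qed

text \<open>The symmetry of the ancestry that exchanges the two parents of a site. It turns a path
  that drifts left into one that drifts right.\<close>

definition reflect :: "int \<times> nat \<Rightarrow> int \<times> nat" where
  "reflect z = (int (snd z) - fst z, snd z)"

lemma inj_reflect: "inj reflect"
  by (auto simp: inj_def reflect_def)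

lemma dead_reflect:
  assumes e': "\<And>z. e' z = e (reflect z)"
  shows "x + y = int d \<Longrightarrow> dead e' r x d = dead e r y d"
proof (induction r arbitrary: x y d)
  case (Suc r)
  then have "dead e' r x (d + 1) = dead e r (y + 1) (d + 1)"
    "dead e' r (x + 1) (d + 1) = dead e r y (d + 1)" "reflect (x, d) = (y, d)"
    by (auto simp: reflect_def)
  then show ?case
    using e'[of "(x, d)"] by auto
qed simp

lemma dead_path_reflect:
  assumes e': "\<And>z. e' z = e (reflect z)"
  shows "x + x' = int d \<Longrightarrow> y + y' = int (d + m) \<Longrightarrow> dead_path e' m r x d y = dead_path e m r x' d y'"
proof (induction m arbitrary: r x x' d)
  case (Suc m)
  have "dead_path e' m (r - 1) x (d + 1) y = dead_path e m (r - 1) (x' + 1) (d + 1) y'"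
    "dead_path e' m (r - 1) (x + 1) (d + 1) y = dead_path e m (r - 1) x' (d + 1) y'"
    using Suc by auto
  moreover have "dead e' r x d = dead e r x' d"
    using dead_reflect[of e' e, OF e'] Suc.prems by blast
  ultimately show ?case
    by (auto simp del: One_nat_def)
qed auto

lemma dead_path_errors:
  assumes "dead_path e m r 0 0 y"
  obtains h ws where "h \<in> {id, reflect}" "m \<le> length ws"
    "length ws \<le> 4 * card (leaves ((0, 0), False) ws)"
    "\<And>z. z \<in> leaves ((0, 0), False) ws \<Longrightarrow> e (h z)"
proof (cases "2 * y \<ge> int m")
  case True
  from dead_path_leaves[OF assms this] that[of id] show thesis by auto
next
  case False
  have "dead_path (e \<circ> reflect) m r 0 0 (int m - y)"
    using assms by (subst dead_path_reflect[where e = e and x' = 0 and y' = y]) auto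
  from dead_path_leaves[OF this] False that[of reflect] show thesis by auto
qed

section \<open>Open ancestral paths and space-time cones\<close>

text \<open>A canonical choice made from the errors alone. Started at a site that is not dead, it
  stays on error-free sites; otherwise it is just some path with one site in each row.\<close>

primrec open_path :: "(int \<times> nat \<Rightarrow> bool) \<Rightarrow> nat \<Rightarrow> int \<Rightarrow> nat \<Rightarrow> (int \<times> nat) set" where
  "open_path e 0 x d = {}"
| "open_path e (Suc r) x d = insert (x, d)
     (if dead e r x (d + 1) then open_path e r (x + 1) (d + 1) else open_path e r x (d + 1))"

definition cone :: "nat \<Rightarrow> int \<Rightarrow> nat \<Rightarrow> (int \<times> nat) set" where
  "cone r x d = {(y, s). d \<le> s \<and> s < d + r \<and> x \<le> y \<and> y \<le> x + int (s - d)}"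

lemma finite_cone [simp]: "finite (cone r x d)"
  by (rule finite_subset[of _ "{x..x + int r} \<times> {d..<d + r}"]) (auto simp: cone_def)

lemma cone_Suc:
  "cone (Suc r) x d = insert (x, d) (cone r x (d + 1) \<union> cone r (x + 1) (d + 1))"
  by (auto simp: cone_def)

lemma dead_cong: "(\<And>z. z \<in> cone r x d \<Longrightarrow> e z = e' z) \<Longrightarrow> dead e r x d = dead e' r x d"
proof (induction r arbitrary: x d)
  case (Suc r)
  then show ?case
    using Suc.IH[of x "d + 1"] Suc.IH[of "x + 1" "d + 1"] by (simp add: cone_Suc)
qed simp

lemma open_path_cong:
  "(\<And>z. z \<in> cone r x d \<Longrightarrow> e z = e' z) \<Longrightarrow> open_path e r x d = open_path e' r x d"
proof (induction r arbitrary: x d)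
  case (Suc r)
  have "dead e r x (d + 1) = dead e' r x (d + 1)"
    by (rule dead_cong) (use Suc.prems cone_Suc in auto)
  then show ?case
    using Suc.IH[of x "d + 1"] Suc.IH[of "x + 1" "d + 1"] Suc.prems by (simp add: cone_Suc)
qed simp

lemma open_path_subset: "open_path e r x d \<subseteq> cone r x d"
  by (induction r arbitrary: x d) (simp_all, auto simp: cone_Suc split: if_splits)

lemma card_open_path: "card (open_path e r x d) = r"
proof (induction r arbitrary: x d)
  case (Suc r)
  let ?P = "if dead e r x (d + 1) then open_path e r (x + 1) (d + 1) else open_path e r x (d + 1)"
  have "?P \<subseteq> cone r (x + 1) (d + 1) \<union> cone r x (d + 1)"
    using open_path_subset[of e r] by auto
  then have "finite ?P" "(x, d) \<notin> ?P"
    by (meson finite_UnI finite_subset finite_cone) (use \<open>?P \<subseteq> _\<close> in \<open>auto simp: cone_def\<close>)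
  moreover have "card ?P = r" using Suc.IH by simp
  ultimately show ?case by simp
qed simp

section \<open>Independent uniform samples\<close>

abbreviation unif :: "real measure" where
  "unif \<equiv> uniform_measure lborel {0..1}"

lemma prob_space_unif: "prob_space unif"
  by (rule prob_space_uniform_measure) auto

lemma measure_unif: "A \<in> sets borel \<Longrightarrow> measure unif A = measure lborel ({0..1} \<inter> A)"
  by (subst measure_uniform_measure) auto

lemma measure_unif_interval:
  assumes "0 \<le> a" "a \<le> b" "b \<le> 1"
  shows "measure unif {a..<b} = b - a" "measure unif {..<b} = b" "measure unif {a..} = 1 - a"
proof -
  have "{0..1} \<inter> {a..<b} = {a..<b}" "{0..1} \<inter> {a..} = {a..1}"
    using assms by auto
  moreover have "{0..1} \<inter> {..<b} = (if b = 0 then {} else {0..<b})"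
    using assms by auto
  ultimately show "measure unif {a..<b} = b - a" "measure unif {..<b} = b" "measure unif {a..} = 1 - a"
    using assms by (auto simp: measure_unif)
qed

lemma sets_uniform_samples: "sets uniform_samples = sets (PiM UNIV (\<lambda>_. borel))"
  unfolding uniform_samples_def by (rule sets_PiM_cong) auto

lemma space_uniform_samples [simp]: "space uniform_samples = UNIV"
  by (simp add: uniform_samples_def space_PiM)

interpretation samples: prob_space uniform_samples
  unfolding uniform_samples_def by (intro prob_space_PiM prob_space_unif)

abbreviation prob :: "(nat \<Rightarrow> real) set \<Rightarrow> real" where
  "prob \<equiv> measure uniform_samples"

lemma measurable_sample [measurable]: "(\<lambda>\<omega>. \<omega> i) \<in> borel_measurable uniform_samples"
  unfolding measurable_cong_sets[OF sets_uniform_samples refl] by measurable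

lemma prob_coordinates:
  assumes "finite J" "\<And>i. i \<in> J \<Longrightarrow> F i \<in> sets borel"
  shows "prob {\<omega>. \<forall>i\<in>J. \<omega> i \<in> F i} = (\<Prod>i\<in>J. measure unif (F i))"
proof -
  interpret product_prob_space "\<lambda>_::nat. unif" UNIV
    by (rule product_prob_spaceI) (rule prob_space_unif)
  have "{\<omega>. \<forall>i\<in>J. \<omega> i \<in> F i} = prod_emb UNIV (\<lambda>_. unif) J (Pi\<^sub>E J F)"
    by (auto simp: prod_emb_def PiE_iff)
  then show ?thesis
    unfolding uniform_samples_def using assms by (simp add: measure_PiM_emb)
qed

lemma prob_sites:
  fixes g :: "'s \<Rightarrow> nat"
  assumes "inj_on g R" "finite R" "\<And>z. z \<in> R \<Longrightarrow> F z \<in> sets borel"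
  shows "prob {\<omega>. \<forall>z\<in>R. \<omega> (g z) \<in> F z} = (\<Prod>z\<in>R. measure unif (F z))"
proof -
  let ?F = "\<lambda>i. F (the_inv_into R g i)"
  have "{\<omega>. \<forall>z\<in>R. \<omega> (g z) \<in> F z} = {\<omega>. \<forall>i\<in>g ` R. \<omega> i \<in> ?F i}"
    using assms(1) by (auto simp: the_inv_into_f_f)
  also have "prob \<dots> = (\<Prod>i\<in>g ` R. measure unif (?F i))"
    using assms by (intro prob_coordinates) (auto simp: the_inv_into_f_f)
  also have "\<dots> = (\<Prod>z\<in>R. measure unif (F z))"
    using assms(1) by (subst prod.reindex) (auto simp: the_inv_into_f_f)
  finally show ?thesis .
qed

lemma sites_sets:
  assumes "finite R" "\<And>z. z \<in> R \<Longrightarrow> F z \<in> sets borel"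
  shows "{\<omega>. \<forall>z\<in>R. \<omega> (g z) \<in> F z} \<in> sets uniform_samples"
proof -
  have "Measurable.pred uniform_samples (\<lambda>\<omega>. \<forall>z\<in>R. \<omega> (g z) \<in> F z)"
    using assms by (intro pred_intros_finite pred_sets2[OF _ measurable_sample]) auto
  then show ?thesis by (simp add: pred_def)
qed

definition determined :: "nat set \<Rightarrow> (nat \<Rightarrow> real) set \<Rightarrow> bool" where
  "determined I A \<longleftrightarrow> A \<in> sets uniform_samples \<and>
     (\<forall>\<omega> \<omega>'. (\<forall>i\<in>I. \<omega> i = \<omega>' i) \<longrightarrow> \<omega> \<in> A \<longrightarrow> \<omega>' \<in> A)"

lemma determinedI:
  "A \<in> sets uniform_samples \<Longrightarrow> (\<And>\<omega> \<omega>'. (\<And>i. i \<in> I \<Longrightarrow> \<omega> i = \<omega>' i) \<Longrightarrow> \<omega> \<in> A \<Longrightarrow> \<omega>' \<in> A) \<Longrightarrow>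
    determined I A"
  by (auto simp: determined_def)

lemma indep_samples:
  "samples.indep_vars (\<lambda>_. borel) (\<lambda>i \<omega>. \<omega> i) UNIV"
proof -
  have *: "distr uniform_samples borel (\<lambda>\<omega>. \<omega> i) = unif" for i
  proof -
    interpret product_prob_space "\<lambda>_::nat. unif" UNIV
      by (rule product_prob_spaceI) (rule prob_space_unif)
    have "distr uniform_samples borel (\<lambda>\<omega>. \<omega> i) = distr uniform_samples unif (\<lambda>\<omega>. \<omega> i)"
      by (rule distr_cong) auto
    then show ?thesis
      unfolding uniform_samples_def by (simp add: PiM_component)
  qed
  have "distr uniform_samples (PiM UNIV (\<lambda>_. borel)) (\<lambda>x. \<lambda>i\<in>UNIV. x i) = uniform_samples"
    by (simp add: restrict_UNIV distr_id2 sets_uniform_samples)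
  also have "\<dots> = PiM UNIV (\<lambda>i. distr uniform_samples borel (\<lambda>\<omega>. \<omega> i))"
    unfolding * by (rule uniform_samples_def)
  finally show ?thesis
    by (subst samples.indep_vars_iff_distr_eq_PiM) simp_all
qed

text \<open>Restrictions of the samples to disjoint index sets are independent. Filling up a
  restriction with zeros by \<open>ext\<close> does not change membership in an event determined by
  the kept indices, so such events are preimages under restrictions.\<close>

lemma prob_determined_Int:
  assumes A: "determined I A" and B: "determined J B" and "I \<inter> J = {}"
  shows "prob (A \<inter> B) = prob A * prob B"
proof -
  let ?M = "\<lambda>I. PiM I (\<lambda>_. borel :: real measure)"
  define ext where "ext I \<eta> = (\<lambda>i. if i \<in> I then \<eta> i else 0)" for I and \<eta> :: "nat \<Rightarrow> real"
  have ext: "ext I \<in> ?M I \<rightarrow>\<^sub>M uniform_samples" for I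
    unfolding measurable_cong_sets[OF refl sets_uniform_samples] ext_def
  proof (rule measurable_PiM_single')
    show "(\<lambda>\<omega>. if i \<in> I then \<omega> i else 0) \<in> borel_measurable (?M I)" for i
      by (cases "i \<in> I") auto
  qed (auto simp: space_PiM)
  have det: "{\<omega> \<in> space uniform_samples. restrict \<omega> I \<in> ext I -` A \<inter> space (?M I)} = A"
    if "determined I A" for I A
  proof -
    have "ext I (restrict \<omega> I) \<in> A \<longleftrightarrow> \<omega> \<in> A" for \<omega>
    proof -
      have "ext I (restrict \<omega> I) i = \<omega> i" if "i \<in> I" for i
        using that by (simp add: ext_def)
      then show ?thesis
        using that unfolding determined_def by metis
    qed
    then show ?thesis by (auto simp: space_PiM)
  qed
  have "samples.indep_var (?M I) (\<lambda>\<omega>. restrict (\<lambda>i. \<omega> i) I) (?M J) (\<lambda>\<omega>. restrict (\<lambda>i. \<omega> i) J)"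
    by (rule samples.indep_var_restrict[OF indep_samples]) (use assms in auto)
  from samples.indep_varD[OF this measurable_sets[OF ext] measurable_sets[OF ext], of A B]
  have "prob ((\<lambda>\<omega>. (restrict \<omega> I, restrict \<omega> J)) -`
      ((ext I -` A \<inter> space (?M I)) \<times> (ext J -` B \<inter> space (?M J))) \<inter> space uniform_samples) =
    prob ((\<lambda>\<omega>. restrict \<omega> I) -` (ext I -` A \<inter> space (?M I)) \<inter> space uniform_samples) *
    prob ((\<lambda>\<omega>. restrict \<omega> J) -` (ext J -` B \<inter> space (?M J)) \<inter> space uniform_samples)"
    using A B unfolding determined_def by blast
  moreover have "(\<lambda>\<omega>. (restrict \<omega> I, restrict \<omega> J)) -`
      ((ext I -` A \<inter> space (?M I)) \<times> (ext J -` B \<inter> space (?M J))) \<inter> space uniform_samples = A \<inter> B"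
    "(\<lambda>\<omega>. restrict \<omega> I) -` (ext I -` A \<inter> space (?M I)) \<inter> space uniform_samples = A"
    "(\<lambda>\<omega>. restrict \<omega> J) -` (ext J -` B \<inter> space (?M J)) \<inter> space uniform_samples = B"
    using det[OF A] det[OF B] by blast+
  ultimately show ?thesis by simp
qed

text \<open>There are \<open>6 ^ T\<close> walks of length \<open>T\<close>, and those in \<open>dead_path_leaves\<close> have at least
  \<open>T / 4\<close> distinct errors; this choice makes \<open>6 ^ T * eps powr (T / 4)\<close> equal to
  \<open>(1 / 2) ^ T\<close>.\<close>

definition eps :: real where "eps = (1 / 12) ^ 4"

definition err :: "(int \<times> nat \<Rightarrow> nat) \<Rightarrow> (nat \<Rightarrow> real) \<Rightarrow> int \<times> nat \<Rightarrow> bool" where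
  "err g \<omega> z \<longleftrightarrow> \<omega> (g z) \<ge> 1 - eps"

lemma eps_bounds: "0 < eps" "eps < 1"
  by (simp_all add: eps_def power_one_over)

lemma card_steps: "card {ws :: step list. length ws = T} = 6 ^ T" "finite {ws :: step list. length ws = T}"
proof -
  have U: "(UNIV :: step set) = set [SD, SL, SH, SU, SP False, SP True]"
  proof -
    have "s \<in> set [SD, SL, SH, SU, SP False, SP True]" for s
      by (cases s) auto
    then show ?thesis by blast
  qed
  then have finite_steps: "finite (UNIV :: step set)" and "card (UNIV :: step set) = 6"
    unfolding U by (auto simp: card_insert_if)
  with card_lists_length_eq[OF finite_steps, of T] finite_lists_length_eq[OF finite_steps, of T]
  show "card {ws :: step list. length ws = T} = 6 ^ T" "finite {ws :: step list. length ws = T}"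
    by auto
qed

text \<open>The union bound runs over all words with enough leaves, valid or not; for each the
  leaves form a fixed set of sites that must all be errors. The bound is the same for every
  \<open>r\<close>. A measurable superset \<open>B\<close> spares the measurability of the event
  itself.\<close>

lemma prob_dead_path:
  assumes g: "inj g"
  shows "\<exists>B \<in> sets uniform_samples.
    {\<omega>. \<exists>y. dead_path (err g \<omega>) m r 0 0 y} \<subseteq> B \<and> prob B \<le> 4 * (1 / 2) ^ m"
proof -
  let ?L = "leaves ((0, 0), False)"
  define W where "W T = {ws. length ws = T \<and> T \<le> 4 * card (?L ws)}" for T
  define B where "B h ws = {\<omega>. \<forall>z\<in>?L ws. \<omega> (g (h z)) \<in> {1 - eps..}}" for h ws
  \<comment> \<open>\<open>T\<close> is the excess over the least possible length \<open>m\<close>,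
    since the walk may be much longer than the path. The two orientations cost the factor 2 in the
    bound for \<open>A T\<close>, and the sum over \<open>T\<close> another 2.\<close>
  define A where "A T = (\<Union>(h, ws)\<in>{id, reflect} \<times> W (T + m). B h ws)" for T
  have B: "B h ws \<in> sets uniform_samples" for h ws
    unfolding B_def by (rule sites_sets) auto
  have finW: "finite (W T)" for T
    by (rule finite_subset[OF _ card_steps(2)[of T]]) (auto simp: W_def)
  have cardW: "card (W T) \<le> 6 ^ T" for T
    unfolding card_steps(1)[symmetric] by (rule card_mono[OF card_steps(2)]) (auto simp: W_def)
  have A: "A T \<in> sets uniform_samples" for T
    unfolding A_def using finW B by (intro sets.finite_UN) auto
  have prob_B: "prob (B h ws) \<le> (1 / 12) ^ T" if "h \<in> {id, reflect}" "ws \<in> W T" for h ws T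
  proof -
    have "inj (g \<circ> h)"
      using that(1) g inj_reflect by (auto intro: inj_compose)
    then have "prob (B h ws) = (\<Prod>z\<in>?L ws. measure unif {1 - eps..})"
      unfolding B_def using prob_sites[of "g \<circ> h" "?L ws" "\<lambda>_. {1 - eps..}"]
      by (simp add: inj_on_subset[OF _ subset_UNIV])
    also have "\<dots> = (1 / 12) ^ (4 * card (?L ws))"
      using measure_unif_interval[of "1 - eps" 1] eps_bounds by (simp add: eps_def power_mult)
    also have "\<dots> \<le> (1 / 12) ^ T"
      using that(2) by (intro power_decreasing) (auto simp: W_def)
    finally show ?thesis .
  qed
  have prob_A: "prob (A T) \<le> 2 * (1 / 2) ^ (T + m)" for T
  proof -
    have "prob (A T) \<le> (\<Sum>(h, ws)\<in>{id, reflect} \<times> W (T + m). prob (B h ws))"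
      unfolding A_def using finW B
      by (intro order.trans[OF samples.finite_measure_subadditive_finite] sum_mono) auto
    also have "\<dots> \<le> (\<Sum>(h, ws)\<in>{id, reflect} \<times> W (T + m). (1 / 12) ^ (T + m))"
      using prob_B by (intro sum_mono) auto
    also have "\<dots> = card ({id, reflect} \<times> W (T + m)) * (1 / 12) ^ (T + m)"
      by simp
    also have "\<dots> \<le> real (2 * 6 ^ (T + m)) * (1 / 12) ^ (T + m)"
    proof (intro mult_right_mono of_nat_mono)
      have "card {id, reflect} \<le> 2"
        by (simp add: card_insert_if)
      then show "card ({id, reflect} \<times> W (T + m)) \<le> 2 * 6 ^ (T + m)"
        unfolding card_cartesian_product by (intro mult_mono cardW) auto
    qed simp
    also have "\<dots> = 2 * (6 * (1 / 12)) ^ (T + m)"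
      by (simp only: power_mult_distrib of_nat_mult of_nat_power of_nat_numeral mult.assoc)
    finally show ?thesis by simp
  qed
  have sums: "(\<lambda>T. 2 * (1 / 2 :: real) ^ (T + m)) sums (4 * (1 / 2) ^ m)"
    using sums_mult[OF geometric_sums[of "1 / 2 :: real"], of "2 * (1 / 2) ^ m"]
    by (simp add: power_add mult_ac)
  have summable: "summable (\<lambda>T. prob (A T))"
    by (rule summable_comparison_test'[OF sums_summable[OF sums], of 0]) (use prob_A in auto)
  have "{\<omega>. \<exists>y. dead_path (err g \<omega>) m r 0 0 y} \<subseteq> (\<Union>T. A T)"
  proof safe
    fix \<omega> y assume "dead_path (err g \<omega>) m r 0 0 y"
    from dead_path_errors[OF this] obtain h ws where h: "h \<in> {id, reflect}" "m \<le> length ws"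
      "length ws \<le> 4 * card (?L ws)" "\<And>z. z \<in> ?L ws \<Longrightarrow> err g \<omega> (h z)"
      by blast
    then have "\<omega> \<in> B h ws" "ws \<in> W (length ws - m + m)"
      by (auto simp: B_def W_def err_def)
    with h(1) have "\<omega> \<in> A (length ws - m)"
      unfolding A_def by blast
    then show "\<omega> \<in> (\<Union>T. A T)" by blast
  qed
  moreover have "prob (\<Union>T. A T) \<le> (\<Sum>T. prob (A T))"
    using A summable by (intro samples.finite_measure_subadditive_countably) auto
  moreover have "(\<Sum>T. prob (A T)) \<le> 4 * (1 / 2) ^ m"
    using suminf_le[OF prob_A summable sums_summable[OF sums]] sums_unique[OF sums] by simp
  ultimately show ?thesis
    using A by (intro bexI[of _ "\<Union>T. A T"]) auto
qed

text \<open>The event is split by the error set \<open>E\<close> of the cone. For fixed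
  \<open>E\<close> the path \<open>Op E\<close> is fixed, and each of its sites contributes the
  probability \<open>q\<close> that a sample below \<open>1 - eps\<close> is at least
  \<open>p\<close>. The remaining weights of the sets \<open>E\<close> add up to at most 1.\<close>

lemma prob_open_path:
  assumes g: "inj g" and p: "0 < p" "p \<le> 1 - eps"
  shows "\<exists>B \<in> sets uniform_samples.
    {\<omega>. \<forall>z\<in>open_path (err g \<omega>) r x d. p \<le> \<omega> (g z) \<and> \<not> err g \<omega> z} \<subseteq> B \<and>
    prob B \<le> ((1 - eps - p) / (1 - eps)) ^ r"
proof -
  define q where "q = (1 - eps - p) / (1 - eps)"
  define R where "R = cone r x d"
  define Op where "Op E = open_path (\<lambda>z. z \<in> E) r x d" for E
  define F where "F E z = (if z \<in> E then {1 - eps..} else if z \<in> Op E then {p..<1 - eps} else {..<1 - eps})" for E z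
  define B where "B E = {\<omega>. \<forall>z\<in>R. \<omega> (g z) \<in> F E z}" for E
  define P where "P = {E \<in> Pow R. E \<inter> Op E = {}}"
  have R: "finite R" by (simp add: R_def)
  have P: "finite P" "P \<subseteq> Pow R" using R by (auto simp: P_def)
  have B: "B E \<in> sets uniform_samples" for E
    unfolding B_def using R by (rule sites_sets) (auto simp: F_def)
  have prob_B: "prob (B E) = q ^ r * ((\<Prod>z\<in>E. eps) * (\<Prod>z\<in>R - E. 1 - eps))" if "E \<in> P" for E
  proof -
    have E: "E \<subseteq> R" "E \<inter> Op E = {}" "Op E \<subseteq> R" "card (Op E) = r"
      using that by (auto simp: P_def Op_def R_def open_path_subset card_open_path)
    have "prob (B E) = (\<Prod>z\<in>R. measure unif (F E z))"
      unfolding B_def using R g by (intro prob_sites) (auto simp: F_def intro: inj_on_subset)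
    also have "\<dots> = (\<Prod>z\<in>R. (if z \<in> E then eps else 1 - eps) * (if z \<in> Op E then q else 1))"
    proof (rule prod.cong)
      fix z
      show "measure unif (F E z) = (if z \<in> E then eps else 1 - eps) * (if z \<in> Op E then q else 1)"
        using E(2) p eps_bounds measure_unif_interval[of p "1 - eps"] measure_unif_interval[of "1 - eps" 1]
        by (auto simp: F_def q_def)
    qed simp
    also have "\<dots> = (\<Prod>z\<in>R. if z \<in> E then eps else 1 - eps) * (\<Prod>z\<in>R. if z \<in> Op E then q else 1)"
      by (rule prod.distrib)
    also have "(\<Prod>z\<in>R. if z \<in> Op E then q else 1) = (\<Prod>z\<in>Op E. q)"
      using R E(3) by (simp add: prod.If_cases Int_absorb1)
    also have "(\<Prod>z\<in>R. if z \<in> E then eps else 1 - eps) = (\<Prod>z\<in>E. eps) * (\<Prod>z\<in>R - E. 1 - eps)"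
      using R E(1) by (simp add: prod.If_cases Int_absorb1 Diff_eq)
    finally show ?thesis
      using E(4) by simp
  qed
  have q: "0 \<le> q" using p eps_bounds by (simp add: q_def)
  let ?U = "\<Union>E\<in>P. B E"
  have "prob ?U \<le> (\<Sum>E\<in>P. prob (B E))"
    using P B by (intro samples.finite_measure_subadditive_finite) auto
  also have "\<dots> = (\<Sum>E\<in>P. q ^ r * ((\<Prod>z\<in>E. eps) * (\<Prod>z\<in>R - E. 1 - eps)))"
    by (intro sum.cong prob_B) auto
  also have "\<dots> \<le> (\<Sum>E\<in>Pow R. q ^ r * ((\<Prod>z\<in>E. eps) * (\<Prod>z\<in>R - E. 1 - eps)))"
    using P R q eps_bounds by (intro sum_mono2) auto
  \<comment> \<open>The sum over all subsets of \<open>R\<close> is the expansion of a product whose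
    factors are all 1.\<close>
  also have "\<dots> = q ^ r * (\<Prod>z\<in>R. eps + (1 - eps))"
    unfolding prod_add[OF R] sum_distrib_left ..
  finally have bound: "prob ?U \<le> q ^ r" by simp
  have "{\<omega>. \<forall>z\<in>open_path (err g \<omega>) r x d. p \<le> \<omega> (g z) \<and> \<not> err g \<omega> z} \<subseteq> ?U"
  proof safe
    fix \<omega> assume \<omega>: "\<forall>z\<in>open_path (err g \<omega>) r x d. p \<le> \<omega> (g z) \<and> \<not> err g \<omega> z"
    define E where "E = {z \<in> R. err g \<omega> z}"
    have "Op E = open_path (err g \<omega>) r x d"
      unfolding Op_def by (rule open_path_cong) (simp add: E_def R_def)
    with \<omega> have "E \<in> P" "\<omega> \<in> B E"
      by (auto simp: E_def P_def B_def F_def err_def)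
    then show "\<omega> \<in> ?U" by blast
  qed
  then show ?thesis
    using bound B P unfolding q_def by (intro bexI[of _ ?U] conjI sets.finite_UN) auto
qed

section \<open>Coupling from the past\<close>

text \<open>Inversion of the distribution function along a list, written with subtractions because
  the sampling program executes it this way. The last symbol absorbs any remainder.\<close>

primrec pick :: "('a \<Rightarrow> real) \<Rightarrow> 'a \<Rightarrow> 'a list \<Rightarrow> real \<Rightarrow> 'a" where
  "pick w x [] u = x"
| "pick w x (y # ys) u = (if u < w x then x else pick w y ys (u - w x))"

lemma pick_in: "pick w x ys u \<in> insert x (set ys)"
  by (induction ys arbitrary: x u) (simp, force)

lemma pick_interval:
  assumes "distinct (x # ys)" "\<And>z. 0 \<le> w z" "c \<in> set (x # ys)"
  shows "\<exists>a\<ge>0. a + w c \<le> sum_list (map w (x # ys)) \<and>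
    {u. 0 \<le> u \<and> u < sum_list (map w (x # ys)) \<and> pick w x ys u = c} = {a..<a + w c}"
  using assms
proof (induction ys arbitrary: x)
  case Nil
  then show ?case by (intro exI[of _ 0]) auto
next
  case (Cons y ys)
  have nn: "0 \<le> sum_list (map w zs)" for zs
    using Cons.prems(2) by (intro sum_list_nonneg) auto
  show ?case
  proof (cases "c = x")
    case True
    have "pick w y ys u \<noteq> x" for u
      using Cons.prems(1) pick_in[of w y ys u] by auto
    then show ?thesis
      using True nn[of "y # ys"] Cons.prems(2)[of x]
      by (intro exI[of _ 0]) auto
  next
    case False
    with Cons.IH[of y] Cons.prems obtain a where a: "a \<ge> 0" "a + w c \<le> sum_list (map w (y # ys))"
      "{u. 0 \<le> u \<and> u < sum_list (map w (y # ys)) \<and> pick w y ys u = c} = {a..<a + w c}"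
      by auto
    have *: "0 \<le> u \<and> u < sum_list (map w (x # y # ys)) \<and> pick w x (y # ys) u = c \<longleftrightarrow>
        u - w x \<in> {a..<a + w c}" for u
      unfolding a(3)[symmetric] using Cons.prems(2)[of x] False by auto
    have "{u. 0 \<le> u \<and> u < sum_list (map w (x # y # ys)) \<and> pick w x (y # ys) u = c} =
        {w x + a..<w x + a + w c}"
      unfolding * by auto
    then show ?thesis
      using a(1,2) Cons.prems(2)[of x] by (intro exI[of _ "w x + a"] conjI) simp_all
  qed
qed

lemma measurable_pick [measurable]: "pick w x ys \<in> borel \<rightarrow>\<^sub>M count_space UNIV"
proof (induction ys arbitrary: x)
  case (Cons y ys)
  have "(\<lambda>u. if u < w x then x else pick w y ys (u - w x)) \<in> borel \<rightarrow>\<^sub>M count_space UNIV"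
    by (rule measurable_If) (auto intro!: measurable_compose[OF _ Cons.IH])
  moreover have "pick w x (y # ys) = (\<lambda>u. if u < w x then x else pick w y ys (u - w x))"
    by auto
  ultimately show ?case by simp
next
  case Nil
  have "pick w x [] = (\<lambda>u. x)" by auto
  then show ?case by simp
qed

lemma measure_pick:
  fixes w :: "'a::finite \<Rightarrow> real"
  assumes "distinct (x # ys)" "set (x # ys) = UNIV" "\<And>z. 0 \<le> w z" "(\<Sum>z\<in>UNIV. w z) = 1"
  shows "measure unif {u. pick w x ys u = c} = w c"
proof -
  have "sum_list (map w (x # ys)) = 1"
    using assms by (metis sum_list_distinct_conv_sum_set)
  with pick_interval[of x ys w c, OF assms(1,3)] assms(2) obtain a where a: "a \<ge> 0" "a + w c \<le> 1"
    "{u. 0 \<le> u \<and> u < 1 \<and> pick w x ys u = c} = {a..<a + w c}"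
    by auto
  interpret unif: prob_space unif by (rule prob_space_unif)
  \<comment> \<open>The sample 1 can be drawn, but lies in none of the half-open intervals of
    \<open>pick\<close>.\<close>
  have "emeasure unif {1::real} = 0"
    by (subst emeasure_uniform_measure) auto
  then have "AE u in unif. u \<noteq> 1"
    by (intro AE_I[of _ _ "{1}"]) auto
  moreover have "AE u in unif. u \<in> {0..1}"
    by (rule AE_uniform_measureI) auto
  ultimately have ae: "AE u in unif. (u \<in> {u. pick w x ys u = c}) = (u \<in> {a..<a + w c})"
  proof eventually_elim
    case (elim u)
    then show ?case unfolding a(3)[symmetric] by auto
  qed
  have "{u. pick w x ys u = c} \<in> sets borel"
    using measurable_sets[OF measurable_pick[of w x ys], of "{c}"] by (simp add: vimage_def)
  then have "measure unif {u. pick w x ys u = c} = measure unif {a..<a + w c}"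
    using ae by (intro measure_eq_AE) auto
  also have "\<dots> = w c"
    using a(1,2) assms(3)[of c] by (subst measure_unif_interval) auto
  finally show ?thesis .
qed

section \<open>The envelope process\<close>

locale noisy_ca =
  fixes \<phi> :: "'a::finite \<Rightarrow> 'a \<Rightarrow> 'a pmf" and \<alpha> :: 'a and ys :: "'a list"
  assumes symbols: "distinct (\<alpha> # ys)" "set (\<alpha> # ys) = UNIV"
    and positive: "\<And>a b. pmf (\<phi> a b) \<alpha> > 0"
    and spread: "\<And>a b. a = \<alpha> \<or> b = \<alpha> \<Longrightarrow> pmf (\<phi> a b) \<alpha> \<ge> 1 - eps"
begin

text \<open>\<open>\<alpha>\<close> stands first in the list, so it occupies the lowest samples for
  all parents at once; the coupling rests on this.\<close>

definition update :: "'a \<Rightarrow> 'a \<Rightarrow> real \<Rightarrow> 'a" where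
  "update a b u = pick (pmf (\<phi> a b)) \<alpha> ys u"

text \<open>With an unknown parent, \<open>\<alpha>\<close> is concluded only if every completion of
  the parents would give it: either the sample is below all thresholds, or one parent is
  \<open>\<alpha>\<close>, which by \<open>spread\<close> puts the threshold at
  \<open>1 - eps\<close> or above.\<close>

definition known_update :: "'a option \<Rightarrow> 'a option \<Rightarrow> real \<Rightarrow> 'a option" where
  "known_update x y u = (case (x, y) of (Some a, Some b) \<Rightarrow> Some (update a b u)
     | _ \<Rightarrow> if (\<forall>a b. u < pmf (\<phi> a b) \<alpha>) \<or> (x = Some \<alpha> \<or> y = Some \<alpha>) \<and> u < 1 - eps
           then Some \<alpha> else None)"

lemma prob_update: "measure unif {u. update a b u = c} = pmf (\<phi> a b) c"
  unfolding update_def using symbols by (intro measure_pick) (auto simp: sum_pmf_eq_1)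

lemma update_sets: "{u. update a b u = c} \<in> sets borel"
  using measurable_sets[OF measurable_pick, of "{c}"] by (simp add: vimage_def update_def)

lemma update_\<alpha>: "u < pmf (\<phi> a b) \<alpha> \<Longrightarrow> update a b u = \<alpha>"
  unfolding update_def by (cases ys) auto

text \<open>The case of interest is a default \<open>\<alpha>\<close> overtaken by knowledge of both
  parents: then the sample lies below the actual threshold, by \<open>spread\<close> if a parent is
  \<open>\<alpha>\<close>, so \<open>update\<close> agrees.\<close>

lemma known_update_mono:
  assumes "known_update x y u = Some c" "\<And>a. x = Some a \<Longrightarrow> x' = Some a" "\<And>b. y = Some b \<Longrightarrow> y' = Some b"
  shows "known_update x' y' u = Some c"
proof (cases "x = None \<or> y = None")
  case False
  then show ?thesis using assms by (auto simp: known_update_def)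
next
  case True
  then have c: "c = \<alpha>" "(\<forall>a b. u < pmf (\<phi> a b) \<alpha>) \<or> (x = Some \<alpha> \<or> y = Some \<alpha>) \<and> u < 1 - eps"
    using assms(1) by (auto simp: known_update_def split: option.splits if_splits)
  then have "(\<forall>a b. u < pmf (\<phi> a b) \<alpha>) \<or> (x' = Some \<alpha> \<or> y' = Some \<alpha>) \<and> u < 1 - eps"
    using assms(2,3) by auto
  then have "u < pmf (\<phi> a b) \<alpha>" if "x' = Some a" "y' = Some b" for a b
    using spread[of a b] that by force
  with c show ?thesis
    using \<open>(\<forall>a b. u < pmf (\<phi> a b) \<alpha>) \<or> (x' = Some \<alpha> \<or> y' = Some \<alpha>) \<and> u < 1 - eps\<close>
    by (auto simp: known_update_def update_\<alpha> split: option.splits)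
qed

primrec val :: "'a config \<Rightarrow> (int \<times> nat \<Rightarrow> nat) \<Rightarrow> nat \<Rightarrow> nat \<Rightarrow> int \<Rightarrow> (nat \<Rightarrow> real) \<Rightarrow> 'a" where
  "val x g 0 d k \<omega> = x k"
| "val x g (Suc r) d k \<omega> = update (val x g r (d + 1) k \<omega>) (val x g r (d + 1) (k + 1) \<omega>) (\<omega> (g (k, d)))"

primrec known :: "(int \<times> nat \<Rightarrow> nat) \<Rightarrow> nat \<Rightarrow> nat \<Rightarrow> int \<Rightarrow> (nat \<Rightarrow> real) \<Rightarrow> 'a option" where
  "known g 0 d k \<omega> = None"
| "known g (Suc r) d k \<omega> = known_update (known g r (d + 1) k \<omega>) (known g r (d + 1) (k + 1) \<omega>) (\<omega> (g (k, d)))"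

text \<open>By monotonicity, with the true values of the parents in place of what is known about
  them. As \<open>x\<close> is arbitrary, a known value has forgotten the initial
  configuration.\<close>

lemma known_val: "known g r d k \<omega> = Some c \<Longrightarrow> val x g r d k \<omega> = c"
proof (induction r arbitrary: d k c)
  case (Suc r)
  have "known_update (Some (val x g r (d + 1) k \<omega>)) (Some (val x g r (d + 1) (k + 1) \<omega>)) (\<omega> (g (k, d))) = Some c"
    by (rule known_update_mono[OF Suc.prems[unfolded known.simps]]) (simp_all add: Suc.IH)
  then show ?case by (simp add: known_update_def)
qed simp

lemma known_Suc: "known g r d k \<omega> = Some c \<Longrightarrow> known g (Suc r) d k \<omega> = Some c"
proof (induction r arbitrary: d k c)
  case (Suc r)
  show ?case
    unfolding known.simps(2)[of g "Suc r"]
    by (rule known_update_mono[OF Suc.prems[unfolded known.simps]]) (erule Suc.IH)+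
qed simp

lemma known_mono: "r \<le> r' \<Longrightarrow> known g r d k \<omega> = Some c \<Longrightarrow> known g r' d k \<omega> = Some c"
  by (induction r' rule: dec_induct) (auto intro: known_Suc simp del: known.simps)

lemma known_translate: "known (\<lambda>(k, d). g (k + c, d)) r d k \<omega> = known g r d (k + c) \<omega>"
  by (induction r arbitrary: d k) (auto simp: ac_simps)

lemma val_cong:
  "(\<And>z. z \<in> cone r k d \<Longrightarrow> \<omega> (g z) = \<omega>' (g z)) \<Longrightarrow> val x g r d k \<omega> = val x g r d k \<omega>'"
proof (induction r arbitrary: d k)
  case (Suc r)
  then show ?case
    using Suc.IH[of k "d + 1"] Suc.IH[of "k + 1" "d + 1"] by (simp add: cone_Suc)
qed simp

lemma measurable_val [measurable]: "val x g r d k \<in> uniform_samples \<rightarrow>\<^sub>M count_space UNIV"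
proof (induction r arbitrary: d k)
  case (Suc r)
  have upd: "(\<lambda>\<omega>. update a b (\<omega> i)) \<in> uniform_samples \<rightarrow>\<^sub>M count_space UNIV" for a b i
    unfolding update_def by (rule measurable_compose[OF measurable_sample measurable_pick])
  have "(\<lambda>\<omega>. update (val x g r (d + 1) k \<omega>) (val x g r (d + 1) (k + 1) \<omega>) (\<omega> (g (k, d))))
      \<in> uniform_samples \<rightarrow>\<^sub>M count_space UNIV"
    by (rule measurable_compose_countable[OF measurable_compose_countable[OF upd Suc.IH] Suc.IH])
  then show ?case by simp
next
  case 0
  have "val x g 0 d k = (\<lambda>_. x k)" by auto
  then show ?case by simp
qed

lemma measurable_known [measurable]: "known g r d k \<in> uniform_samples \<rightarrow>\<^sub>M count_space UNIV"
proof (induction r arbitrary: d k)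
  case (Suc r)
  have upd: "(\<lambda>\<omega>. known_update a b (\<omega> i)) \<in> uniform_samples \<rightarrow>\<^sub>M count_space UNIV" for a b i
  proof -
    have [measurable]: "(\<lambda>\<omega>. update a b (\<omega> i)) \<in> uniform_samples \<rightarrow>\<^sub>M count_space UNIV" for a b
      unfolding update_def by (rule measurable_compose[OF measurable_sample measurable_pick])
    show ?thesis
      unfolding known_update_def by (cases a; cases b) simp_all
  qed
  have "(\<lambda>\<omega>. known_update (known g r (d + 1) k \<omega>) (known g r (d + 1) (k + 1) \<omega>) (\<omega> (g (k, d))))
      \<in> uniform_samples \<rightarrow>\<^sub>M count_space UNIV"
    by (rule measurable_compose_countable[OF measurable_compose_countable[OF upd Suc.IH] Suc.IH])
  then show ?case by simp
next
  case 0
  have "known g 0 d k = (\<lambda>_. None)" by auto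
  then show ?case by simp
qed

lemma known_sets [measurable]: "{\<omega>. known g r d k \<omega> = v} \<in> sets uniform_samples"
  using measurable_sets[OF measurable_known, of "{v}" g r d k] by (simp add: vimage_def)

lemma val_sets:
  assumes "finite K"
  shows "{\<omega>. \<forall>k\<in>K. val x g r d k \<omega> = y k} \<in> sets uniform_samples"
proof -
  have "{\<omega>. val x g r d k \<omega> = y k} \<in> sets uniform_samples" for k
    using measurable_sets[OF measurable_val, of "{y k}" x g r d k] by (simp add: vimage_def)
  then have "(\<Inter>k\<in>K. {\<omega>. val x g r d k \<omega> = y k}) \<in> sets uniform_samples" if "K \<noteq> {}"
    using assms that by (intro sets.finite_INT) auto
  moreover have "{\<omega>. \<forall>k\<in>K. val x g r d k \<omega> = y k} = (\<Inter>k\<in>K. {\<omega>. val x g r d k \<omega> = y k})" by auto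
  ultimately show ?thesis
    using sets.top[of uniform_samples] by (cases "K = {}") auto
qed

lemma determined_val:
  assumes "finite K"
  shows "determined (g ` (\<Union>k\<in>K. cone r k d)) {\<omega>. \<forall>k\<in>K. val x g r d k \<omega> = y k}"
proof (rule determinedI)
  show "{\<omega>. \<forall>k\<in>K. val x g r d k \<omega> = y k} \<in> sets uniform_samples"
    using assms by (rule val_sets)
  fix \<omega> \<omega>' :: "nat \<Rightarrow> real"
  assume "\<And>i. i \<in> g ` (\<Union>k\<in>K. cone r k d) \<Longrightarrow> \<omega> i = \<omega>' i"
  then have "val x g r d k \<omega> = val x g r d k \<omega>'" if "k \<in> K" for k
    using that by (intro val_cong) auto
  then show "\<omega> \<in> {\<omega>. \<forall>k\<in>K. val x g r d k \<omega> = y k} \<Longrightarrow> \<omega>' \<in> {\<omega>. \<forall>k\<in>K. val x g r d k \<omega> = y k}"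
    by auto
qed

text \<open>Including \<open>1 - eps\<close> in the minimum keeps the ratio \<open>q\<close>
  nonnegative.\<close>

definition p\<^sub>0 :: real where
  "p\<^sub>0 = Min (insert (1 - eps) (range (\<lambda>(a, b). pmf (\<phi> a b) \<alpha>)))"

lemma p\<^sub>0_bounds: "0 < p\<^sub>0" "p\<^sub>0 \<le> 1 - eps" "p\<^sub>0 \<le> pmf (\<phi> a b) \<alpha>"
proof -
  have "p\<^sub>0 \<in> insert (1 - eps) (range (\<lambda>(a, b). pmf (\<phi> a b) \<alpha>))"
    unfolding p\<^sub>0_def by (rule Min_in) auto
  then show "0 < p\<^sub>0"
    using eps_bounds positive by auto
  show "p\<^sub>0 \<le> 1 - eps" "p\<^sub>0 \<le> pmf (\<phi> a b) \<alpha>"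
    unfolding p\<^sub>0_def by (rule Min_le; force)+
qed

text \<open>What is traced into the past is not ignorance but the failure to be known as
  \<open>\<alpha>\<close>. Unlike ignorance it passes to both parents of a site that is no error,
  hence along any open path.\<close>

lemma known_not_\<alpha>:
  assumes "known g (Suc r) d k \<omega> \<noteq> Some \<alpha>"
  shows "p\<^sub>0 \<le> \<omega> (g (k, d))"
    and "\<not> err g \<omega> (k, d) \<Longrightarrow> known g r (d + 1) k \<omega> \<noteq> Some \<alpha>"
    and "\<not> err g \<omega> (k, d) \<Longrightarrow> known g r (d + 1) (k + 1) \<omega> \<noteq> Some \<alpha>"
proof -
  let ?x = "known g r (d + 1) k \<omega>" and ?y = "known g r (d + 1) (k + 1) \<omega>" and ?u = "\<omega> (g (k, d))"
  have *: "known_update ?x ?y ?u = Some \<alpha>"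
    if "(\<forall>a b. ?u < pmf (\<phi> a b) \<alpha>) \<or> (?x = Some \<alpha> \<or> ?y = Some \<alpha>) \<and> ?u < 1 - eps"
  proof (cases "?x = None \<or> ?y = None")
    case True
    with that show ?thesis by (auto simp: known_update_def split: option.splits)
  next
    case False
    then obtain a b where ab: "?x = Some a" "?y = Some b" by auto
    have "?u < pmf (\<phi> a b) \<alpha>"
      using that spread[of a b] ab by force
    then show ?thesis using ab by (simp add: known_update_def update_\<alpha>)
  qed
  show "p\<^sub>0 \<le> ?u"
  proof (rule ccontr)
    assume "\<not> p\<^sub>0 \<le> ?u"
    then have "?u < pmf (\<phi> a b) \<alpha>" for a b
      using p\<^sub>0_bounds(3)[of a b] by simp
    with * assms show False by simp
  qed
  show "\<not> err g \<omega> (k, d) \<Longrightarrow> ?x \<noteq> Some \<alpha>" "\<not> err g \<omega> (k, d) \<Longrightarrow> ?y \<noteq> Some \<alpha>"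
    using * assms by (auto simp: err_def not_le)
qed

lemma known_None:
  "known g (Suc r) d k \<omega> = None \<Longrightarrow> known g r (d + 1) k \<omega> = None \<or> known g r (d + 1) (k + 1) \<omega> = None"
  by (auto simp: known_update_def split: option.splits if_splits)

lemma not_dead_open_path:
  assumes "known g r d k \<omega> \<noteq> Some \<alpha>" "\<not> dead (err g \<omega>) r k d"
  shows "\<forall>z\<in>open_path (err g \<omega>) r k d. p\<^sub>0 \<le> \<omega> (g z) \<and> \<not> err g \<omega> z"
  using assms
proof (induction r arbitrary: d k)
  case (Suc r)
  have e: "\<not> err g \<omega> (k, d)" and
    d: "\<not> dead (err g \<omega>) r k (d + 1) \<or> \<not> dead (err g \<omega>) r (k + 1) (d + 1)"
    using Suc.prems(2) by auto
  note n = known_not_\<alpha>[OF Suc.prems(1)]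
  show ?case
  proof (cases "dead (err g \<omega>) r k (d + 1)")
    case True
    with Suc.IH[OF n(3)[OF e]] n(1) e d show ?thesis by simp
  next
    case False
    with Suc.IH[OF n(2)[OF e]] n(1) e show ?thesis by simp
  qed
qed simp

text \<open>An unknown site has an unknown parent, and the hypothesis makes each unknown site in the
  cone dead. At age \<open>s\<close> there are \<open>r - (s - d)\<close> rows left before the
  horizon.\<close>

lemma None_dead_path:
  assumes "known g r d k \<omega> = None" "m \<le> r"
    "\<And>x s. (x, s) \<in> cone m k d \<Longrightarrow> known g (r - (s - d)) s x \<omega> \<noteq> Some \<alpha> \<Longrightarrow> dead (err g \<omega>) (r - (s - d)) x s"
  shows "\<exists>y. dead_path (err g \<omega>) m r k d y"
  using assms
proof (induction m arbitrary: r d k)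
  case (Suc m)
  then obtain r' where r': "r = Suc r'" "m \<le> r'" by (cases r) auto
  have "dead (err g \<omega>) r k d"
    using Suc.prems(1) Suc.prems(3)[of k d] by (simp add: cone_Suc)
  obtain k' where k': "k' \<in> {k, k + 1}" "known g r' (d + 1) k' \<omega> = None"
    using known_None[OF Suc.prems(1)[unfolded r'(1)]] by (metis insertCI)
  have "\<exists>y. dead_path (err g \<omega>) m r' k' (d + 1) y"
  proof (rule Suc.IH[OF k'(2) r'(2)])
    fix x s assume xs: "(x, s) \<in> cone m k' (d + 1)" "known g (r' - (s - (d + 1))) s x \<omega> \<noteq> Some \<alpha>"
    from xs(1) have s: "r' - (s - (d + 1)) = r - (s - d)"
      unfolding r'(1) cone_def by auto
    show "dead (err g \<omega>) (r' - (s - (d + 1))) x s"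
      unfolding s
    proof (rule Suc.prems(3))
      show "(x, s) \<in> cone (Suc m) k d"
        using xs(1) k'(1) by (auto simp: cone_Suc)
    qed (use xs(2) s in simp)
  qed
  then obtain y where "dead_path (err g \<omega>) m r' k' (d + 1) y" by blast
  then have "dead_path (err g \<omega>) m r' k (d + 1) y \<or> dead_path (err g \<omega>) m r' (k + 1) (d + 1) y"
    using k'(1) by auto
  with \<open>dead (err g \<omega>) r k d\<close> show ?case
    by (intro exI[of _ y]) (simp add: r')
next
  case 0
  show ?case by (rule exI[of _ k]) simp
qed

text \<open>The threshold serves all numberings \<open>g\<close> and all cells \<open>k\<close> at
  once. This uniformity is what later makes the limit law independent of the numbering.\<close>

lemma known_eventually:
  assumes "\<delta> > 0"
  shows "\<exists>n\<^sub>0. \<forall>n\<ge>n\<^sub>0. \<forall>g k. inj g \<longrightarrow> prob {\<omega>. known g n 0 k \<omega> = None} \<le> \<delta>"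
proof -
  define q where "q = (1 - eps - p\<^sub>0) / (1 - eps)"
  have q: "0 \<le> q" "q < 1"
    using p\<^sub>0_bounds(1,2) eps_bounds by (auto simp: q_def field_simps)
  have "(\<lambda>m. 4 * (1 / 2 :: real) ^ m) \<longlonglongrightarrow> 0"
    by (intro tendsto_mult_right_zero LIMSEQ_power_zero) simp
  from order_tendstoD(2)[OF this, of "\<delta> / 2"] assms
  have "\<forall>\<^sub>F m in sequentially. 4 * (1 / 2 :: real) ^ m < \<delta> / 2"
    by simp
  then obtain m where m: "4 * (1 / 2 :: real) ^ m < \<delta> / 2"
    by (auto simp: eventually_sequentially)
  define T where "T = cone m 0 0"
  have "(\<lambda>n. card T * q ^ n) \<longlonglongrightarrow> 0"
    using q by (intro tendsto_mult_right_zero LIMSEQ_power_zero) auto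
  from order_tendstoD(2)[OF this, of "\<delta> / 2"] assms
  have "\<forall>\<^sub>F n in sequentially. card T * q ^ n < \<delta> / 2"
    by simp
  then obtain l where l: "\<And>n. n \<ge> l \<Longrightarrow> card T * q ^ n < \<delta> / 2"
    by (auto simp: eventually_sequentially)
  have main: "prob {\<omega>. known g n 0 0 \<omega> = None} \<le> \<delta>" if n: "n \<ge> l + m" and g: "inj g" for n g
  proof -
    obtain B\<^sub>1 where B1: "B\<^sub>1 \<in> sets uniform_samples"
      "{\<omega>. \<exists>y. dead_path (err g \<omega>) m n 0 0 y} \<subseteq> B\<^sub>1" "prob B\<^sub>1 \<le> 4 * (1 / 2) ^ m"
      using prob_dead_path[OF g, of m n] by (elim bexE conjE) (rule that)
    have "\<forall>z. \<exists>B. B \<in> sets uniform_samples \<and>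
        {\<omega>. \<forall>z'\<in>open_path (err g \<omega>) (n - snd z) (fst z) (snd z). p\<^sub>0 \<le> \<omega> (g z') \<and> \<not> err g \<omega> z'} \<subseteq> B \<and>
        prob B \<le> q ^ (n - snd z)"
      using prob_open_path[OF g p\<^sub>0_bounds(1,2), unfolded Bex_def] unfolding q_def by (rule allI)
    from choice[OF this] obtain B where
      B': "\<forall>z. B z \<in> sets uniform_samples \<and>
        {\<omega>. \<forall>z'\<in>open_path (err g \<omega>) (n - snd z) (fst z) (snd z). p\<^sub>0 \<le> \<omega> (g z') \<and> \<not> err g \<omega> z'} \<subseteq> B z \<and>
        prob (B z) \<le> q ^ (n - snd z)" ..
    have B: "B z \<in> sets uniform_samples"
      "{\<omega>. \<forall>z'\<in>open_path (err g \<omega>) (n - snd z) (fst z) (snd z). p\<^sub>0 \<le> \<omega> (g z') \<and> \<not> err g \<omega> z'} \<subseteq> B z"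
      "prob (B z) \<le> q ^ (n - snd z)" for z
      using spec[OF B', of z] by simp_all
    have "{\<omega>. known g n 0 0 \<omega> = None} \<subseteq> B\<^sub>1 \<union> (\<Union>z\<in>T. B z)"
    proof safe
      fix \<omega> assume \<omega>: "known g n 0 0 \<omega> = None" "\<omega> \<notin> (\<Union>z\<in>T. B z)"
      have "dead (err g \<omega>) (n - (s - 0)) x s"
        if "(x, s) \<in> cone m 0 0" "known g (n - (s - 0)) s x \<omega> \<noteq> Some \<alpha>" for x s
      proof (rule ccontr)
        assume "\<not> ?thesis"
        from not_dead_open_path[OF that(2) this] have "\<omega> \<in> B (x, s)"
          by (intro subsetD[OF B(2)[of "(x, s)"]]) simp
        with \<omega>(2) that(1) show False by (auto simp: T_def)
      qed
      from None_dead_path[OF \<omega>(1) _ this, of m] n have "\<exists>y. dead_path (err g \<omega>) m n 0 0 y"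
        by simp
      with B1(2) show "\<omega> \<in> B\<^sub>1" by blast
    qed
    then have "prob {\<omega>. known g n 0 0 \<omega> = None} \<le> prob (B\<^sub>1 \<union> (\<Union>z\<in>T. B z))"
      using B1 B by (intro samples.finite_measure_mono sets.Un sets.finite_UN) (auto simp: T_def)
    also have "\<dots> \<le> prob B\<^sub>1 + prob (\<Union>z\<in>T. B z)"
      using B1 B by (intro measure_Un_le sets.finite_UN) (auto simp: T_def)
    also have "prob (\<Union>z\<in>T. B z) \<le> (\<Sum>z\<in>T. prob (B z))"
      using B by (intro samples.finite_measure_subadditive_finite) (auto simp: T_def)
    also have "(\<Sum>z\<in>T. prob (B z)) \<le> (\<Sum>z\<in>T. q ^ (n - m))"
    proof (rule sum_mono)
      fix z assume "z \<in> T"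
      then have "n - m \<le> n - snd z" by (auto simp: T_def cone_def)
      with B(3)[of z] q show "prob (B z) \<le> q ^ (n - m)"
        by (meson less_imp_le order.trans power_decreasing)
    qed
    also have "(\<Sum>z\<in>T. q ^ (n - m)) \<le> \<delta> / 2"
      using less_imp_le[OF l[of "n - m"]] n by simp
    finally show ?thesis using B1(3) m by simp
  qed
  show ?thesis
  proof (intro exI[of _ "l + m"] allI impI)
    fix n g k assume n: "l + m \<le> n" and g: "inj (g :: int \<times> nat \<Rightarrow> nat)"
    have "inj (\<lambda>(i, d). g (i + k, d))"
      by (auto simp: inj_on_def inj_eq[OF g])
    from main[OF n this] show "prob {\<omega>. known g n 0 k \<omega> = None} \<le> \<delta>"
      using known_translate[of g k n 0 0] by simp
  qed
qed

section \<open>The law of finitely many steps\<close>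

definition nbhd :: "int set \<Rightarrow> int set" where
  "nbhd K = K \<union> (\<lambda>k. k + 1) ` K"

lemma cyl_partition:
  fixes x :: "'a config"
  assumes "finite K"
  shows "\<exists>!z. z \<in> PiE K (\<lambda>_. UNIV) \<and> x \<in> cyl K z"
proof (rule ex1I[of _ "restrict x K"])
  fix z assume "z \<in> PiE K (\<lambda>_. UNIV) \<and> x \<in> cyl K z"
  then show "z = restrict x K"
    by (auto simp: cyl_def PiE_iff extensional_def)
qed (auto simp: cyl_def)

text \<open>The probability of a cylinder after one step depends on finitely many cells only, so the
  integral is a finite sum of cylinder probabilities. In this form it commutes with limits.\<close>

lemma measure_bind_pca_cyl:
  assumes M: "M \<in> space (prob_algebra cfg_space)" and K: "finite K"
  shows "measure (M \<bind> pca \<phi>) (cyl K y) =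
    (\<Sum>z\<in>PiE (nbhd K) (\<lambda>_. UNIV). measure M (cyl (nbhd K) z) * (\<Prod>k\<in>K. pmf (\<phi> (z k) (z (k + 1))) (y k)))"
proof -
  let ?Z = "PiE (nbhd K) (\<lambda>_. UNIV) :: 'a config set"
  let ?h = "\<lambda>z. \<Prod>k\<in>K. pmf (\<phi> (z k) (z (k + 1))) (y k)"
  have N: "finite (nbhd K)" and Z: "finite ?Z"
    using K by (auto simp: nbhd_def intro!: finite_PiE)
  have setsM: "sets M = sets cfg_space" and "prob_space M"
    using M by (auto simp: space_prob_algebra)
  interpret prob_space M by fact
  have spaceM: "space M = UNIV"
    using sets_eq_imp_space_eq[OF setsM] by simp
  have "measure (M \<bind> pca \<phi>) (cyl K y) = (\<integral>x. measure (pca \<phi> x) (cyl K y) \<partial>M)"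
  proof (rule measure_bind)
    show "pca \<phi> \<in> M \<rightarrow>\<^sub>M subprob_algebra cfg_space"
      using measurable_prob_algebraD[OF pca_kernel] measurable_cong_sets[OF setsM refl] by blast
  qed (use K in simp)
  also have "\<dots> = (\<integral>x. (\<Sum>z\<in>?Z. indicator (cyl (nbhd K) z) x * ?h z) \<partial>M)"
  proof (rule Bochner_Integration.integral_cong[OF refl])
    fix x
    obtain z where z: "z \<in> ?Z" "x \<in> cyl (nbhd K) z" and
      unique: "\<And>z'. z' \<in> ?Z \<Longrightarrow> x \<in> cyl (nbhd K) z' \<Longrightarrow> z' = z"
      using cyl_partition[OF N, of x] by auto
    have "(\<Sum>z\<in>?Z. indicator (cyl (nbhd K) z) x * ?h z) = (\<Sum>z'\<in>?Z. if z' = z then ?h z else 0)"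
    proof (rule sum.cong[OF refl])
      fix z' assume "z' \<in> ?Z"
      show "indicator (cyl (nbhd K) z') x * ?h z' = (if z' = z then ?h z else 0)"
      proof (cases "z' = z")
        case False
        with unique \<open>z' \<in> ?Z\<close> have "x \<notin> cyl (nbhd K) z'" by blast
        with False show ?thesis by simp
      qed (simp add: z(2))
    qed
    also have "\<dots> = ?h z" using Z z by simp
    also have "\<dots> = ?h x"
      using z(2) by (intro prod.cong) (auto simp: cyl_def nbhd_def)
    finally show "measure (pca \<phi> x) (cyl K y) = (\<Sum>z\<in>?Z. indicator (cyl (nbhd K) z) x * ?h z)"
      by (simp add: measure_pca_cyl[OF K])
  qed
  also have "\<dots> = (\<Sum>z\<in>?Z. \<integral>x. indicator (cyl (nbhd K) z) x * ?h z \<partial>M)"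
    using N by (intro Bochner_Integration.integral_sum) (simp add: setsM emeasure_finite less_top[symmetric])
  also have "\<dots> = (\<Sum>z\<in>?Z. measure M (cyl (nbhd K) z) * ?h z)"
    by (intro sum.cong) (simp_all add: spaceM)
  finally show ?thesis .
qed

lemma bind_pca_space: "M \<in> space (prob_algebra cfg_space) \<Longrightarrow> M \<bind> pca \<phi> \<in> space (prob_algebra cfg_space)"
  by (rule measurable_space[OF measurable_bind_prob_space[OF measurable_ident_sets[OF refl] pca_kernel]])

lemma kernel_pow_measurable: "kernel_pow (pca \<phi>) n \<in> cfg_space \<rightarrow>\<^sub>M prob_algebra cfg_space"
proof (induction n)
  case 0
  have "kernel_pow (pca \<phi>) 0 = return cfg_space" by auto
  then show ?case by (simp add: measurable_return_prob_space)
next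
  case (Suc n)
  have "kernel_pow (pca \<phi>) (Suc n) = (\<lambda>x. kernel_pow (pca \<phi>) n x \<bind> pca \<phi>)" by auto
  moreover have "(\<lambda>x. kernel_pow (pca \<phi>) n x \<bind> pca \<phi>) \<in> cfg_space \<rightarrow>\<^sub>M prob_algebra cfg_space"
    by (rule measurable_bind_prob_space[OF Suc.IH pca_kernel])
  ultimately show ?case by simp
qed

lemma kernel_pow_space: "kernel_pow (pca \<phi>) n x \<in> space (prob_algebra cfg_space)"
  using measurable_space[OF kernel_pow_measurable] by simp

text \<open>Age runs against time: row \<open>d\<close> is the newest, so the step peeled off is the
  last one. Its samples are disjoint from those of the older rows, so for fixed values
  \<open>z\<close> of the previous row the two events are independent.\<close>

lemma prob_val:
  assumes g: "inj g" and K: "finite K"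
  shows "prob {\<omega>. \<forall>k\<in>K. val x g r d k \<omega> = y k} = measure (kernel_pow (pca \<phi>) r x) (cyl K y)"
  using K
proof (induction r arbitrary: d K y)
  case 0
  have "measure (return cfg_space x) (cyl K y) = indicator (cyl K y) x"
    using 0 by (simp add: measure_return)
  moreover have "{\<omega>. \<forall>k\<in>K. val x g 0 d k \<omega> = y k} = (if x \<in> cyl K y then UNIV else {})"
    by (auto simp: cyl_def)
  ultimately show ?case
    using samples.prob_space by (simp add: indicator_def)
next
  case (Suc r)
  let ?K = "nbhd K"
  let ?Z = "PiE ?K (\<lambda>_. UNIV) :: 'a config set"
  have K: "finite ?K" and Z: "finite ?Z"
    using Suc.prems by (auto simp: nbhd_def intro!: finite_PiE)
  define A where "A z = {\<omega>. \<forall>k\<in>?K. val x g r (d + 1) k \<omega> = z k}" for z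
  define B where "B z = {\<omega>. \<forall>k\<in>K. \<omega> (g (k, d)) \<in> {u. update (z k) (z (k + 1)) u = y k}}" for z
  have A: "A z \<in> sets uniform_samples" for z
    unfolding A_def by (rule val_sets[OF K])
  have B: "B z \<in> sets uniform_samples" for z
    unfolding B_def by (rule sites_sets[OF Suc.prems, of _ "\<lambda>k. g (k, d)"]) (rule update_sets)
  have "{\<omega>. \<forall>k\<in>K. val x g (Suc r) d k \<omega> = y k} = (\<Union>z\<in>?Z. A z \<inter> B z)"
  proof (intro equalityI subsetI)
    fix \<omega> assume "\<omega> \<in> {\<omega>. \<forall>k\<in>K. val x g (Suc r) d k \<omega> = y k}"
    moreover define w where "w = restrict (\<lambda>k. val x g r (d + 1) k \<omega>) ?K"
    ultimately have "\<omega> \<in> A w \<inter> B w"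
      by (auto simp: A_def B_def nbhd_def)
    moreover have "w \<in> ?Z" by (simp add: w_def)
    ultimately show "\<omega> \<in> (\<Union>z\<in>?Z. A z \<inter> B z)" by (rule UN_I[rotated])
  qed (auto simp: A_def B_def nbhd_def)
  also have "prob \<dots> = (\<Sum>z\<in>?Z. prob (A z \<inter> B z))"
  proof (rule samples.finite_measure_finite_Union[OF Z])
    show "disjoint_family_on (\<lambda>z. A z \<inter> B z) ?Z"
      unfolding disjoint_family_on_def
    proof (intro ballI impI)
      fix z z' assume zz: "z \<in> ?Z" "z' \<in> ?Z" "z \<noteq> z'"
      then obtain k where "k \<in> ?K" "z k \<noteq> z' k"
        by (meson PiE_ext)
      then show "A z \<inter> B z \<inter> (A z' \<inter> B z') = {}"
        by (auto simp: A_def)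
    qed
  qed (use A B in auto)
  also have "\<dots> = (\<Sum>z\<in>?Z. measure (kernel_pow (pca \<phi>) r x) (cyl ?K z) * (\<Prod>k\<in>K. pmf (\<phi> (z k) (z (k + 1))) (y k)))"
  proof (rule sum.cong[OF refl])
    fix z
    have "determined (g ` (\<Union>k\<in>?K. cone r k (d + 1))) (A z)"
      unfolding A_def by (rule determined_val[OF K])
    moreover have "determined (g ` (\<lambda>k. (k, d)) ` K) (B z)"
      by (rule determinedI[OF B]) (auto simp: B_def)
    moreover have "g ` (\<Union>k\<in>?K. cone r k (d + 1)) \<inter> g ` (\<lambda>k. (k, d)) ` K = {}"
      by (auto simp: cone_def inj_eq[OF g])
    ultimately have "prob (A z \<inter> B z) = prob (A z) * prob (B z)"
      by (rule prob_determined_Int)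
    also have "prob (B z) = (\<Prod>k\<in>K. measure unif {u. update (z k) (z (k + 1)) u = y k})"
      unfolding B_def using Suc.prems g update_sets
      by (intro prob_sites) (auto simp: inj_on_def inj_eq[OF g])
    also have "prob (A z) = measure (kernel_pow (pca \<phi>) r x) (cyl ?K z)"
      unfolding A_def by (rule Suc.IH[OF K])
    finally show "prob (A z \<inter> B z) = measure (kernel_pow (pca \<phi>) r x) (cyl ?K z) *
        (\<Prod>k\<in>K. pmf (\<phi> (z k) (z (k + 1))) (y k))"
      by (simp add: prob_update)
  qed
  also have "\<dots> = measure (kernel_pow (pca \<phi>) (Suc r) x) (cyl K y)"
    using measure_bind_pca_cyl[OF kernel_pow_space Suc.prems] by simp
  finally show ?case .
qed

end

section \<open>Ergodicity and mixing\<close>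

lemma cfg_measure_eqI:
  fixes P Q :: "'a::finite config measure"
  assumes P: "P \<in> space (prob_algebra cfg_space)" and Q: "Q \<in> space (prob_algebra cfg_space)"
    and eq: "\<And>K y. finite K \<Longrightarrow> measure P (cyl K y) = measure Q (cyl K y)"
  shows "P = Q"
proof (rule measure_eqI_PiM_infinite[where I = UNIV and M = "\<lambda>_. count_space UNIV"])
  have sets: "sets P = sets cfg_space" "sets Q = sets cfg_space" and "prob_space P" "prob_space Q"
    using P Q by (auto simp: space_prob_algebra)
  interpret P: prob_space P by fact
  interpret Q: prob_space Q by fact
  show "finite_measure P" by unfold_locales
  show "sets P = sets (Pi\<^sub>M UNIV (\<lambda>_. count_space UNIV))" "sets Q = sets (Pi\<^sub>M UNIV (\<lambda>_. count_space UNIV))"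
    using sets by (simp_all add: cfg_space_def)
  fix A :: "int \<Rightarrow> 'a set" and J :: "int set" assume J: "finite J"
  have fin: "finite (PiE J A)"
    using J by (intro finite_PiE) auto
  have disj: "disjoint_family_on (cyl J) (PiE J A)"
    unfolding disjoint_family_on_def
  proof (intro ballI impI)
    fix z z' assume "z \<in> PiE J A" "z' \<in> PiE J A" "z \<noteq> z'"
    then obtain k where "k \<in> J" "z k \<noteq> z' k" by (meson PiE_ext)
    then show "cyl J z \<inter> cyl J z' = {}" by (auto simp: cyl_def)
  qed
  have U: "prod_emb UNIV (\<lambda>_. count_space UNIV) J (Pi\<^sub>E J A) = (\<Union>z\<in>PiE J A. cyl J z)"
  proof (intro equalityI subsetI)
    fix x assume "x \<in> prod_emb UNIV (\<lambda>_. count_space UNIV) J (Pi\<^sub>E J A)"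
    then have "restrict x J \<in> PiE J A" by (auto simp: prod_emb_def)
    moreover have "x \<in> cyl J (restrict x J)" by (simp add: cyl_def)
    ultimately show "x \<in> (\<Union>z\<in>PiE J A. cyl J z)" by (rule UN_I[where a = "restrict x J"])
  qed (auto simp: prod_emb_def cyl_def PiE_iff)
  have "measure P (\<Union>z\<in>PiE J A. cyl J z) = measure Q (\<Union>z\<in>PiE J A. cyl J z)"
    using J eq[OF J] sets
    by (subst P.finite_measure_finite_Union[OF fin _ disj], force,
        subst Q.finite_measure_finite_Union[OF fin _ disj], force) simp
  then show "emeasure P (prod_emb UNIV (\<lambda>_. count_space UNIV) J (Pi\<^sub>E J A)) =
      emeasure Q (prod_emb UNIV (\<lambda>_. count_space UNIV) J (Pi\<^sub>E J A))"
    unfolding U P.emeasure_eq_measure Q.emeasure_eq_measure by simp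
qed

lemma shift_cyl: "shift (- k) ` cyl L v = cyl ((\<lambda>l. l + k) ` L) (\<lambda>l. v (l - k))"
proof (intro equalityI subsetI)
  fix x :: "'a config" assume x: "x \<in> cyl ((\<lambda>l. l + k) ` L) (\<lambda>l. v (l - k))"
  then have "shift k x \<in> cyl L v"
    by (auto simp: cyl_def shift_def add.commute)
  moreover have "shift (- k) (shift k x) = x" by (auto simp: shift_def)
  ultimately show "x \<in> shift (- k) ` cyl L v" by (metis image_eqI)
qed (auto simp: cyl_def shift_def)

lemma small_multiple:
  fixes e :: real
  assumes "e > 0"
  obtains \<delta> where "\<delta> > 0" "real c * \<delta> < e"
proof
  show "e / (real c + 1) > 0" using assms by simp
  show "real c * (e / (real c + 1)) < e" using assms by (simp add: field_simps)
qed

text \<open>Cells are counted from a base \<open>b\<close>, which will be the left end of the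
  sampler's input: from there on to the right the index is a plain polynomial expression.
  \<open>int_encode\<close> keeps the numbering injective on all of \<open>int\<close>.\<close>

definition site :: "int \<Rightarrow> int \<times> nat \<Rightarrow> nat" where
  "site b = (\<lambda>(k, d). prod_encode (int_encode (k - b), d))"

lemma inj_site: "inj (site b)"
  by (auto simp: site_def inj_on_def prod_encode_eq int_encode_eq)

context noisy_ca
begin

section \<open>The coalesced configuration and its law\<close>

text \<open>By \<open>known_mono\<close> every stage at which the cell is known gives the same
  value. The default \<open>\<alpha>\<close> is met with probability zero only.\<close>

definition known_limit :: "(int \<times> nat \<Rightarrow> nat) \<Rightarrow> int \<Rightarrow> (nat \<Rightarrow> real) \<Rightarrow> 'a" where
  "known_limit g k \<omega> = (if \<exists>n. known g n 0 k \<omega> \<noteq> None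
     then the (known g (LEAST n. known g n 0 k \<omega> \<noteq> None) 0 k \<omega>) else \<alpha>)"

lemma known_limit_eq:
  assumes "known g n 0 k \<omega> = Some c"
  shows "known_limit g k \<omega> = c"
proof -
  define l where "l = (LEAST n. known g n 0 k \<omega> \<noteq> None)"
  have "known g n 0 k \<omega> \<noteq> None"
    using assms by simp
  then have "known g l 0 k \<omega> \<noteq> None" "l \<le> n"
    unfolding l_def by (rule LeastI, rule Least_le)
  then have "known g n 0 k \<omega> = known g l 0 k \<omega>"
    using known_mono by (metis not_None_eq)
  moreover have "\<exists>n. known g n 0 k \<omega> \<noteq> None"
    using assms by auto
  moreover from calculation(1) have "the (known g l 0 k \<omega>) = c"
    using assms by (metis option.sel)
  ultimately show ?thesis
    unfolding known_limit_def l_def[symmetric] by simp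
qed

lemma known_limit_sets: "{\<omega>. known_limit g k \<omega> = c} \<in> sets uniform_samples"
proof -
  have "{\<omega>. known_limit g k \<omega> = c} = (\<Union>n. {\<omega>. known g n 0 k \<omega> = Some c}) \<union>
      (if c = \<alpha> then (\<Inter>n. {\<omega>. known g n 0 k \<omega> = None}) else {})"
  proof -
    have "known_limit g k \<omega> = c \<longleftrightarrow> (\<exists>n. known g n 0 k \<omega> = Some c) \<or> c = \<alpha> \<and> (\<forall>n. known g n 0 k \<omega> = None)" for \<omega>
    proof (cases "\<exists>n c. known g n 0 k \<omega> = Some c")
      case True
      then obtain n c' where "known g n 0 k \<omega> = Some c'" by blast
      then show ?thesis using known_limit_eq by (metis option.distinct(1))
    next
      case False
      then have "\<forall>n. known g n 0 k \<omega> = None" by (metis not_None_eq)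
      then show ?thesis by (auto simp: known_limit_def)
    qed
    then show ?thesis by auto
  qed
  then show ?thesis by (simp add: known_sets)
qed

lemma known_limits_sets:
  assumes "finite K"
  shows "{\<omega>. \<forall>k\<in>K. known_limit g k \<omega> = y k} \<in> sets uniform_samples"
proof -
  have "Measurable.pred uniform_samples (\<lambda>\<omega>. \<forall>k\<in>K. known_limit g k \<omega> = y k)"
    using assms known_limit_sets by (intro pred_intros_finite) (auto simp: pred_def)
  then show ?thesis by (simp add: pred_def)
qed

text \<open>The coupling inequality: the run from \<open>x\<close> and the limit agree unless some
  cell of \<open>K\<close> is still unknown. The bound sees only the size of \<open>K\<close>, which
  mixing needs for cylinders that move away.\<close>

lemma kernel_pow_near_limit:
  fixes \<delta> :: real
  assumes "\<delta> > 0"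
  shows "\<exists>n\<^sub>0. \<forall>n\<ge>n\<^sub>0. \<forall>g K x y. inj g \<longrightarrow> finite K \<longrightarrow>
    \<bar>measure (kernel_pow (pca \<phi>) n x) (cyl K y) - prob {\<omega>. \<forall>k\<in>K. known_limit g k \<omega> = y k}\<bar> \<le> card K * \<delta>"
proof -
  from known_eventually[OF assms] obtain n\<^sub>0 where
    n0: "\<And>n g k. n \<ge> n\<^sub>0 \<Longrightarrow> inj g \<Longrightarrow> prob {\<omega>. known g n 0 k \<omega> = None} \<le> \<delta>"
    by blast
  have "\<bar>measure (kernel_pow (pca \<phi>) n x) (cyl K y) - prob {\<omega>. \<forall>k\<in>K. known_limit g k \<omega> = y k}\<bar> \<le> card K * \<delta>"
    if n: "n \<ge> n\<^sub>0" and g: "inj g" and K: "finite K" for n g K x y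
  proof -
    let ?A = "{\<omega>. \<forall>k\<in>K. val x g n 0 k \<omega> = y k}"
    let ?B = "{\<omega>. \<forall>k\<in>K. known_limit g k \<omega> = y k}"
    let ?N = "\<Union>k\<in>K. {\<omega>. known g n 0 k \<omega> = None}"
    have sets: "?A \<in> sets uniform_samples" "?B \<in> sets uniform_samples" "?N \<in> sets uniform_samples"
      using K by (auto intro: val_sets known_limits_sets sets.finite_UN known_sets)
    have "prob ?N \<le> (\<Sum>k\<in>K. prob {\<omega>. known g n 0 k \<omega> = None})"
      using K by (intro samples.finite_measure_subadditive_finite) (auto simp: known_sets)
    also have "\<dots> \<le> (\<Sum>k\<in>K. \<delta>)"
      by (intro sum_mono n0 n g)
    finally have N: "prob ?N \<le> card K * \<delta>" by simp
    have agree: "val x g n 0 k \<omega> = known_limit g k \<omega>" if "\<omega> \<notin> ?N" "k \<in> K" for k \<omega>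
    proof -
      from that obtain c where "known g n 0 k \<omega> = Some c" by auto
      then show ?thesis using known_val known_limit_eq by metis
    qed
    have "?A \<subseteq> ?B \<union> ?N" "?B \<subseteq> ?A \<union> ?N"
      using agree by auto
    then have "prob ?A \<le> prob (?B \<union> ?N)" "prob ?B \<le> prob (?A \<union> ?N)"
      using sets by (auto intro!: samples.finite_measure_mono)
    moreover have "prob (?B \<union> ?N) \<le> prob ?B + prob ?N" "prob (?A \<union> ?N) \<le> prob ?A + prob ?N"
      using sets by (auto intro!: measure_Un_le)
    ultimately show ?thesis
      using N unfolding prob_val[OF g K, symmetric, of n x y 0] by linarith
  qed
  then show ?thesis by blast
qed

definition \<pi> :: "'a config measure" where
  "\<pi> = distr uniform_samples cfg_space (\<lambda>\<omega> k. known_limit (site 0) k \<omega>)"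

lemma measurable_known_limit:
  "(\<lambda>\<omega> k. known_limit g k \<omega>) \<in> uniform_samples \<rightarrow>\<^sub>M cfg_space"
  unfolding cfg_space_def
proof (rule measurable_PiM_single')
  fix k
  show "known_limit g k \<in> uniform_samples \<rightarrow>\<^sub>M count_space UNIV"
    using known_limit_sets[of g k]
    by (auto simp: measurable_count_space_eq2 vimage_def)
qed auto

lemma \<pi>_space: "\<pi> \<in> space (prob_algebra cfg_space)"
  unfolding \<pi>_def space_prob_algebra
  by (simp add: samples.prob_space_distr[OF measurable_known_limit])

lemma measure_\<pi>_cyl:
  assumes K: "finite K"
  shows "measure \<pi> (cyl K y) =
    prob {\<omega>. \<forall>k\<in>K. known_limit (site 0) k \<omega> = y k}"
  unfolding \<pi>_def using cyl_sets[OF K, of y]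
  by (subst measure_distr[OF measurable_known_limit]) (auto simp: cyl_def vimage_def)

lemma kernel_pow_near_\<pi>:
  fixes \<delta> :: real
  assumes "\<delta> > 0"
  shows "\<exists>n\<^sub>0. \<forall>n\<ge>n\<^sub>0. \<forall>K x y. finite K \<longrightarrow>
    \<bar>measure (kernel_pow (pca \<phi>) n x) (cyl K y) - measure \<pi> (cyl K y)\<bar> \<le> card K * \<delta>"
proof -
  from kernel_pow_near_limit[OF assms] obtain n\<^sub>0 where n0: "\<forall>n\<ge>n\<^sub>0. \<forall>g K x y. inj g \<longrightarrow> finite K \<longrightarrow>
    \<bar>measure (kernel_pow (pca \<phi>) n x) (cyl K y) - prob {\<omega>. \<forall>k\<in>K. known_limit g k \<omega> = y k}\<bar> \<le> card K * \<delta>" ..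
  from n0[rule_format, OF _ inj_site[of 0]] show ?thesis
    by (intro exI[of _ n\<^sub>0] allI impI) (simp add: measure_\<pi>_cyl)
qed

lemma kernel_pow_uniform_limit:
  assumes K: "finite K"
  shows "uniform_limit UNIV (\<lambda>t x. measure (kernel_pow (pca \<phi>) t x) (cyl K y)) (\<lambda>_. measure \<pi> (cyl K y)) sequentially"
proof (rule uniform_limitI)
  fix e :: real assume e: "e > 0"
  from small_multiple[OF this, of "card K"] obtain \<delta> where \<delta>: "\<delta> > 0" "real (card K) * \<delta> < e" .
  from kernel_pow_near_\<pi>[OF \<delta>(1)] obtain n\<^sub>0 where n0: "\<forall>n\<ge>n\<^sub>0. \<forall>K x y. finite K \<longrightarrow>
    \<bar>measure (kernel_pow (pca \<phi>) n x) (cyl K y) - measure \<pi> (cyl K y)\<bar> \<le> card K * \<delta>" ..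
  show "\<forall>\<^sub>F n in sequentially. \<forall>x\<in>UNIV. dist (measure (kernel_pow (pca \<phi>) n x) (cyl K y)) (measure \<pi> (cyl K y)) < e"
    unfolding eventually_sequentially dist_real_def
    using order.strict_trans1[OF n0[rule_format, OF _ K] \<delta>(2)] by blast
qed

lemma kernel_pow_tendsto:
  "finite K \<Longrightarrow> (\<lambda>t. measure (kernel_pow (pca \<phi>) t x) (cyl K y)) \<longlonglongrightarrow> measure \<pi> (cyl K y)"
  by (rule tendsto_uniform_limitI[OF kernel_pow_uniform_limit]) auto

text \<open>The kernel powers do not mention \<open>g\<close>, and they converge to both sides. So
  the numbering may be translated, or chosen by the sampler according to its input.\<close>

lemma prob_known_limit:
  assumes g: "inj g" and K: "finite K"
  shows "prob {\<omega>. \<forall>k\<in>K. known_limit g k \<omega> = y k} = measure \<pi> (cyl K y)"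
proof -
  have "(\<lambda>t. measure (kernel_pow (pca \<phi>) t (\<lambda>_. \<alpha>)) (cyl K y)) \<longlonglongrightarrow>
      prob {\<omega>. \<forall>k\<in>K. known_limit g k \<omega> = y k}"
  proof (rule LIMSEQ_I)
    fix e :: real assume e: "e > 0"
    from small_multiple[OF this, of "card K"] obtain \<delta> where \<delta>: "\<delta> > 0" "real (card K) * \<delta> < e" .
    from kernel_pow_near_limit[OF \<delta>(1)] obtain n\<^sub>0 where n0: "\<forall>n\<ge>n\<^sub>0. \<forall>g K x y. inj g \<longrightarrow> finite K \<longrightarrow>
      \<bar>measure (kernel_pow (pca \<phi>) n x) (cyl K y) - prob {\<omega>. \<forall>k\<in>K. known_limit g k \<omega> = y k}\<bar> \<le> card K * \<delta>" ..
    show "\<exists>n\<^sub>0. \<forall>n\<ge>n\<^sub>0. norm (measure (kernel_pow (pca \<phi>) n (\<lambda>_. \<alpha>)) (cyl K y) -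
        prob {\<omega>. \<forall>k\<in>K. known_limit g k \<omega> = y k}) < e"
      unfolding real_norm_def using order.strict_trans1[OF n0[rule_format, OF _ g K] \<delta>(2)] by blast
  qed
  with kernel_pow_tendsto[OF K] show ?thesis
    by (rule LIMSEQ_unique[symmetric])
qed

text \<open>Passing to the limit in the one-step formula for cylinders; the powers with exponents
  \<open>t\<close> and \<open>Suc t\<close> have the same limit.\<close>

lemma invariant_\<pi>: "invariant_measure (pca \<phi>) \<pi>"
  unfolding invariant_measure_def
proof (intro conjI \<pi>_space cfg_measure_eqI bind_pca_space)
  fix K y assume K: "finite (K :: int set)"
  let ?h = "\<lambda>z. \<Prod>k\<in>K. pmf (\<phi> (z k) (z (k + 1))) (y k)"
  have N: "finite (nbhd K)" using K by (simp add: nbhd_def)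
  have "(\<lambda>t. \<Sum>z\<in>PiE (nbhd K) (\<lambda>_. UNIV). measure (kernel_pow (pca \<phi>) t (\<lambda>_. \<alpha>)) (cyl (nbhd K) z) * ?h z)
      \<longlonglongrightarrow> (\<Sum>z\<in>PiE (nbhd K) (\<lambda>_. UNIV). measure \<pi> (cyl (nbhd K) z) * ?h z)"
    by (intro tendsto_sum tendsto_mult kernel_pow_tendsto[OF N] tendsto_const)
  then have "(\<lambda>t. measure (kernel_pow (pca \<phi>) (Suc t) (\<lambda>_. \<alpha>)) (cyl K y)) \<longlonglongrightarrow> measure (\<pi> \<bind> pca \<phi>) (cyl K y)"
    using measure_bind_pca_cyl[OF kernel_pow_space K] measure_bind_pca_cyl[OF \<pi>_space K] by simp
  moreover have "(\<lambda>t. measure (kernel_pow (pca \<phi>) (Suc t) (\<lambda>_. \<alpha>)) (cyl K y)) \<longlonglongrightarrow> measure \<pi> (cyl K y)"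
    using kernel_pow_tendsto[OF K] by (rule LIMSEQ_Suc)
  ultimately show "measure (\<pi> \<bind> pca \<phi>) (cyl K y) = measure \<pi> (cyl K y)"
    by (rule LIMSEQ_unique)
qed

lemma invariant_kernel_pow:
  assumes "invariant_measure (pca \<phi>) \<mu>"
  shows "\<mu> \<bind> kernel_pow (pca \<phi>) n = \<mu>"
proof -
  have \<mu>: "\<mu> \<in> space (prob_algebra cfg_space)" "\<mu> \<bind> pca \<phi> = \<mu>"
    using assms by (auto simp: invariant_measure_def)
  have sets: "sets \<mu> = sets cfg_space" using \<mu>(1) by (auto simp: space_prob_algebra)
  show ?thesis
  proof (induction n)
    case 0
    have "\<mu> \<bind> return cfg_space = \<mu>"
      using bind_return''[of \<mu> cfg_space] sets by simp
    moreover have "kernel_pow (pca \<phi>) 0 = return cfg_space" by auto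
    ultimately show ?case by simp
  next
    case (Suc n)
    have "kernel_pow (pca \<phi>) n \<in> \<mu> \<rightarrow>\<^sub>M subprob_algebra cfg_space"
      using measurable_prob_algebraD[OF kernel_pow_measurable] measurable_cong_sets[OF sets refl] by blast
    from bind_assoc[OF this measurable_prob_algebraD[OF pca_kernel[of \<phi>]]]
    have "\<mu> \<bind> (\<lambda>x. kernel_pow (pca \<phi>) n x \<bind> pca \<phi>) = \<mu>"
      unfolding Suc \<mu>(2) by (rule sym)
    moreover have "kernel_pow (pca \<phi>) (Suc n) = (\<lambda>x. kernel_pow (pca \<phi>) n x \<bind> pca \<phi>)" by auto
    ultimately show ?case by simp
  qed
qed

text \<open>\<open>\<mu>\<close> is also invariant under every power, and the integrand tends to a
  constant by ergodicity, so dominated convergence applies.\<close>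

lemma invariant_unique:
  assumes "invariant_measure (pca \<phi>) \<mu>"
  shows "\<mu> = \<pi>"
proof (rule cfg_measure_eqI)
  show \<mu>: "\<mu> \<in> space (prob_algebra cfg_space)" using assms by (simp add: invariant_measure_def)
  then have sets: "sets \<mu> = sets cfg_space" and "prob_space \<mu>" by (auto simp: space_prob_algebra)
  interpret prob_space \<mu> by fact
  fix K y assume K: "finite (K :: int set)"
  have meas: "kernel_pow (pca \<phi>) n \<in> \<mu> \<rightarrow>\<^sub>M subprob_algebra cfg_space" for n
    using measurable_prob_algebraD[OF kernel_pow_measurable] measurable_cong_sets[OF sets refl] by blast
  have int: "(\<lambda>x. measure (kernel_pow (pca \<phi>) n x) (cyl K y)) \<in> borel_measurable \<mu>" for n
    by (rule measurable_compose[OF meas measurable_measure_subprob_algebra[OF cyl_sets[OF K]]])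
  have "measure \<mu> (cyl K y) = (\<integral>x. measure (kernel_pow (pca \<phi>) n x) (cyl K y) \<partial>\<mu>)" for n
  proof -
    have "measure (\<mu> \<bind> kernel_pow (pca \<phi>) n) (cyl K y) = (\<integral>x. measure (kernel_pow (pca \<phi>) n x) (cyl K y) \<partial>\<mu>)"
      by (rule measure_bind[OF meas cyl_sets[OF K]])
    then show ?thesis by (simp add: invariant_kernel_pow[OF assms])
  qed
  moreover have "(\<lambda>n. \<integral>x. measure (kernel_pow (pca \<phi>) n x) (cyl K y) \<partial>\<mu>) \<longlonglongrightarrow> (\<integral>x. measure \<pi> (cyl K y) \<partial>\<mu>)"
  proof (rule integral_dominated_convergence[where w = "\<lambda>_. 1"])
    show "AE x in \<mu>. norm (measure (kernel_pow (pca \<phi>) n x) (cyl K y)) \<le> 1" for n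
    proof (rule AE_I2)
      fix x
      have "prob_space (kernel_pow (pca \<phi>) n x)"
        using kernel_pow_space[of n x] by (simp add: space_prob_algebra)
      then show "norm (measure (kernel_pow (pca \<phi>) n x) (cyl K y)) \<le> 1"
        by (simp add: prob_space.prob_le_1)
    qed
  qed (auto intro: int kernel_pow_tendsto[OF K])
  ultimately show "measure \<mu> (cyl K y) = measure \<pi> (cyl K y)"
    using LIMSEQ_unique[OF tendsto_const] by (simp add: prob_space)
qed (rule \<pi>_space)

lemma uniformly_ergodic: "uniformly_ergodic_to (pca \<phi>) \<pi>"
  unfolding uniformly_ergodic_to_def
  by (intro conjI allI impI invariant_\<pi> invariant_unique kernel_pow_uniform_limit)

lemma known_limit_translate: "known_limit (\<lambda>(k, d). g (k + c, d)) k \<omega> = known_limit g (k + c) \<omega>"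
  by (simp only: known_limit_def known_translate)

lemma \<pi>_translate:
  assumes L: "finite L"
  shows "measure \<pi> (cyl ((\<lambda>l. l + c) ` L) (\<lambda>l. v (l - c))) = measure \<pi> (cyl L v)"
proof -
  define g where "g = site 0"
  have g: "inj g" unfolding g_def by (rule inj_site)
  have g': "inj (\<lambda>(k, d). g (k + c, d))"
    by (auto simp: inj_on_def inj_eq[OF g])
  have "measure \<pi> (cyl ((\<lambda>l. l + c) ` L) (\<lambda>l. v (l - c))) =
      prob {\<omega>. \<forall>k\<in>(\<lambda>l. l + c) ` L. known_limit g k \<omega> = v (k - c)}"
    by (rule prob_known_limit[OF g, symmetric]) (use L in simp)
  also have "{\<omega>. \<forall>k\<in>(\<lambda>l. l + c) ` L. known_limit g k \<omega> = v (k - c)} =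
      {\<omega>. \<forall>k\<in>L. known_limit (\<lambda>(k, d). g (k + c, d)) k \<omega> = v k}"
    by (auto simp: known_limit_translate)
  also have "prob \<dots> = measure \<pi> (cyl L v)"
    by (rule prob_known_limit[OF g' L])
  finally show ?thesis .
qed

text \<open>After \<open>n\<close> steps a cell depends only on the samples of its cone, and cones
  of cells more than \<open>n\<close> apart are disjoint.\<close>

lemma kernel_pow_indep:
  assumes K: "finite K" and L: "finite L"
    and far: "\<And>k l. k \<in> K \<Longrightarrow> l \<in> L \<Longrightarrow> \<bar>k - l\<bar> > int n"
  shows "measure (kernel_pow (pca \<phi>) n x) (cyl K u \<inter> cyl L v) =
    measure (kernel_pow (pca \<phi>) n x) (cyl K u) * measure (kernel_pow (pca \<phi>) n x) (cyl L v)"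
proof -
  define g where "g = site 0"
  have g: "inj g" unfolding g_def by (rule inj_site)
  let ?E = "\<lambda>K u. {\<omega>. \<forall>k\<in>K. val x g n 0 k \<omega> = u k}"
  define w where "w i = (if i \<in> K then u i else v i)" for i
  have KL: "k \<notin> K" if "k \<in> L" for k
    using far[of k k] that by auto
  have "cone n k 0 \<inter> cone n l 0 = {}" if "k \<in> K" "l \<in> L" for k l
    using far[OF that] by (auto simp: cone_def)
  then have "g ` (\<Union>k\<in>K. cone n k 0) \<inter> g ` (\<Union>k\<in>L. cone n k 0) = {}"
    unfolding image_Int[OF g, symmetric] by (simp add: Int_UN_distrib2)
  from prob_determined_Int[OF determined_val[OF K] determined_val[OF L] this]
  have "prob (?E K u \<inter> ?E L v) = prob (?E K u) * prob (?E L v)" .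
  also have "?E K u \<inter> ?E L v = ?E (K \<union> L) w"
    using KL by (auto simp: w_def)
  also have "prob (?E (K \<union> L) w) = measure (kernel_pow (pca \<phi>) n x) (cyl (K \<union> L) w)"
    using K L by (intro prob_val[OF g]) simp
  also have "cyl (K \<union> L) w = cyl K u \<inter> cyl L v"
    using KL by (auto simp: w_def cyl_def)
  finally show ?thesis
    by (simp only: prob_val[OF g K] prob_val[OF g L])
qed

lemma spatially_mixing_\<pi>: "spatially_mixing \<pi>"
  unfolding spatially_mixing_def
proof (intro allI impI tendstoI)
  fix K L :: "int set" and u v :: "'a config" and e :: real
  assume K: "finite K" and L: "finite L" and e: "e > 0"
  interpret \<pi>: prob_space \<pi>
    using \<pi>_space by (simp add: space_prob_algebra)
  \<comment> \<open>Two approximations of \<open>\<pi>\<close> by the law after \<open>n\<close>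
    steps are made, one for the joint cylinder and one for the product; each costs at most
    \<open>(card K + card L) * \<delta>\<close>, whatever the shift is.\<close>
  from small_multiple[OF e, of "2 * (card K + card L)"] obtain \<delta> where
    \<delta>: "\<delta> > 0" "real (2 * (card K + card L)) * \<delta> < e" .
  from kernel_pow_near_\<pi>[OF \<delta>(1)] obtain n where "\<forall>n'\<ge>n. \<forall>K x y. finite K \<longrightarrow>
    \<bar>measure (kernel_pow (pca \<phi>) n' x) (cyl K y) - measure \<pi> (cyl K y)\<bar> \<le> card K * \<delta>" ..
  note n = this[rule_format, OF order_refl]
  define R where "R = Max (abs ` (K \<union> L))"
  have R: "\<bar>k\<bar> \<le> R" if "k \<in> K \<union> L" for k
    unfolding R_def using K L that by (intro Max_ge) auto
  have "dist (measure \<pi> (cyl K u \<inter> shift (- k) ` cyl L v)) (measure \<pi> (cyl K u) * measure \<pi> (cyl L v)) < e"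
    if k: "\<bar>k\<bar> \<ge> 2 * R + int n + 1" for k
  proof -
    let ?L = "(\<lambda>l. l + k) ` L" and ?v = "\<lambda>l. v (l - k)"
    let ?\<mu> = "measure (kernel_pow (pca \<phi>) n (\<lambda>_. \<alpha>))"
    interpret \<mu>: prob_space "kernel_pow (pca \<phi>) n (\<lambda>_. \<alpha>)"
      using kernel_pow_space by (simp add: space_prob_algebra)
    have L': "finite ?L" "card ?L = card L"
      using L by (auto simp: card_image)
    have far: "\<bar>i - l\<bar> > int n" if "i \<in> K" "l \<in> ?L" for i l
    proof -
      from that(2) obtain l' where "l' \<in> L" "l = l' + k" by blast
      with R[of i] R[of l'] that(1) k show ?thesis by simp
    qed
    define w where "w i = (if i \<in> K then u i else ?v i)" for i
    have KL: "i \<notin> K" if "i \<in> ?L" for i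
      using far[of i i] that by auto
    have w: "cyl K u \<inter> cyl ?L ?v = cyl (K \<union> ?L) w"
    proof -
      have "w i = u i" if "i \<in> K" for i using that by (simp add: w_def)
      moreover have "w i = ?v i" if "i \<in> ?L" for i using KL[OF that] by (simp add: w_def)
      ultimately show ?thesis unfolding cyl_def ball_Un Collect_conj_eq by simp
    qed
    have "\<bar>?\<mu> (cyl (K \<union> ?L) w) - measure \<pi> (cyl (K \<union> ?L) w)\<bar> \<le> card (K \<union> ?L) * \<delta>"
      using K L by (intro n) simp
    also have "card (K \<union> ?L) * \<delta> \<le> (card K + card L) * \<delta>"
      using card_Un_le[of K ?L] L' \<delta>(1) by (intro mult_right_mono) auto
    finally have 1: "\<bar>?\<mu> (cyl (K \<union> ?L) w) - measure \<pi> (cyl (K \<union> ?L) w)\<bar> \<le> (card K + card L) * \<delta>" .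
    have 2: "?\<mu> (cyl (K \<union> ?L) w) = ?\<mu> (cyl K u) * ?\<mu> (cyl ?L ?v)"
      unfolding w[symmetric] by (rule kernel_pow_indep[OF K L'(1) far])
    have "\<bar>?\<mu> (cyl K u) * ?\<mu> (cyl ?L ?v) - measure \<pi> (cyl K u) * measure \<pi> (cyl ?L ?v)\<bar>
        \<le> \<bar>?\<mu> (cyl K u) - measure \<pi> (cyl K u)\<bar> + \<bar>?\<mu> (cyl ?L ?v) - measure \<pi> (cyl ?L ?v)\<bar>"
    proof -
      define a b c d where "a = ?\<mu> (cyl K u)" "b = ?\<mu> (cyl ?L ?v)"
        "c = measure \<pi> (cyl K u)" "d = measure \<pi> (cyl ?L ?v)"
      have "\<bar>b\<bar> \<le> 1" "\<bar>c\<bar> \<le> 1" unfolding a_b_c_d_def by simp_all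
      have "\<bar>a * b - c * d\<bar> = \<bar>(a - c) * b + c * (b - d)\<bar>" by (simp add: algebra_simps)
      also have "\<dots> \<le> \<bar>a - c\<bar> * \<bar>b\<bar> + \<bar>c\<bar> * \<bar>b - d\<bar>"
        by (metis abs_mult abs_triangle_ineq)
      also have "\<dots> \<le> \<bar>a - c\<bar> * 1 + 1 * \<bar>b - d\<bar>"
        using \<open>\<bar>b\<bar> \<le> 1\<close> \<open>\<bar>c\<bar> \<le> 1\<close> by (intro add_mono mult_mono) auto
      finally show ?thesis by (simp add: a_b_c_d_def)
    qed
    also have "\<dots> \<le> card K * \<delta> + card L * \<delta>"
      using n[OF K, of "\<lambda>_. \<alpha>" u] n[OF L'(1), of "\<lambda>_. \<alpha>" ?v] L'(2) by simp
    finally have 3: "\<bar>?\<mu> (cyl K u) * ?\<mu> (cyl ?L ?v) - measure \<pi> (cyl K u) * measure \<pi> (cyl ?L ?v)\<bar>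
        \<le> (card K + card L) * \<delta>" by (simp add: distrib_right)
    have T: "measure \<pi> (cyl L v) = measure \<pi> (cyl ?L ?v)"
      by (rule \<pi>_translate[OF L, symmetric])
    have "real (2 * (card K + card L)) * \<delta> = (card K + card L) * \<delta> + (card K + card L) * \<delta>"
      by simp
    with 1 2 3 \<delta>(2) show ?thesis
      unfolding shift_cyl w dist_real_def T by linarith
  qed
  then show "\<forall>\<^sub>F k in filtercomap (\<lambda>k::int. \<bar>k\<bar>) at_top.
      dist (measure \<pi> (cyl K u \<inter> shift (- k) ` cyl L v)) (measure \<pi> (cyl K u) * measure \<pi> (cyl L v)) < e"
    unfolding eventually_filtercomap_at_top_linorder by blast
qed

end

section \<open>The sampling program\<close>

inductive_cases exec_SkipE: "exec \<phi> \<omega> Skip s t"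
inductive_cases exec_IAssignE: "exec \<phi> \<omega> (IAssign l e) s t"
inductive_cases exec_RAssignE: "exec \<phi> \<omega> (RAssign l e) s t"
inductive_cases exec_DrawE: "exec \<phi> \<omega> (Draw l) s t"
inductive_cases exec_SeqE: "exec \<phi> \<omega> (Seq c1 c2) s t"
inductive_cases exec_CondE: "exec \<phi> \<omega> (Cond b c1 c2) s t"
inductive_cases exec_WhileE: "exec \<phi> \<omega> (While b c) s t"

text \<open>Halting and output are stated as the existence of a final state; determinism lets one
  constructed run speak for all.\<close>

lemma exec_deterministic: "exec \<phi> \<omega> c s t \<Longrightarrow> exec \<phi> \<omega> c s t' \<Longrightarrow> t = t'"
proof (induction arbitrary: t' rule: exec.induct)
  case (exec_Skip s)
  then show ?case by (rule exec_SkipE) simp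
next
  case (exec_IAssign l e s)
  then show ?case by (rule exec_IAssignE) simp
next
  case (exec_RAssign l e s)
  then show ?case by (rule exec_RAssignE) simp
next
  case (exec_Draw l s)
  then show ?case by (rule exec_DrawE) simp
next
  case (exec_Seq c1 s s' c2 s'')
  from exec_Seq.prems show ?case
    by (rule exec_SeqE) (use exec_Seq.IH in metis)
next
  case (exec_CondT b s c1 s' c2)
  from exec_CondT.prems show ?case
    by (rule exec_CondE) (use exec_CondT in metis)+
next
  case (exec_CondF b s c2 s' c1)
  from exec_CondF.prems show ?case
    by (rule exec_CondE) (use exec_CondF in metis)+
next
  case (exec_WhileF b s c)
  from exec_WhileF.prems show ?case
    by (rule exec_WhileE) (use exec_WhileF.hyps in metis)+
next
  case (exec_WhileT b s c s' s'')
  from exec_WhileT.prems show ?case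
    by (rule exec_WhileE) (use exec_WhileT.IH exec_WhileT.hyps(1) in metis)+
qed

abbreviation store :: "int \<Rightarrow> int \<Rightarrow> mstate \<Rightarrow> mstate" where
  "store a v s \<equiv> s\<lparr>imem := (imem s)(a := v)\<rparr>"

definition For :: "int \<Rightarrow> iexp \<Rightarrow> 'a com \<Rightarrow> 'a com" where
  "For v e c = Seq (IAssign (IConst v) (IConst 0))
     (While (ILess (IMem (IConst v)) e) (Seq c (IAssign (IConst v) (IAdd (IMem (IConst v)) (IConst 1)))))"

text \<open>The bound is evaluated afresh in every pass, so the invariant must pin down its value;
  it is required again only after the counter has been increased.\<close>

lemma exec_For:
  assumes init: "I 0 (store v 0 s)"
    and cell: "\<And>i t. I i t \<Longrightarrow> imem t v = int i"
    and bound: "\<And>i t. I i t \<Longrightarrow> ival t e = int B"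
    and body: "\<And>i t. i < B \<Longrightarrow> I i t \<Longrightarrow>
      \<exists>t'. exec \<phi> \<omega> c t t' \<and> I (Suc i) (store v (imem t' v + 1) t')"
  shows "\<exists>t. exec \<phi> \<omega> (For v e c) s t \<and> I B t"
proof -
  let ?b = "ILess (IMem (IConst v)) e"
  let ?c = "Seq c (IAssign (IConst v) (IAdd (IMem (IConst v)) (IConst 1)))"
  have "\<exists>t'. exec \<phi> \<omega> (While ?b ?c) t t' \<and> I B t'" if "i + m = B" "I i t" for i m t
    using that
  proof (induction m arbitrary: i t)
    case 0
    then have "\<not> bval \<phi> t ?b" using cell[of i t] bound[of i t] by simp
    with 0 show ?case using exec_WhileF by fastforce
  next
    case (Suc m)
    then have b: "bval \<phi> t ?b" using cell[of i t] bound[of i t] by simp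
    from body[of i t] Suc.prems obtain t' where
      t': "exec \<phi> \<omega> c t t'" "I (Suc i) (store v (imem t' v + 1) t')" by auto
    have "exec \<phi> \<omega> ?c t (store v (imem t' v + 1) t')"
      using exec_Seq[OF t'(1) exec_IAssign[of \<phi> \<omega> "IConst v" "IAdd (IMem (IConst v)) (IConst 1)"]] by simp
    moreover from Suc.IH[OF _ t'(2)] Suc.prems obtain t'' where
      "exec \<phi> \<omega> (While ?b ?c) (store v (imem t' v + 1) t') t''" "I B t''" by auto
    ultimately show ?case using exec_WhileT[OF b] by blast
  qed
  from this[OF _ init, of B] obtain t where "exec \<phi> \<omega> (While ?b ?c) (store v 0 s) t" "I B t" by auto
  then show ?thesis
    unfolding For_def using exec_Seq[OF exec_IAssign[of \<phi> \<omega> "IConst v" "IConst 0" s]] by auto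
qed

text \<open>Negative integer cells hold the variables of the sampler: \<open>-1\<close> the number of rows drawn,
  \<open>-2\<close> and \<open>-3\<close> loop counters, \<open>-4\<close> whether some cell is still unknown, \<open>-5\<close> and \<open>-6\<close> the
  width and the left end of the smallest interval containing the input, \<open>-7\<close> the number of
  samples drawn; cell \<open>-10 - j\<close> is the \<open>j\<close>th cell of the current row. The real cell \<open>i \<ge> 0\<close>
  holds the \<open>i\<close>th sample.\<close>

abbreviation var :: "int \<Rightarrow> iexp" where "var a \<equiv> IMem (IConst a)"
abbreviation row :: "iexp \<Rightarrow> iexp" where "row e \<equiv> ISub (IConst (-10)) e"
abbreviation samp :: "'a rexp" where "samp \<equiv> RMem (IConst (-1))"

definition ieq :: "iexp \<Rightarrow> iexp \<Rightarrow> 'a bexp" where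
  "ieq e f = BAnd (BNot (ILess e f)) (BNot (ILess f e))"

definition bor :: "'a bexp \<Rightarrow> 'a bexp \<Rightarrow> 'a bexp" where
  "bor b c = BNot (BAnd (BNot b) (BNot c))"

lemma bval_ieq [simp]: "bval \<phi> s (ieq e f) \<longleftrightarrow> ival s e = ival s f"
  by (auto simp: ieq_def)

lemma bval_bor [simp]: "bval \<phi> s (bor b c) \<longleftrightarrow> bval \<phi> s b \<or> bval \<phi> s c"
  by (auto simp: bor_def)

text \<open>Follows \<open>pick\<close> by subtracting in place from a working copy of the sample;
  the stored sample survives for later stages.\<close>

primrec pick_com :: "('a \<Rightarrow> int) \<Rightarrow> 'a \<Rightarrow> 'a \<Rightarrow> 'a \<Rightarrow> 'a list \<Rightarrow> 'a com" where
  "pick_com code a b x [] = IAssign (row (var (-2))) (IConst (code x))"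
| "pick_com code a b x (y # ys) = Cond (RLess samp (RProb a b x))
     (IAssign (row (var (-2))) (IConst (code x)))
     (Seq (RAssign (IConst (-1)) (RSub samp (RProb a b x))) (pick_com code a b y ys))"

text \<open>The quantifier over all pairs is unrolled when the program is built; the probabilities
  enter as symbols.\<close>

primrec below_all :: "'a \<Rightarrow> ('a \<times> 'a) list \<Rightarrow> 'a bexp" where
  "below_all \<alpha> [] = ILess (IConst 0) (IConst 1)"
| "below_all \<alpha> (p # ps) = BAnd (RLess samp (RProb (fst p) (snd p) \<alpha>)) (below_all \<alpha> ps)"

lemma bval_below_all: "bval \<phi> s (below_all \<alpha> ps) \<longleftrightarrow> (\<forall>(a, b)\<in>set ps. rmem s (-1) < pmf (\<phi> a b) \<alpha>)"
  by (induction ps) auto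

locale sampler = noisy_ca \<phi> \<alpha> ys
  for \<phi> :: "'a::finite \<Rightarrow> 'a \<Rightarrow> 'a pmf" and \<alpha> :: 'a and ys :: "'a list" +
  fixes code :: "'a \<Rightarrow> int" and unk :: int
  assumes inj_code: "inj code" and unk: "unk \<notin> range code"
begin

definition cd :: "'a option \<Rightarrow> int" where
  "cd x = (case x of None \<Rightarrow> unk | Some a \<Rightarrow> code a)"

lemma cd_simps [simp]: "cd None = unk" "cd (Some a) = code a"
  by (simp_all add: cd_def)

lemma cd_eq: "cd x = code a \<longleftrightarrow> x = Some a" "cd x = unk \<longleftrightarrow> x = None"
proof -
  have "code a \<noteq> unk" "unk \<noteq> code a" for a using unk by (metis rangeI)+
  then show "cd x = code a \<longleftrightarrow> x = Some a" "cd x = unk \<longleftrightarrow> x = None"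
    using inj_code by (auto simp: cd_def inj_eq split: option.splits)
qed

text \<open>The quotient is \<open>1 - eps\<close>, with \<open>20736 = 12 ^ 4\<close>, built from
  integers because no other numerical real constants are available.\<close>

definition default_com :: "('a \<times> 'a) list \<Rightarrow> 'a com" where
  "default_com ps = Cond
     (bor (below_all \<alpha> ps)
       (BAnd (bor (ieq (IMem (row (var (-2)))) (IConst (code \<alpha>)))
                  (ieq (IMem (row (IAdd (var (-2)) (IConst 1)))) (IConst (code \<alpha>))))
             (RLess samp (RDiv (ROfInt (IConst 20735)) (ROfInt (IConst 20736))))))
     (IAssign (row (var (-2))) (IConst (code \<alpha>)))
     (IAssign (row (var (-2))) (IConst unk))"

primrec update_com :: "'a com \<Rightarrow> ('a \<times> 'a) list \<Rightarrow> 'a com" where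
  "update_com c [] = c"
| "update_com c (p # ps) = Cond
     (BAnd (ieq (IMem (row (var (-2)))) (IConst (code (fst p))))
           (ieq (IMem (row (IAdd (var (-2)) (IConst 1)))) (IConst (code (snd p)))))
     (pick_com code (fst p) (snd p) \<alpha> ys)
     (update_com c ps)"

definition pairs :: "('a \<times> 'a) list" where
  "pairs = List.product (\<alpha> # ys) (\<alpha> # ys)"

lemma set_pairs: "set pairs = UNIV"
  unfolding pairs_def set_product symbols(2) by simp

definition sets_cell :: "mstate \<Rightarrow> int \<Rightarrow> mstate \<Rightarrow> bool" where
  "sets_cell s v t \<longleftrightarrow> imem t = (imem s)(- 10 - imem s (-2) := v) \<and> drawn t = drawn s \<and>
     (\<forall>i. i \<noteq> -1 \<longrightarrow> rmem t i = rmem s i)"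

lemma exec_pick_com:
  "\<exists>t. exec \<phi> \<omega> (pick_com code a b x zs) s t \<and> sets_cell s (code (pick (pmf (\<phi> a b)) x zs (rmem s (-1)))) t"
proof (induction zs arbitrary: x s)
  case Nil
  show ?case
    using exec_IAssign[of \<phi> \<omega> "row (var (-2))" "IConst (code x)" s]
    by (intro exI conjI) (auto simp: sets_cell_def)
next
  case (Cons y zs)
  show ?case
  proof (cases "rmem s (-1) < pmf (\<phi> a b) x")
    case True
    then show ?thesis
      using exec_CondT[OF _ exec_IAssign[of \<phi> \<omega> "row (var (-2))" "IConst (code x)" s], of "RLess samp (RProb a b x)"]
      by (intro exI conjI) (auto simp: sets_cell_def)
  next
    case False
    define s' where "s' = s\<lparr>rmem := (rmem s)(-1 := rmem s (-1) - pmf (\<phi> a b) x)\<rparr>"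
    have "exec \<phi> \<omega> (RAssign (IConst (-1)) (RSub samp (RProb a b x))) s s'"
      using exec_RAssign[of \<phi> \<omega> "IConst (-1)" "RSub samp (RProb a b x)" s] by (simp add: s'_def)
    moreover from Cons.IH[of y s'] obtain t where t: "exec \<phi> \<omega> (pick_com code a b y zs) s' t"
      "sets_cell s' (code (pick (pmf (\<phi> a b)) y zs (rmem s' (-1)))) t" by blast
    ultimately have "exec \<phi> \<omega> (pick_com code a b x (y # zs)) s t"
      using False by (auto intro!: exec_CondF exec_Seq)
    moreover have "sets_cell s (code (pick (pmf (\<phi> a b)) x (y # zs) (rmem s (-1)))) t"
      using t(2) False by (auto simp: sets_cell_def s'_def)
    ultimately show ?thesis by blast
  qed
qed

lemma exec_default_com:
  assumes "imem s (- 10 - imem s (-2)) = cd x" "imem s (- 10 - (imem s (-2) + 1)) = cd y"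
    and "x = None \<or> y = None"
  shows "\<exists>t. exec \<phi> \<omega> (default_com pairs) s t \<and> sets_cell s (cd (known_update x y (rmem s (-1)))) t"
proof -
  have eps: "1 - eps = 20735 / 20736" by (simp add: eps_def power_one_over)
  let ?b = "(\<forall>a b. rmem s (-1) < pmf (\<phi> a b) \<alpha>) \<or> (x = Some \<alpha> \<or> y = Some \<alpha>) \<and> rmem s (-1) < 1 - eps"
  have ku: "known_update x y (rmem s (-1)) = (if ?b then Some \<alpha> else None)"
    using assms(3) by (auto simp: known_update_def split: option.splits)
  show ?thesis
  proof (cases ?b)
    case True
    then have "exec \<phi> \<omega> (default_com pairs) s (store (- 10 - imem s (-2)) (code \<alpha>) s)"
      unfolding default_com_def
      using exec_IAssign[of \<phi> \<omega> "row (var (-2))" "IConst (code \<alpha>)" s] assms(1,2)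
      by (intro exec_CondT) (auto simp: bval_below_all set_pairs eps cd_eq)
    then show ?thesis using True unfolding ku by (intro exI conjI) (auto simp: sets_cell_def)
  next
    case False
    then have "exec \<phi> \<omega> (default_com pairs) s (store (- 10 - imem s (-2)) unk s)"
      unfolding default_com_def
      using exec_IAssign[of \<phi> \<omega> "row (var (-2))" "IConst unk" s] assms(1,2)
      by (intro exec_CondF) (auto simp: bval_below_all set_pairs eps cd_eq)
    then show ?thesis using False unfolding ku by (intro exI conjI) (auto simp: sets_cell_def)
  qed
qed

lemma exec_update_com:
  assumes cells: "imem s (- 10 - imem s (-2)) = cd x" "imem s (- 10 - (imem s (-2) + 1)) = cd y"
  shows "\<exists>t. exec \<phi> \<omega> (update_com (default_com pairs) pairs) s t \<and>
    sets_cell s (cd (known_update x y (rmem s (-1)))) t"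
proof (cases "x = None \<or> y = None")
  case True
  from exec_default_com[OF cells this] obtain t where
    t: "exec \<phi> \<omega> (default_com pairs) s t" "sets_cell s (cd (known_update x y (rmem s (-1)))) t"
    by blast
  have "exec \<phi> \<omega> (update_com (default_com pairs) ps) s t" for ps
  proof (induction ps)
    case (Cons p ps)
    have "\<not> (cd x = code (fst p) \<and> cd y = code (snd p))"
      using True unfolding cd_eq by auto
    with Cons cells show ?case by (auto intro!: exec_CondF)
  qed (simp add: t(1))
  with t(2) show ?thesis by blast
next
  case False
  then obtain a b where ab: "x = Some a" "y = Some b" by auto
  obtain t where t: "exec \<phi> \<omega> (pick_com code a b \<alpha> ys) s t"
    "sets_cell s (code (pick (pmf (\<phi> a b)) \<alpha> ys (rmem s (-1)))) t"
    using exec_pick_com by blast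
  have "exec \<phi> \<omega> (update_com c ps) s t" if "(a, b) \<in> set ps" for ps c
    using that
  proof (induction ps)
    case (Cons p ps)
    show ?case
    proof (cases "p = (a, b)")
      case True
      with t(1) cells ab show ?thesis by (auto intro!: exec_CondT)
    next
      case False
      then have "\<not> (code a = code (fst p) \<and> code b = code (snd p))"
        using inj_code by (auto simp: inj_eq prod_eq_iff)
      with Cons False cells ab show ?thesis by (auto intro!: exec_CondF)
    qed
  qed simp
  moreover have "(a, b) \<in> set pairs" unfolding set_pairs by simp
  ultimately show ?thesis
    using t(2) ab by (auto simp: known_update_def update_def)
qed

end

context sampler
begin

text \<open>Here \<open>l\<close> is \<open>2 * w + 3 * n + 2\<close>, for width \<open>w\<close>
  and \<open>n\<close> rows, and its square exceeds every site index needed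
  (\<open>site_bound\<close>). New samples are appended and old ones kept: coupling from the past
  must reuse the same sample at the same site in every stage.\<close>

definition draw_com :: "'a com" where
  "draw_com = (let l = IAdd (IAdd (var (-5)) (var (-5))) (IAdd (IAdd (var (-1)) (var (-1))) (IAdd (var (-1)) (IConst 2)))
     in For (-2) (IMul l l) (Seq (Draw (var (-7))) (IAssign (IConst (-7)) (IAdd (var (-7)) (IConst 1)))))"

definition init_com :: "'a com" where
  "init_com = For (-2) (IAdd (var (-5)) (IAdd (var (-1)) (IConst 1))) (IAssign (row (var (-2))) (IConst unk))"

text \<open>The address is the pairing function of \<open>site_index\<close>: the local
  \<open>j\<close> is twice the cell number, and the local \<open>n\<close> adds the age of the row
  under construction.\<close>

definition cell_com :: "'a com" where
  "cell_com =
     (let j = IAdd (var (-2)) (var (-2)); n = IAdd j (ISub (ISub (var (-1)) (var (-3))) (IConst 1))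
      in Seq (RAssign (IConst (-1)) (RMem (IAdd (IDiv (IMul n (IAdd n (IConst 1))) (IConst 2)) j)))
          (update_com (default_com pairs) pairs))"

definition row_com :: "'a com" where
  "row_com = For (-2) (IAdd (var (-5)) (ISub (var (-1)) (var (-3)))) cell_com"

definition rows_com :: "'a com" where
  "rows_com = For (-3) (var (-1)) row_com"

definition check_com :: "'a com" where
  "check_com = Seq (IAssign (IConst (-4)) (IConst 0))
     (For (-2) (IAdd (var (-5)) (IConst 1))
       (Cond (ieq (IMem (row (var (-2)))) (IConst unk)) (IAssign (IConst (-4)) (IConst 1)) Skip))"

definition stage_com :: "'a com" where
  "stage_com = Seq (IAssign (IConst (-1)) (IAdd (var (-1)) (IConst 1)))
     (Seq draw_com (Seq init_com (Seq rows_com check_com)))"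

text \<open>Cell \<open>-4\<close> starts at 1 to enter the loop. For an empty input, cells 0 and 1
  hold 0, so the left end and the width are 0 and a single cell is simulated.\<close>

definition setup_com :: "'a com" where
  "setup_com = Seq (IAssign (IConst (-1)) (IConst 0)) (Seq (IAssign (IConst (-4)) (IConst 1))
     (Seq (IAssign (IConst (-7)) (IConst 0)) (Seq (IAssign (IConst (-6)) (var 1))
     (IAssign (IConst (-5)) (ISub (IMem (var 0)) (var 1))))))"

definition copy_com :: "'a com" where
  "copy_com = For (-3) (var 0) (IAssign (IAdd (var (-3)) (IConst 1))
     (IMem (row (ISub (IMem (IAdd (var (-3)) (IConst 1))) (var (-6))))))"

definition program :: "'a com" where
  "program = Seq setup_com (Seq (While (ILess (IConst 0) (var (-4))) stage_com) copy_com)"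

end

lemma site_index:
  "int (site b (b + int j, t)) = (2 * int j + int t) * (2 * int j + int t + 1) div 2 + 2 * int j"
proof -
  have "site b (b + int j, t) = (2 * j + t) * (2 * j + t + 1) div 2 + 2 * j"
    by (simp add: site_def prod_encode_def Nat_Bijection.triangle_def int_encode_def sum_encode_def)
  then show ?thesis
    by (simp only: of_nat_add of_nat_mult zdiv_int of_nat_numeral of_nat_1)
qed

lemma site_bound:
  assumes "j \<le> w + n" "t \<le> n"
  shows "site b (b + int j, t) < (2 * w + 3 * n + 2) * (2 * w + 3 * n + 2)"
proof -
  have "site b (b + int j, t) = (2 * j + t) * (2 * j + t + 1) div 2 + 2 * j"
    by (simp add: site_def prod_encode_def Nat_Bijection.triangle_def int_encode_def sum_encode_def)
  also have "\<dots> \<le> (2 * j + t) * (2 * j + t + 1) + 2 * j"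
    by simp
  also have "\<dots> < (2 * j + t + 2) * (2 * j + t + 2)"
    by (simp add: algebra_simps)
  also have "\<dots> \<le> (2 * w + 3 * n + 2) * (2 * w + 3 * n + 2)"
    using assms by (intro mult_mono) auto
  finally show ?thesis .
qed

section \<open>Correctness of the program for fixed samples\<close>

locale sampler_run = sampler \<phi> \<alpha> ys code unk
  for \<phi> :: "'a::finite \<Rightarrow> 'a \<Rightarrow> 'a pmf" and \<alpha> ys code unk +
  fixes \<omega> :: "nat \<Rightarrow> real" and w :: nat and b :: int and m\<^sub>0 :: "int \<Rightarrow> int"
begin

definition base :: "nat \<Rightarrow> mstate \<Rightarrow> bool" where
  "base n s \<longleftrightarrow> imem s (-1) = int n \<and> imem s (-5) = int w \<and> imem s (-6) = b \<and>
     imem s (-7) = int (drawn s) \<and> (\<forall>i\<ge>0. imem s i = m\<^sub>0 i) \<and> (\<forall>i<drawn s. rmem s (int i) = \<omega> i)"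

definition cells :: "nat \<Rightarrow> nat \<Rightarrow> nat set \<Rightarrow> mstate \<Rightarrow> bool" where
  "cells r d J s \<longleftrightarrow> (\<forall>j\<in>J. imem s (- 10 - int j) = cd (known (site b) r d (b + int j) \<omega>))"

definition enough :: "nat \<Rightarrow> mstate \<Rightarrow> bool" where
  "enough n s \<longleftrightarrow> (2 * w + 3 * n + 2) * (2 * w + 3 * n + 2) \<le> drawn s"

lemma base_store:
  "a < 0 \<Longrightarrow> a \<notin> {-1, -5, -6, -7} \<Longrightarrow> base n (store a v s) \<longleftrightarrow> base n s"
  by (auto simp: base_def)

lemma cells_store: "a > - 10 \<Longrightarrow> cells r d J (store a v s) \<longleftrightarrow> cells r d J s"
  by (auto simp: cells_def)

lemma enough_store: "enough n (store a v s) \<longleftrightarrow> enough n s"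
  by (simp add: enough_def)

lemma exec_draw:
  assumes "base n s"
  shows "\<exists>t. exec \<phi> \<omega> draw_com s t \<and> base n t \<and> enough n t"
proof -
  let ?c = "Seq (Draw (var (-7))) (IAssign (IConst (-7)) (IAdd (var (-7)) (IConst 1)))"
  have "\<exists>t. exec \<phi> \<omega> draw_com s t \<and>
    (base n t \<and> imem t (-2) = int ((2 * w + 3 * n + 2) * (2 * w + 3 * n + 2)) \<and>
     (2 * w + 3 * n + 2) * (2 * w + 3 * n + 2) \<le> drawn t)"
    unfolding draw_com_def Let_def
  proof (rule exec_For[where I = "\<lambda>i t. base n t \<and> imem t (-2) = int i \<and> i \<le> drawn t"])
    fix i t assume I: "base n t \<and> imem t (-2) = int i \<and> i \<le> drawn t"
    define t' where "t' = t\<lparr>rmem := (rmem t)(int (drawn t) := \<omega> (drawn t)),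
      drawn := Suc (drawn t), imem := (imem t)(-7 := int (drawn t) + 1)\<rparr>"
    have "exec \<phi> \<omega> ?c t t'"
      using I exec_Seq[OF exec_Draw[of \<phi> \<omega> "var (-7)" t] exec_IAssign[of \<phi> \<omega> "IConst (-7)" "IAdd (var (-7)) (IConst 1)"]]
      by (simp add: t'_def base_def)
    moreover have "base n t'" "i < drawn t'" "imem t' (-2) = int i"
      using I by (auto simp: t'_def base_def less_Suc_eq)
    ultimately show "\<exists>t'. exec \<phi> \<omega> ?c t t' \<and>
        base n (store (-2) (imem t' (-2) + 1) t') \<and> imem (store (-2) (imem t' (-2) + 1) t') (-2) = int (Suc i) \<and>
        Suc i \<le> drawn (store (-2) (imem t' (-2) + 1) t')"
      by (intro exI[of _ t']) (simp add: base_store)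
  qed (use assms in \<open>auto simp: base_def algebra_simps\<close>)
  then show ?thesis by (auto simp: enough_def)
qed

lemma exec_init:
  assumes "base n s" "enough n s"
  shows "\<exists>t. exec \<phi> \<omega> init_com s t \<and> base n t \<and> enough n t \<and> cells 0 n {..w + n} t"
proof -
  have "\<exists>t. exec \<phi> \<omega> init_com s t \<and>
    (base n t \<and> enough n t \<and> imem t (-2) = int (w + n + 1) \<and> cells 0 n {..<w + n + 1} t)"
    unfolding init_com_def
  proof (rule exec_For[where I = "\<lambda>i t. base n t \<and> enough n t \<and> imem t (-2) = int i \<and> cells 0 n {..<i} t"])
    fix i t assume I: "base n t \<and> enough n t \<and> imem t (-2) = int i \<and> cells 0 n {..<i} t"
    let ?t = "store (- 10 - int i) unk t"
    have "exec \<phi> \<omega> (IAssign (row (var (-2))) (IConst unk)) t ?t"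
      using I exec_IAssign[of \<phi> \<omega> "row (var (-2))" "IConst unk" t] by simp
    moreover have "base n (store (-2) (imem ?t (-2) + 1) ?t)" "enough n (store (-2) (imem ?t (-2) + 1) ?t)"
      using I by (auto simp: base_def enough_def)
    moreover have "cells 0 n {..<Suc i} (store (-2) (imem ?t (-2) + 1) ?t)"
      using I by (auto simp: cells_def less_Suc_eq)
    ultimately show "\<exists>t'. exec \<phi> \<omega> (IAssign (row (var (-2))) (IConst unk)) t t' \<and>
        base n (store (-2) (imem t' (-2) + 1) t') \<and> enough n (store (-2) (imem t' (-2) + 1) t') \<and>
        imem (store (-2) (imem t' (-2) + 1) t') (-2) = int (Suc i) \<and>
        cells 0 n {..<Suc i} (store (-2) (imem t' (-2) + 1) t')"
      using I by (intro exI[of _ ?t]) auto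
  qed (use assms in \<open>auto simp: base_def enough_def cells_def\<close>)
  then show ?thesis by (auto simp: lessThan_Suc_atMost)
qed

text \<open>One array holds both rows: the new cell \<open>j\<close> needs the old cells
  \<open>j\<close> and \<open>j + 1\<close>, and no later cell reads the old cell \<open>j\<close>
  again.\<close>

lemma exec_cell:
  assumes s: "base n s" "enough n s" "imem s (-3) = int i" "imem s (-2) = int j"
    and ij: "i < n" "j < w + n - i"
    and new: "cells (Suc i) (n - 1 - i) {..<j} s" and old: "cells i (n - i) {j..w + n - i} s"
  shows "\<exists>t. exec \<phi> \<omega> cell_com s t \<and> base n t \<and> enough n t \<and> imem t (-3) = int i \<and> imem t (-2) = int j \<and>
    cells (Suc i) (n - 1 - i) {..<Suc j} t \<and> cells i (n - i) {Suc j..w + n - i} t"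
proof -
  define idx where "idx = site b (b + int j, n - 1 - i)"
  define s' where "s' = s\<lparr>rmem := (rmem s)(-1 := \<omega> idx)\<rparr>"
  have "idx < drawn s"
  proof (rule order.strict_trans2)
    show "idx < (2 * w + 3 * n + 2) * (2 * w + 3 * n + 2)"
      unfolding idx_def by (rule site_bound) (use ij in auto)
  qed (use s(2) in \<open>simp only: enough_def\<close>)
  then have u: "rmem s (int idx) = \<omega> idx"
    using s(1) by (auto simp: base_def)
  let ?j = "IAdd (var (-2)) (var (-2))"
  let ?n = "IAdd ?j (ISub (ISub (var (-1)) (var (-3))) (IConst 1))"
  let ?e = "IAdd (IDiv (IMul ?n (IAdd ?n (IConst 1))) (IConst 2)) ?j"
  have e: "ival s ?e = int idx"
  proof -
    have "int (n - 1 - i) = int n - int i - 1" using ij by simp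
    then show ?thesis
      unfolding idx_def site_index using s by (simp add: base_def)
  qed
  have 1: "exec \<phi> \<omega> (RAssign (IConst (-1)) (RMem ?e)) s s'"
    using exec_RAssign[of \<phi> \<omega> "IConst (-1)" "RMem ?e" s] unfolding s'_def rval.simps e u by simp
  let ?x = "known (site b) i (n - i) (b + int j) \<omega>" and ?y = "known (site b) i (n - i) (b + int j + 1) \<omega>"
  have x: "imem s' (- 10 - imem s' (-2)) = cd ?x"
    using old s(4) ij by (simp add: s'_def cells_def)
  have "Suc j \<in> {j..w + n - i}" using ij by auto
  from bspec[OF old[unfolded cells_def] this]
  have "imem s (- 10 - int (Suc j)) = cd (known (site b) i (n - i) (b + int (Suc j)) \<omega>)" .
  then have y: "imem s' (- 10 - (imem s' (-2) + 1)) = cd ?y"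
    using s(4) by (simp add: s'_def algebra_simps)
  from exec_update_com[OF x y] obtain t where t: "exec \<phi> \<omega> (update_com (default_com pairs) pairs) s' t"
    "sets_cell s' (cd (known_update ?x ?y (rmem s' (-1)))) t" by blast
  have "n - 1 - i + 1 = n - i" using ij by simp
  then have ku: "known_update ?x ?y (rmem s' (-1)) = known (site b) (Suc i) (n - 1 - i) (b + int j) \<omega>"
    unfolding known.simps(2) by (simp add: s'_def idx_def)
  have imem_t: "imem t = (imem s)(- 10 - int j := cd (known (site b) (Suc i) (n - 1 - i) (b + int j) \<omega>))"
    and t': "drawn t = drawn s" "\<And>i. i \<noteq> -1 \<Longrightarrow> rmem t i = rmem s i"
    using t(2) s(4) unfolding ku sets_cell_def by (auto simp: s'_def)
  have "exec \<phi> \<omega> cell_com s t"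
    unfolding cell_com_def Let_def using exec_Seq[OF 1 t(1)] .
  moreover have "base n t" "enough n t" "imem t (-3) = int i" "imem t (-2) = int j"
    using s t' by (auto simp: imem_t base_def enough_def)
  moreover have "cells (Suc i) (n - 1 - i) {..<Suc j} t" "cells i (n - i) {Suc j..w + n - i} t"
    using new old by (auto simp: cells_def imem_t less_Suc_eq simp del: known.simps)
  ultimately show ?thesis by blast
qed

lemma exec_row:
  assumes s: "base n s" "enough n s" "imem s (-3) = int i" and i: "i < n"
    and cells: "cells i (n - i) {..w + n - i} s"
  shows "\<exists>t. exec \<phi> \<omega> row_com s t \<and> base n t \<and> enough n t \<and> imem t (-3) = int i \<and>
    cells (Suc i) (n - Suc i) {..w + n - Suc i} t"
proof -
  let ?I = "\<lambda>j t. base n t \<and> enough n t \<and> imem t (-3) = int i \<and> imem t (-2) = int j \<and>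
    cells (Suc i) (n - 1 - i) {..<j} t \<and> cells i (n - i) {j..w + n - i} t"
  have "\<exists>t. exec \<phi> \<omega> row_com s t \<and> ?I (w + n - i) t"
    unfolding row_com_def
  proof (rule exec_For[where I = ?I])
    show "?I 0 (store (-2) 0 s)"
      using s cells by (auto simp: base_store enough_store cells_store) (auto simp: cells_def)
    show "ival t (IAdd (var (-5)) (ISub (var (-1)) (var (-3)))) = int (w + n - i)" if "?I j t" for j t
      using that i by (auto simp: base_def of_nat_diff)
    fix j t assume j: "j < w + n - i" and I: "?I j t"
    from exec_cell[of n t i j] I i j obtain t' where t': "exec \<phi> \<omega> cell_com t t'" "base n t'" "enough n t'"
      "imem t' (-3) = int i" "imem t' (-2) = int j"
      "cells (Suc i) (n - 1 - i) {..<Suc j} t'" "cells i (n - i) {Suc j..w + n - i} t'" by blast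
    then show "\<exists>t'. exec \<phi> \<omega> cell_com t t' \<and> ?I (Suc j) (store (-2) (imem t' (-2) + 1) t')"
      by (intro exI[of _ t']) (simp add: base_store enough_store cells_store del: known.simps)
  qed auto
  moreover have "{..<w + n - i} = {..w + n - Suc i}" using i by auto
  ultimately show ?thesis by auto
qed

lemma exec_rows:
  assumes s: "base n s" "enough n s" and cells: "cells 0 n {..w + n} s"
  shows "\<exists>t. exec \<phi> \<omega> rows_com s t \<and> base n t \<and> cells n 0 {..w} t"
proof -
  let ?I = "\<lambda>i t. base n t \<and> enough n t \<and> imem t (-3) = int i \<and> cells i (n - i) {..w + n - i} t"
  have "\<exists>t. exec \<phi> \<omega> rows_com s t \<and> ?I n t"
    unfolding rows_com_def
  proof (rule exec_For[where I = ?I])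
    fix i t assume i: "i < n" and I: "?I i t"
    from exec_row[of n t i] I i obtain t' where t': "exec \<phi> \<omega> row_com t t'" "base n t'" "enough n t'"
      "imem t' (-3) = int i" "cells (Suc i) (n - Suc i) {..w + n - Suc i} t'" by blast
    then show "\<exists>t'. exec \<phi> \<omega> row_com t t' \<and> ?I (Suc i) (store (-3) (imem t' (-3) + 1) t')"
      by (intro exI[of _ t']) (simp add: base_store enough_store cells_store del: known.simps)
  qed (use s cells in \<open>auto simp: base_store enough_store cells_store base_def\<close>)
  then show ?thesis by auto
qed

definition flag :: "nat \<Rightarrow> nat set \<Rightarrow> mstate \<Rightarrow> bool" where
  "flag n J s \<longleftrightarrow> imem s (-4) = (if \<exists>j\<in>J. known (site b) n 0 (b + int j) \<omega> = None then 1 else 0)"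

lemma exec_check:
  assumes s: "base n s" and cells: "cells n 0 {..w} s"
  shows "\<exists>t. exec \<phi> \<omega> check_com s t \<and> base n t \<and> cells n 0 {..w} t \<and> flag n {..w} t"
proof -
  let ?I = "\<lambda>j t. base n t \<and> cells n 0 {..w} t \<and> imem t (-2) = int j \<and> flag n {..<j} t"
  let ?c = "Cond (ieq (IMem (row (var (-2)))) (IConst unk)) (IAssign (IConst (-4)) (IConst 1)) Skip"
  let ?s = "store (-4) 0 s"
  have "\<exists>t. exec \<phi> \<omega> (For (-2) (IAdd (var (-5)) (IConst 1)) ?c) ?s t \<and> ?I (w + 1) t"
  proof (rule exec_For[where I = ?I])
    show "?I 0 (store (-2) 0 ?s)"
      using s cells by (auto simp: base_def cells_def flag_def)
    fix j t assume j: "j < w + 1" and I: "?I j t"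
    then have cell: "imem t (- 10 - int j) = cd (known (site b) n 0 (b + int j) \<omega>)"
      by (auto simp: cells_def)
    show "\<exists>t'. exec \<phi> \<omega> ?c t t' \<and> ?I (Suc j) (store (-2) (imem t' (-2) + 1) t')"
    proof (cases "known (site b) n 0 (b + int j) \<omega> = None")
      case True
      then have "exec \<phi> \<omega> ?c t (store (-4) 1 t)"
        using I cell exec_IAssign[of \<phi> \<omega> "IConst (-4)" "IConst 1" t] by (intro exec_CondT) (auto simp: cd_eq)
      then show ?thesis
        using I True by (intro exI[of _ "store (-4) 1 t"]) (auto simp: base_def cells_def flag_def lessThan_Suc)
    next
      case False
      then have "exec \<phi> \<omega> ?c t t"
        using I cell by (intro exec_CondF exec_Skip) (auto simp: cd_eq)
      then show ?thesis
        using I False by (intro exI[of _ t]) (auto simp: base_store cells_store flag_def lessThan_Suc)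
    qed
  qed (auto simp: base_def)
  then obtain t where "exec \<phi> \<omega> (For (-2) (IAdd (var (-5)) (IConst 1)) ?c) ?s t" "?I (w + 1) t" by blast
  then show ?thesis
    unfolding check_com_def using exec_Seq[OF exec_IAssign[of \<phi> \<omega> "IConst (-4)" "IConst 0" s]]
    by (auto simp: lessThan_Suc_atMost)
qed

text \<open>The contents of the row are claimed only once the flag is 0, since nothing has been
  computed before the first pass.\<close>

definition stage :: "nat \<Rightarrow> mstate \<Rightarrow> bool" where
  "stage n s \<longleftrightarrow> base n s \<and> flag n {..w} s \<and> (imem s (-4) = 0 \<longrightarrow> cells n 0 {..w} s)"

lemma exec_stage:
  assumes "stage n s"
  shows "\<exists>t. exec \<phi> \<omega> stage_com s t \<and> stage (Suc n) t"
proof -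
  have 1: "exec \<phi> \<omega> (IAssign (IConst (-1)) (IAdd (var (-1)) (IConst 1))) s (store (-1) (int (Suc n)) s)"
    using exec_IAssign[of \<phi> \<omega> "IConst (-1)" "IAdd (var (-1)) (IConst 1)" s] assms
    by (simp add: stage_def base_def add.commute)
  have "base (Suc n) (store (-1) (int (Suc n)) s)"
    using assms by (auto simp: stage_def base_def)
  from exec_draw[OF this] obtain t1 where
    t1: "exec \<phi> \<omega> draw_com (store (-1) (int (Suc n)) s) t1" "base (Suc n) t1" "enough (Suc n) t1" by blast
  from exec_init[OF t1(2,3)] obtain t2 where
    t2: "exec \<phi> \<omega> init_com t1 t2" "base (Suc n) t2" "enough (Suc n) t2" "cells 0 (Suc n) {..w + Suc n} t2" by blast
  from exec_rows[OF t2(2-4)] obtain t3 where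
    t3: "exec \<phi> \<omega> rows_com t2 t3" "base (Suc n) t3" "cells (Suc n) 0 {..w} t3" by blast
  from exec_check[OF t3(2,3)] obtain t4 where
    t4: "exec \<phi> \<omega> check_com t3 t4" "base (Suc n) t4" "cells (Suc n) 0 {..w} t4" "flag (Suc n) {..w} t4" by blast
  have "exec \<phi> \<omega> stage_com s t4"
    unfolding stage_com_def by (rule exec_Seq[OF 1 exec_Seq[OF t1(1) exec_Seq[OF t2(1) exec_Seq[OF t3(1) t4(1)]]]])
  then show ?thesis using t4 by (auto simp: stage_def)
qed

abbreviation loop :: "'a com" where
  "loop \<equiv> While (ILess (IConst 0) (var (-4))) stage_com"

definition all_known :: "nat \<Rightarrow> bool" where
  "all_known n \<longleftrightarrow> (\<forall>j\<le>w. known (site b) n 0 (b + int j) \<omega> \<noteq> None)"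

lemma stage_flag: "stage n s \<Longrightarrow> imem s (-4) = (if all_known n then 0 else 1)"
  by (auto simp: stage_def flag_def all_known_def)

lemma exec_loop:
  assumes "stage n s" "all_known (n + m)"
  shows "\<exists>n' t. exec \<phi> \<omega> loop s t \<and> stage n' t \<and> all_known n'"
  using assms
proof (induction m arbitrary: n s)
  case 0
  then show ?case
    using exec_WhileF[of \<phi> s "ILess (IConst 0) (var (-4))" \<omega> stage_com] stage_flag[of n s] by auto
next
  case (Suc m)
  show ?case
  proof (cases "all_known n")
    case True
    then show ?thesis
      using Suc.prems exec_WhileF[of \<phi> s "ILess (IConst 0) (var (-4))" \<omega> stage_com] stage_flag[of n s] by auto
  next
    case False
    from exec_stage[OF Suc.prems(1)] obtain t where t: "exec \<phi> \<omega> stage_com s t" "stage (Suc n) t" by blast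
    from Suc.IH[OF t(2)] Suc.prems obtain n' t' where "exec \<phi> \<omega> loop t t'" "stage n' t'" "all_known n'"
      by auto
    moreover have "bval \<phi> s (ILess (IConst 0) (var (-4)))"
      using False stage_flag[OF Suc.prems(1)] by simp
    ultimately show ?thesis using exec_WhileT t(1) by blast
  qed
qed

text \<open>The converse of \<open>exec_loop\<close>, by induction on the given finite run;
  determinism identifies its intermediate states with the stages constructed before.\<close>

lemma exec_loop_known:
  assumes "exec \<phi> \<omega> c s t" "c = loop" "stage n s"
  shows "\<exists>n. all_known n"
  using assms
proof (induction arbitrary: n rule: exec.induct)
  case (exec_WhileF s b c)
  then show ?case using stage_flag[of n s] by (auto split: if_splits)
next
  case (exec_WhileT s b c s' s'')
  from exec_stage[OF exec_WhileT.prems(2)] obtain t where t: "exec \<phi> \<omega> stage_com s t" "stage (Suc n) t"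
    by blast
  moreover have "s' = t"
    using exec_deterministic t(1) exec_WhileT.hyps(2) exec_WhileT.prems(1) by blast
  ultimately show ?case using exec_WhileT.IH(2) exec_WhileT.prems(1) by blast
qed simp_all

end

section \<open>Halting and the law of the output\<close>

definition left :: "int set \<Rightarrow> int" where
  "left A = imem (input_state A) 1"

definition width :: "int set \<Rightarrow> nat" where
  "width A = nat (imem (input_state A) (int (card A)) - left A)"

lemma imem_input:
  "imem (input_state A) 0 = int (card A)"
  "i < card A \<Longrightarrow> imem (input_state A) (int i + 1) = sorted_list_of_set A ! i"
  "drawn (input_state A) = 0"
  by (auto simp: input_state_def)

lemma left_width:
  assumes "finite A"
  shows "left A + int (width A) = imem (input_state A) (int (card A))"
    and "i < card A \<Longrightarrow> \<exists>j\<le>width A. sorted_list_of_set A ! i = left A + int j"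
proof -
  let ?l = "sorted_list_of_set A"
  have "left A + int (width A) = imem (input_state A) (int (card A)) \<and>
    (\<forall>i<card A. \<exists>j\<le>width A. ?l ! i = left A + int j)"
  proof (cases "card A = 0")
    case True
    then show ?thesis by (simp add: left_def width_def input_state_def)
  next
    case False
    have left: "left A = ?l ! 0"
      using imem_input(2)[of 0 A] False by (simp add: left_def)
    have last: "imem (input_state A) (int (card A)) = ?l ! (card A - 1)"
      using imem_input(2)[of "card A - 1" A] False by (simp add: of_nat_diff)
    have mono: "?l ! i \<le> ?l ! i'" if "i \<le> i'" "i' < card A" for i i'
      using that by (intro sorted_nth_mono) auto
    have le: "left A \<le> imem (input_state A) (int (card A))"
      unfolding left last using False by (intro mono) auto
    have "\<exists>j\<le>width A. ?l ! i = left A + int j" if "i < card A" for i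
    proof (intro exI conjI)
      have "left A \<le> ?l ! i" "?l ! i \<le> imem (input_state A) (int (card A))"
        unfolding left last using that by (auto intro: mono)
      then show "nat (?l ! i - left A) \<le> width A" "?l ! i = left A + int (nat (?l ! i - left A))"
        by (auto simp: width_def)
    qed
    with le show ?thesis by (simp add: width_def)
  qed
  then show "left A + int (width A) = imem (input_state A) (int (card A))"
    "i < card A \<Longrightarrow> \<exists>j\<le>width A. sorted_list_of_set A ! i = left A + int j"
    by blast+
qed

context sampler
begin

text \<open>The program waits for the whole interval spanned by the input, not only for the cells of
  \<open>A\<close>.\<close>

definition halts :: "int set \<Rightarrow> (nat \<Rightarrow> real) \<Rightarrow> bool" where
  "halts A \<omega> \<longleftrightarrow> (\<exists>n. \<forall>j\<in>{..width A}. known (site (left A)) n 0 (left A + int j) \<omega> \<noteq> None)"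

lemma exec_program:
  assumes A: "finite A"
  shows "(\<exists>s. exec \<phi> \<omega> program (input_state A) s \<and> has_output code A s y) \<longleftrightarrow>
      halts A \<omega> \<and> (\<forall>k\<in>A. known_limit (site (left A)) k \<omega> = y k)"
    and "(\<exists>s. exec \<phi> \<omega> program (input_state A) s) \<longleftrightarrow> halts A \<omega>"
proof -
  let ?l = "sorted_list_of_set A" and ?s = "input_state A" and ?g = "site (left A)"
  interpret sampler_run \<phi> \<alpha> ys code unk \<omega> "width A" "left A" "imem ?s"
    by unfold_locales
  have halts: "halts A \<omega> \<longleftrightarrow> (\<exists>n. all_known n)"
    by (simp add: halts_def all_known_def Ball_def)
  define s\<^sub>0 where "s\<^sub>0 = store (-5) (int (width A)) (store (-6) (left A) (store (-7) 0 (store (-4) 1 (store (-1) 0 ?s))))"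
  have w: "imem ?s (int (card A)) - imem ?s 1 = int (width A)"
    using left_width(1)[OF A] by (simp add: left_def)
  have start: "exec \<phi> \<omega> setup_com ?s s\<^sub>0"
  proof -
    let ?s1 = "store (-1) 0 ?s" and ?s2 = "store (-4) 1 (store (-1) 0 ?s)"
      and ?s3 = "store (-7) 0 (store (-4) 1 (store (-1) 0 ?s))"
      and ?s4 = "store (-6) (left A) (store (-7) 0 (store (-4) 1 (store (-1) 0 ?s)))"
    have "exec \<phi> \<omega> (IAssign (IConst (-1)) (IConst 0)) ?s ?s1"
      using exec_IAssign[of \<phi> \<omega> "IConst (-1)" "IConst 0" ?s] by simp
    moreover have "exec \<phi> \<omega> (IAssign (IConst (-4)) (IConst 1)) ?s1 ?s2"
      using exec_IAssign[of \<phi> \<omega> "IConst (-4)" "IConst 1" ?s1] by simp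
    moreover have "exec \<phi> \<omega> (IAssign (IConst (-7)) (IConst 0)) ?s2 ?s3"
      using exec_IAssign[of \<phi> \<omega> "IConst (-7)" "IConst 0" ?s2] by simp
    moreover have "exec \<phi> \<omega> (IAssign (IConst (-6)) (var 1)) ?s3 ?s4"
      using exec_IAssign[of \<phi> \<omega> "IConst (-6)" "var 1" ?s3] by (simp add: left_def)
    moreover have "exec \<phi> \<omega> (IAssign (IConst (-5)) (ISub (IMem (var 0)) (var 1))) ?s4 s\<^sub>0"
      using exec_IAssign[of \<phi> \<omega> "IConst (-5)" "ISub (IMem (var 0)) (var 1)" ?s4] w
      by (simp add: s\<^sub>0_def imem_input(1))
    ultimately show ?thesis
      unfolding setup_com_def by (blast intro: exec_Seq)
  qed
  have stage0: "stage 0 s\<^sub>0"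
    by (auto simp: stage_def base_def flag_def s\<^sub>0_def imem_input(3))
  have run: "\<exists>s. exec \<phi> \<omega> program ?s s \<and> (\<forall>i<card A. imem s (int i + 1) = code (known_limit ?g (?l ! i) \<omega>))"
    if "halts A \<omega>"
  proof -
    from that obtain m where "all_known (0 + m)" by (auto simp: halts)
    from exec_loop[OF stage0 this] obtain n t where
      t: "exec \<phi> \<omega> loop s\<^sub>0 t" "stage n t" "all_known n" by blast
    from t(2,3) have t': "base n t" "cells n 0 {..width A} t"
      using stage_flag[of n t] by (auto simp: stage_def)
    let ?I = "\<lambda>i s. imem s (-3) = int i \<and> imem s (-6) = left A \<and> imem s 0 = int (card A) \<and>
      cells n 0 {..width A} s \<and> (\<forall>i'<i. imem s (int i' + 1) = code (known_limit ?g (?l ! i') \<omega>)) \<and>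
      (\<forall>i'. i \<le> i' \<and> i' < card A \<longrightarrow> imem s (int i' + 1) = ?l ! i')"
    let ?e = "IMem (row (ISub (IMem (IAdd (var (-3)) (IConst 1))) (var (-6)))) :: iexp"
    have "\<exists>s. exec \<phi> \<omega> copy_com t s \<and> ?I (card A) s"
      unfolding copy_com_def
    proof (rule exec_For[where I = ?I])
      show "?I 0 (store (-3) 0 t)"
        using t' by (auto simp: base_def cells_store imem_input)
      fix i s assume i: "i < card A" and I: "?I i s"
      from left_width(2)[OF A i] obtain j where j: "j \<le> width A" "?l ! i = left A + int j" by blast
      from t(3) j(1) obtain c where c: "known ?g n 0 (left A + int j) \<omega> = Some c"
        by (auto simp: all_known_def)
      from I j c have "imem s (- 10 - int j) = code c"
        by (auto simp: cells_def)
      \<comment> \<open>The stage at which the loop stopped does not matter: a known value is the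
        limit value.\<close>
      then have e: "ival s ?e = code (known_limit ?g (?l ! i) \<omega>)"
        using I i j known_limit_eq[OF c] by simp
      let ?s' = "store (int i + 1) (code (known_limit ?g (?l ! i) \<omega>)) s"
      have "exec \<phi> \<omega> (IAssign (IAdd (var (-3)) (IConst 1)) ?e) s ?s'"
        using exec_IAssign[of \<phi> \<omega> "IAdd (var (-3)) (IConst 1)" ?e s] I unfolding e by simp
      moreover have "?I (Suc i) (store (-3) (imem ?s' (-3) + 1) ?s')"
        using I by (auto simp: cells_def less_Suc_eq)
      ultimately show "\<exists>t'. exec \<phi> \<omega> (IAssign (IAdd (var (-3)) (IConst 1)) ?e) s t' \<and>
          ?I (Suc i) (store (-3) (imem t' (-3) + 1) t')" by blast
    qed auto
    then obtain u where "exec \<phi> \<omega> copy_com t u" "?I (card A) u" by blast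
    then show ?thesis
      unfolding program_def using exec_Seq[OF start exec_Seq[OF t(1)]] by blast
  qed
  have halt: "halts A \<omega>" if "exec \<phi> \<omega> program ?s s" for s
  proof -
    from that obtain s' t where s': "exec \<phi> \<omega> setup_com ?s s'" and t: "exec \<phi> \<omega> loop s' t"
      unfolding program_def by (auto elim!: exec_SeqE)
    have "s' = s\<^sub>0" using exec_deterministic[OF s' start] .
    with exec_loop_known[OF t refl] stage0 show ?thesis unfolding halts by blast
  qed
  show "(\<exists>s. exec \<phi> \<omega> program ?s s) \<longleftrightarrow> halts A \<omega>"
    using run halt by blast
  show "(\<exists>s. exec \<phi> \<omega> program ?s s \<and> has_output code A s y) \<longleftrightarrow>
      halts A \<omega> \<and> (\<forall>k\<in>A. known_limit ?g k \<omega> = y k)"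
  proof (cases "halts A \<omega>")
    case True
    from run[OF this] obtain s where s: "exec \<phi> \<omega> program ?s s"
      "\<forall>i<card A. imem s (int i + 1) = code (known_limit ?g (?l ! i) \<omega>)" by blast
    have "has_output code A s y \<longleftrightarrow> (\<forall>i<length ?l. known_limit ?g (?l ! i) \<omega> = y (?l ! i))"
      using s(2) inj_code by (auto simp: has_output_def inj_eq)
    also have "\<dots> \<longleftrightarrow> (\<forall>k\<in>set ?l. known_limit ?g k \<omega> = y k)"
      by (auto simp: all_set_conv_all_nth)
    finally have "has_output code A s y \<longleftrightarrow> (\<forall>k\<in>A. known_limit ?g k \<omega> = y k)"
      using A by simp
    then show ?thesis
      using s(1) True exec_deterministic by blast
  next
    case False
    with halt show ?thesis by blast
  qed
qed

definition some_unknown :: "int set \<Rightarrow> nat \<Rightarrow> (nat \<Rightarrow> real) set" where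
  "some_unknown A n = (\<Union>j\<in>{..width A}. {\<omega>. known (site (left A)) n 0 (left A + int j) \<omega> = None})"

lemma halts_iff: "halts A \<omega> \<longleftrightarrow> (\<exists>n. \<omega> \<notin> some_unknown A n)"
  by (simp add: halts_def some_unknown_def)

lemma some_unknown_sets: "some_unknown A n \<in> sets uniform_samples"
  unfolding some_unknown_def by (rule sets.finite_UN) (simp_all add: known_sets)

lemma halts_sets: "{\<omega>. halts A \<omega>} \<in> sets uniform_samples"
proof -
  have "{\<omega>. halts A \<omega>} = (\<Union>n. space uniform_samples - some_unknown A n)"
    by (auto simp: halts_iff)
  also have "\<dots> \<in> sets uniform_samples"
    using some_unknown_sets by (intro sets.countable_UN) blast
  finally show ?thesis .
qed

text \<open>Halting needs just one good horizon, and at a far horizon a union bound over the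
  interval makes the failure as unlikely as desired.\<close>

lemma prob_halts: "prob {\<omega>. halts A \<omega>} = 1"
proof -
  have "1 - prob {\<omega>. halts A \<omega>} \<le> 0 + e" if "e > 0" for e
  proof -
    from small_multiple[OF that, of "Suc (width A)"] obtain \<delta> where \<delta>: "\<delta> > 0" "real (Suc (width A)) * \<delta> < e" .
    from known_eventually[OF \<delta>(1)] obtain n where
      n: "\<forall>n'\<ge>n. \<forall>g k. inj g \<longrightarrow> prob {\<omega>. known g n' 0 k \<omega> = None} \<le> \<delta>" ..
    have "1 - prob {\<omega>. halts A \<omega>} = prob (space uniform_samples - {\<omega>. halts A \<omega>})"
      by (rule samples.prob_compl[OF halts_sets, symmetric])
    also have "\<dots> \<le> prob (some_unknown A n)"
      by (rule samples.finite_measure_mono[OF _ some_unknown_sets]) (auto simp: halts_iff)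
    also have "\<dots> \<le> (\<Sum>j\<in>{..width A}. prob {\<omega>. known (site (left A)) n 0 (left A + int j) \<omega> = None})"
      unfolding some_unknown_def
      by (rule samples.finite_measure_subadditive_finite) (use known_sets in blast)+
    also have "\<dots> \<le> (\<Sum>j\<in>{..width A}. \<delta>)"
      by (rule sum_mono) (rule n[rule_format, OF order_refl inj_site])
    also have "\<dots> \<le> 0 + e" using \<delta>(2) by simp
    finally show ?thesis .
  qed
  then have "1 - prob {\<omega>. halts A \<omega>} \<le> 0"
    by (rule field_le_epsilon)
  with samples.prob_le_1[of "{\<omega>. halts A \<omega>}"] show ?thesis by linarith
qed

text \<open>Halting is almost sure, so requiring it does not bias the output; its law is that of the
  limit for the numbering based at \<open>left A\<close>.\<close>

lemma perfect_sampling: "perfect_sampling_algorithm code \<phi> \<pi> program"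
  unfolding perfect_sampling_algorithm_def
proof (intro allI impI conjI)
  fix A :: "int set" assume A: "finite A"
  show ae: "AE \<omega> in uniform_samples. \<exists>s. exec \<phi> \<omega> program (input_state A) s"
    unfolding exec_program(2)[OF A]
    using samples.AE_prob_1[OF prob_halts[of A]] by simp
  fix y
  let ?E = "{\<omega>. \<exists>s. exec \<phi> \<omega> program (input_state A) s \<and> has_output code A s y}"
  let ?K = "{\<omega>. \<forall>k\<in>A. known_limit (site (left A)) k \<omega> = y k}"
  have E: "?E = {\<omega>. halts A \<omega>} \<inter> ?K"
    using exec_program(1)[OF A] by auto
  show sets: "?E \<in> sets uniform_samples"
    unfolding E by (intro sets.Int halts_sets known_limits_sets A)
  have "prob ?E = prob ?K"
  proof (rule measure_eq_AE)
    show "AE \<omega> in uniform_samples. (\<omega> \<in> ?E) = (\<omega> \<in> ?K)"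
      using ae unfolding E exec_program(2)[OF A] by eventually_elim simp
  qed (rule sets, rule known_limits_sets[OF A])
  also have "\<dots> = measure \<pi> (cyl A y)"
    by (rule prob_known_limit[OF inj_site A])
  finally show "prob ?E = measure \<pi> (cyl A y)" .
qed

end

theorem theorem3p11:
  fixes f :: "'a::finite \<Rightarrow> 'a \<Rightarrow> 'a" and \<alpha> :: 'a
  assumes "spreading (ca_map f) \<alpha>"
  shows "\<exists>\<epsilon>\<^sub>c>0. \<forall>\<epsilon><\<epsilon>\<^sub>c. \<forall>\<phi>. perturbation \<epsilon> f \<phi> \<and> positive_at \<alpha> \<phi> \<longrightarrow>
           (\<exists>\<pi>. uniformly_ergodic_to (pca \<phi>) \<pi> \<and> spatially_mixing \<pi> \<and>
                 admits_perfect_sampling \<phi> \<pi>)"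
proof (intro exI[of _ eps] conjI allI impI)
  show "eps > 0" by (rule eps_bounds)
  fix \<epsilon> :: real and \<phi>
  assume \<epsilon>: "\<epsilon> < eps" and \<phi>: "perturbation \<epsilon> f \<phi> \<and> positive_at \<alpha> \<phi>"
  obtain ys where ys: "set ys = UNIV - {\<alpha>}" "distinct ys"
    using finite_distinct_list[of "UNIV - {\<alpha>}"] by auto
  have f: "f a b = \<alpha>" if "a = \<alpha> \<or> b = \<alpha>" for a b
  proof -
    \<comment> \<open>A configuration showing \<open>a\<close> and \<open>b\<close> at the cells 0
      and 1 turns spreading into a property of the local rule.\<close>
    define x where "x k = (if k = 0 then a else b)" for k :: int
    have "x 0 = \<alpha> \<or> x (0 + 1) = \<alpha>" using that by (simp add: x_def)
    then have "ca_map f x 0 = \<alpha>" using assms unfolding spreading_def by blast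
    then show ?thesis by (simp add: ca_map_def x_def)
  qed
  interpret noisy_ca \<phi> \<alpha> ys
  proof
    show "distinct (\<alpha> # ys)" "set (\<alpha> # ys) = UNIV" using ys by auto
    show "0 < pmf (\<phi> a b) \<alpha>" for a b
      using \<phi> by (simp add: positive_at_def)
    show "1 - eps \<le> pmf (\<phi> a b) \<alpha>" if "a = \<alpha> \<or> b = \<alpha>" for a b
    proof -
      have "1 - \<epsilon> \<le> pmf (\<phi> a b) (f a b)"
        using \<phi> by (simp add: perturbation_def)
      with f[OF that] \<epsilon> show ?thesis by simp
    qed
  qed
  have "admits_perfect_sampling \<phi> \<pi>"
    unfolding admits_perfect_sampling_def
  proof (intro allI impI)
    fix code :: "'a \<Rightarrow> int" assume "inj code"
    obtain unk where "unk \<notin> range code"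
      using ex_new_if_finite[OF infinite_UNIV_int, of "range code"] by auto
    with \<open>inj code\<close> interpret sampler \<phi> \<alpha> ys code unk
      by unfold_locales
    show "\<exists>c. perfect_sampling_algorithm code \<phi> \<pi> c"
      using perfect_sampling by blast
  qed
  with uniformly_ergodic spatially_mixing_\<pi>
  show "\<exists>\<pi>. uniformly_ergodic_to (pca \<phi>) \<pi> \<and> spatially_mixing \<pi> \<and> admits_perfect_sampling \<phi> \<pi>"
    by blast
qed

end
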